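(* Let $\Omega'$ be a connected open subset of $\mathbb{R}^{n-1}$ and $\Omega=\Omega'\times\,]-1,1[$. Write coordinates in $\Omega$ as $x=(x',x_n)$ with $x'\in\Omega'$, $x_n\in\,]-1,1[$, and let $\xi=(\xi',\xi_n)\in\mathbb{R}^n\setminus\{0\}$ be the corresponding covariable. Let $\psi=\psi(x,\xi)$ be an admissible phase function which locally represents, near the boundary $\{x_n=0\}$, the extension $\tilde\chi$ of a boundary-preserving symplectomorphism $\chi$ (see context), let $\psi_\partial(x',\xi')=\psi(x',0,\xi',\xi_n)$, and let $$\varphi(x,\xi)=\psi(x,\xi)-\psi_\partial(x',\xi').$$ For $k,K>0$ let $$\Phi(x,\xi)=\omega_k(x_n)\,\varphi(x,\xi)+(1-\omega_k(x_n))\,K\,x_n\,\xi_n .$$ For $x'\in\Omega'$, $\xi'\in\mathbb{R}^{n-1}\setminus\{0\}$ and $(t,\tau)\in\mathbb{R}^2$ define $${}^*\Phi(t,\tau)={}^*\Phi_{x',\xi'}(t,\tau)=\Phi\Big(x',\tfrac{t}{\langle\xi'\rangle},\xi',\tau\langle\xi'\rangle\Big) =\omega_k\Big(\tfrac{t}{\langle\xi'\rangle}\Big)\varphi\Big(x',\tfrac{t}{\langle\xi'\rangle},\xi',\tau\langle\xi'\rangle\Big)+\Big[1-\omega_k\Big(\tfrac{t}{\langle\xi'\rangle}\Big)\Big]K\,t\,\tau ,$$ where $k>0$ is taken small enough that $\psi$ is well defined for $x_n\in[-2k,2k]$, and the first summand in the last expression is extended by $0$ for $|t|/\langle\xi'\rangle\ge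 2k$. Then, provided $K$ is large enough and $k$ is small enough, ${}^*\Phi$ is a regular SG phase function, that is: (P1) for all $a,\alpha\in\mathbb{Z}_+$ there exists $C_{a\alpha}>0$ such that $|D_t^aD_\tau^\alpha\,{}^*\Phi(t,\tau)|\le C_{a\alpha}\langle t\rangle^{1-a}\langle\tau\rangle^{1-\alpha}$ for all $t,\tau\in\mathbb{R}$; (P2) there exist $c,C>0$ such that $c\langle\tau\rangle\le\langle\partial_t{}^*\Phi(t,\tau)\rangle\le C\langle\tau\rangle$ and $c\langle t\rangle\le\langle\partial_\tau{}^*\Phi(t,\tau)\rangle\le C\langle t\rangle$ for all $t,\tau\in\mathbb{R}$; (P3) there exists $\varepsilon>0$ such that $|\partial_t\partial_\tau{}^*\Phi(t,\tau)|\ge\varepsilon$ for all $t,\tau\in\mathbb{R}$. Moreover, for $U'\subset\subset\Omega'$, the constants $C_{a\alpha}$ ($a,\alpha\in\mathbb{Z}_+$), $c$, $C$, $\varepsilon$ in (P1), (P2), (P3) do not depend on $(x',\xi')\in U'\times(\mathbb{R}^{n-1}\setminus\{0\})$.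
   Context: Notation: $\langle v\rangle=(1+|v|^2)^{1/2}$. The function $\omega\in C^\infty(\mathbb{R})$ is even, non-increasing on $\mathbb{R}_+$, with $\omega\equiv1$ on $[0,1/2]$ and $\omega(t)=0$ for $t\ge1$; $\omega_k(t)=\omega(t/k)$ for $k>0$. Symplectomorphisms. $X$ and $Y$ are compact $n$-dimensional manifolds with boundary and $\chi:T^*Y\setminus0\to T^*X\setminus0$ is a symplectomorphism, positively homogeneous of degree $1$ in the fibers, which preserves the boundary, i.e. $\pi_{\partial X}\circ\chi=b\circ\pi_{\partial Y}$ over the boundary, with a diffeomorphism $b:\partial Y\to\partial X$ and the canonical projections $\pi_{\partial X},\pi_{\partial Y}$ at the boundaries. It extends to a symplectomorphism $\tilde\chi:T^*\widetilde Y\setminus0\to T^*\widetilde X\setminus0$, where $\widetilde Y,\widetilde X$ are neighborhoods of $Y,X$ in closed $n$-dimensional manifolds containing them. Local coordinates $y=(y',y_n)$ on $\widetilde Y$ and $x=(x',x_n)$ on $\widetilde X$ near the boundary are chosen so that $y_n$, $x_n$ are boundary defining functions of $Y$, $X$ (zero on the boundary, positive in the interior). Phase functions. A real-valued $\psi(x,\xi)$, smooth for $\xi\ne0$ and positively homogeneous of degree $1$ in $\xi$, locally represents $\tilde\chi$ if $\phi(x,y,\xi)=\psi(x,\xi)-\langle y,\xi\rangle$ is a phase function parametrizing the Lagrangian submanifold given by the graph of $\tilde\chi$; that is, $\tilde\chi(\psi'_\xi(x,\xi),\xi)=(x,\psi'_x(x,\xi))$ and $(x,\xi)\mapsto(\psi'_\xi(x,\xi),\xi)$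 is locally a diffeomorphism. Because the boundary is preserved, $\psi(x',0,\xi',\xi_n)$ is independent of $\xi_n$, so that $\psi_\partial(x',\xi')=\psi(x',0,\xi',\xi_n)$ is well defined; it is linear in $\xi'$ and generates the symplectomorphism $\chi_\partial:T^*\partial Y\setminus 0\to T^*\partial X\setminus 0$ induced by $\chi$. Admissibility. A function $p(x,\xi)$ positively homogeneous of degree $m$ in $\xi$ satisfies the transmission condition at $x_n=0$ if, for all $l\in\mathbb{N}$, $\alpha,\beta\in\mathbb{N}^{n-1}$, $$\partial_{x_n}^l\partial_{\xi'}^\alpha\partial_{x'}^\beta p(x',0,0,1)=(-1)^{m-|\alpha|}\partial_{x_n}^l\partial_{\xi'}^\alpha\partial_{x'}^\beta p(x',0,0,-1),$$ the last two arguments being $(\xi',\xi_n)$. The symplectomorphism is admissible if all its components (in local coordinates) satisfy the transmission condition at the boundary; a phase function $\psi$ representing an admissible symplectomorphism is called admissible, and then the first derivatives of $\psi$ satisfy the transmission condition. Convention: whenever $\psi$ is referred to as a symbol, this is understood after a modification near $|\xi|=0$; the precise form of the modification is regarded as irrelevant (modulo operators with smooth kernel).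
   Formalization: For homogeneous ψ the C_{aα} are uniform only for |ξ'|≥r (uniformity fails as ξ'→0); uniformity over all ξ'≠0 is shown for every smooth modification of ψ near ξ=0 that stays nondegenerate, with ξ_n-independent value, at x_n=0; such exist. K, k depend on U'. *)

theory Defs
  imports "HOL-Analysis.Analysis"
begin

text \<open>
  Everything is written in local coordinates. A point of \<open>\<real>\<^sup>n\<close> is a pair \<open>(x', x\<^sub>n)\<close> with
  \<open>x' :: real ^ 'm\<close>, so \<open>n = CARD('m) + 1 \<ge> 2\<close>; covectors \<open>\<xi> = (\<xi>', \<xi>\<^sub>n)\<close> have the same type, and
  \<open>(x, \<xi>)\<close> is a point of the cotangent bundle.
\<close>

type_synonym 'm point = "(real ^ 'm) \<times> real"
type_synonym 'm cotangent = "'m point \<times> 'm point"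


subsection \<open>Smooth maps and diffeomorphisms on open sets\<close>

primrec Ck_on ::
  "nat \<Rightarrow> 'a::real_normed_vector set \<Rightarrow> ('a \<Rightarrow> 'b::real_normed_vector) \<Rightarrow> bool" where
  "Ck_on 0 S f \<longleftrightarrow> continuous_on S f"
| "Ck_on (Suc k) S f \<longleftrightarrow>
     (\<forall>x\<in>S. f differentiable (at x)) \<and> (\<forall>v. Ck_on k S (\<lambda>x. frechet_derivative f (at x) v))"

text \<open>Only used for open sets, since derivatives are taken at \<open>x\<close> and not within \<open>S\<close>.\<close>

definition smooth_on ::
  "'a::real_normed_vector set \<Rightarrow> ('a \<Rightarrow> 'b::real_normed_vector) \<Rightarrow> bool" where
  "smooth_on S f \<longleftrightarrow> (\<forall>k. Ck_on k S f)"

definition diffeo_on ::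
  "'a::real_normed_vector set \<Rightarrow> 'b::real_normed_vector set \<Rightarrow> ('a \<Rightarrow> 'b) \<Rightarrow> bool" where
  "diffeo_on S T f \<longleftrightarrow>
     open S \<and> open T \<and> bij_betw f S T \<and> smooth_on S f \<and> smooth_on T (the_inv_into S f)"

definition local_diffeo_on ::
  "'a::real_normed_vector set \<Rightarrow> ('a \<Rightarrow> 'b::real_normed_vector) \<Rightarrow> bool" where
  "local_diffeo_on S f \<longleftrightarrow> (\<forall>z\<in>S. \<exists>N. z \<in> N \<and> N \<subseteq> S \<and> diffeo_on N (f ` N) f)"

definition compactly_contained ::
  "'a::topological_space set \<Rightarrow> 'a set \<Rightarrow> bool"  (infix "\<subset>\<subset>" 50) where
  "U \<subset>\<subset> S \<longleftrightarrow> compact (closure U) \<and> closure U \<subseteq> S"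

definition japanese :: "'a::real_normed_vector \<Rightarrow> real"  ("\<langle>_\<rangle>") where
  "\<langle>v\<rangle> = sqrt (1 + (norm v)\<^sup>2)"

definition gradient :: "('a::real_inner \<Rightarrow> real) \<Rightarrow> 'a \<Rightarrow> 'a" where
  "gradient f z = (THE D. GDERIV f z :> D)"


subsection \<open>Homogeneous symplectomorphisms in local coordinates\<close>

definition nonzero_cov :: "('m::finite) cotangent set" where
  "nonzero_cov = UNIV \<times> (- {0})"

text \<open>The canonical form \<open>\<Sum>\<^sub>j d\<xi>\<^sub>j \<and> dx\<^sub>j\<close>.\<close>

definition symplectic_form :: "('m::finite) cotangent \<Rightarrow> 'm cotangent \<Rightarrow> real" where
  "symplectic_form v w = snd v \<bullet> fst w - fst v \<bullet> snd w"

text \<open>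
  \<open>V\<close> is the (open, conic) part of the cotangent bundle on which the map is visible in the chosen
  charts.
\<close>

definition homogeneous_symplectomorphism ::
  "('m::finite) cotangent set \<Rightarrow> ('m cotangent \<Rightarrow> 'm cotangent) \<Rightarrow> bool" where
  "homogeneous_symplectomorphism V \<kappa> \<longleftrightarrow>
     V \<subseteq> nonzero_cov \<and> \<kappa> ` V \<subseteq> nonzero_cov \<and> diffeo_on V (\<kappa> ` V) \<kappa> \<and>
     (\<forall>y \<eta>. \<forall>r>0. (y, \<eta>) \<in> V \<longrightarrow>
        (y, r *\<^sub>R \<eta>) \<in> V \<and> \<kappa> (y, r *\<^sub>R \<eta>) = (fst (\<kappa> (y, \<eta>)), r *\<^sub>R snd (\<kappa> (y, \<eta>)))) \<and>
     (\<forall>z\<in>V. \<forall>v w. symplectic_form (frechet_derivative \<kappa> (at z) v) (frechet_derivative \<kappa> (at z) w)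
                     = symplectic_form v w)"

text \<open>
  The first clause says that \<open>\<kappa>\<close> extends a map between the cotangent bundles of the manifolds with
  boundary \<open>{y\<^sub>n \<ge> 0}\<close> and \<open>{x\<^sub>n \<ge> 0}\<close>; the second one that over the boundary the base point is
  mapped by a diffeomorphism \<open>b\<close> of the boundaries.
\<close>

definition boundary_preserving ::
  "('m::finite) cotangent set \<Rightarrow> ('m cotangent \<Rightarrow> 'm cotangent) \<Rightarrow> bool" where
  "boundary_preserving V \<kappa> \<longleftrightarrow>
     (\<forall>z\<in>V. 0 \<le> snd (fst z) \<longleftrightarrow> 0 \<le> snd (fst (\<kappa> z))) \<and>
     (\<exists>B b. diffeo_on B (b ` B) b \<and>
        (\<forall>y' \<eta>. ((y', 0), \<eta>) \<in> V \<longrightarrow> y' \<in> B \<and> fst (\<kappa> ((y', 0), \<eta>)) = (b y', 0)))"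


subsection \<open>Transmission condition\<close>

text \<open>
  \<open>iterated_deriv [v\<^sub>1, \<dots>, v\<^sub>r] p\<close> is \<open>\<partial>\<^bsub>v\<^sub>1\<^esub> \<dots> \<partial>\<^bsub>v\<^sub>r\<^esub> p\<close>. A multi-index \<open>\<alpha>\<close> over the \<open>n - 1\<close> tangential
  coordinates is represented by a list of coordinate indices in which \<open>i\<close> occurs \<open>\<alpha>\<^sub>i\<close> times, so
  that \<open>|\<alpha>|\<close> is the length of the list; for smooth functions the order is immaterial.
\<close>

definition iterated_deriv ::
  "'a::real_normed_vector list \<Rightarrow> ('a \<Rightarrow> real) \<Rightarrow> 'a \<Rightarrow> real" where
  "iterated_deriv vs p = foldr (\<lambda>v f z. frechet_derivative f (at z) v) vs p"

definition transmission_deriv ::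
  "nat \<Rightarrow> 'm list \<Rightarrow> 'm list \<Rightarrow> (('m::finite) cotangent \<Rightarrow> real) \<Rightarrow> 'm cotangent \<Rightarrow> real" where
  "transmission_deriv l \<alpha> \<beta> =
     iterated_deriv (replicate l ((0, 1), 0) @ map (\<lambda>i. (0, (axis i 1, 0))) \<alpha>
                     @ map (\<lambda>j. ((axis j 1, 0), 0)) \<beta>)"

definition transmission_at ::
  "int \<Rightarrow> (('m::finite) cotangent \<Rightarrow> real) \<Rightarrow> real ^ 'm \<Rightarrow> bool" where
  "transmission_at m p x' \<longleftrightarrow>
     (\<forall>l \<alpha> \<beta>. transmission_deriv l \<alpha> \<beta> p ((x', 0), (0, 1)) =
        (- 1) powi (m - int (length \<alpha>)) * transmission_deriv l \<alpha> \<beta> p ((x', 0), (0, - 1)))"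

text \<open>The components of the base point have degree 0, those of the covector degree 1.\<close>

definition admissible ::
  "('m::finite) cotangent set \<Rightarrow> ('m cotangent \<Rightarrow> 'm cotangent) \<Rightarrow> bool" where
  "admissible V \<kappa> \<longleftrightarrow>
     (\<forall>y'. ((y', 0), (0, 1)) \<in> V \<and> ((y', 0), (0, - 1)) \<in> V \<longrightarrow>
        (\<forall>e\<in>Basis. transmission_at 0 (\<lambda>z. fst (\<kappa> z) \<bullet> e) y' \<and>
                   transmission_at 1 (\<lambda>z. snd (\<kappa> z) \<bullet> e) y'))"


subsection \<open>Phase functions\<close>

definition strip :: "(real ^ 'm::finite) set \<Rightarrow> real \<Rightarrow> 'm point set" where
  "strip \<Omega>' \<delta> = \<Omega>' \<times> {- \<delta> <..< \<delta>}"

text \<open>\<open>(x, \<xi>) \<mapsto> (\<psi>'\<^sub>\<xi>(x, \<xi>), \<xi>)\<close>\<close>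

definition phase_map ::
  "(('m::finite) cotangent \<Rightarrow> real) \<Rightarrow> 'm cotangent \<Rightarrow> 'm cotangent" where
  "phase_map \<psi> z = (gradient (\<lambda>\<xi>. \<psi> (fst z, \<xi>)) (snd z), snd z)"

definition phase_represents ::
  "('m::finite) point set \<Rightarrow> ('m cotangent \<Rightarrow> real) \<Rightarrow>
     'm cotangent set \<Rightarrow> ('m cotangent \<Rightarrow> 'm cotangent) \<Rightarrow> bool" where
  "phase_represents S \<psi> V \<kappa> \<longleftrightarrow>
     smooth_on (S \<times> (- {0})) \<psi> \<and>
     (\<forall>x\<in>S. \<forall>\<xi>. \<xi> \<noteq> 0 \<longrightarrow> (\<forall>r>0. \<psi> (x, r *\<^sub>R \<xi>) = r * \<psi> (x, \<xi>))) \<and>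
     (\<forall>x\<in>S. \<forall>\<xi>. \<xi> \<noteq> 0 \<longrightarrow>
        phase_map \<psi> (x, \<xi>) \<in> V \<and>
        \<kappa> (phase_map \<psi> (x, \<xi>)) = (x, gradient (\<lambda>x. \<psi> (x, \<xi>)) x)) \<and>
     local_diffeo_on (S \<times> (- {0})) (phase_map \<psi>)"

text \<open>
  \<open>\<psi>(x', 0, \<xi>', \<xi>\<^sub>n)\<close> does not depend on \<open>\<xi>\<^sub>n\<close>, so it may be evaluated at \<open>\<xi>\<^sub>n = 0\<close> for \<open>\<xi>' \<noteq> 0\<close>.
\<close>

definition boundary_phase ::
  "(('m::finite) cotangent \<Rightarrow> real) \<Rightarrow> real ^ 'm \<Rightarrow> real ^ 'm \<Rightarrow> real" where
  "boundary_phase \<psi> x' \<xi>' = \<psi> ((x', 0), (\<xi>', 0))"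

definition normal_phase :: "(('m::finite) cotangent \<Rightarrow> real) \<Rightarrow> 'm cotangent \<Rightarrow> real" where
  "normal_phase \<psi> z = \<psi> z - boundary_phase \<psi> (fst (fst z)) (fst (snd z))"

text \<open>
  A homogeneous \<open>\<psi>\<close> is in general singular at \<open>\<xi> = 0\<close>. A modification of \<open>\<psi>\<close> near \<open>\<xi> = 0\<close> changes
  it inside \<open>{|\<xi>| < \<rho>}\<close> only, into a function smooth in all \<open>\<xi>\<close>. It has to remain a nondegenerate
  phase function at the boundary (the differential of \<open>phase_map \<psi>m\<close> is invertible) whose boundary
  value is independent of \<open>\<xi>\<^sub>n\<close>: cutting off \<open>\<psi>\<close> by 0 near \<open>\<xi> = 0\<close>, for instance, would make the
  mixed derivative \<open>\<partial>\<^sub>t \<partial>\<^sub>\<tau>\<close> of the function \<open>star_Phi\<close> below vanish for small \<open>\<xi>'\<close>, \<open>t\<close>, \<open>\<tau>\<close>.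
\<close>

definition modification_near_0 ::
  "(real ^ 'm::finite) set \<Rightarrow> real \<Rightarrow> real \<Rightarrow> ('m cotangent \<Rightarrow> real) \<Rightarrow> ('m cotangent \<Rightarrow> real) \<Rightarrow> bool"
  where
  "modification_near_0 N \<delta> \<rho> \<psi> \<psi>m \<longleftrightarrow>
     smooth_on (strip N \<delta> \<times> UNIV) \<psi>m \<and>
     (\<forall>x\<in>strip N \<delta>. \<forall>\<xi>. \<rho> \<le> norm \<xi> \<longrightarrow> \<psi>m (x, \<xi>) = \<psi> (x, \<xi>)) \<and>
     (\<forall>x'\<in>N. \<forall>\<xi>' \<xi>n. \<psi>m ((x', 0), (\<xi>', \<xi>n)) = boundary_phase \<psi>m x' \<xi>') \<and>
     (\<forall>x'\<in>N. \<forall>\<xi>. bij (frechet_derivative (phase_map \<psi>m) (at ((x', 0), \<xi>))))"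


subsection \<open>The functions \<open>\<Phi>\<close> and \<open>*\<Phi>\<close>\<close>

definition cutoff :: "(real \<Rightarrow> real) \<Rightarrow> bool" where
  "cutoff \<omega> \<longleftrightarrow> smooth_on UNIV \<omega> \<and> (\<forall>t. \<omega> (- t) = \<omega> t) \<and> antimono_on {0..} \<omega> \<and>
     (\<forall>t\<in>{0..1/2}. \<omega> t = 1) \<and> (\<forall>t\<ge>1. \<omega> t = 0)"

text \<open>
  The values of \<open>\<psi>\<close> outside its domain \<open>|x\<^sub>n| < \<delta>\<close> do not matter once \<open>2k < \<delta>\<close>, since
  \<open>\<omega> (x\<^sub>n / k) = 0\<close> there; this is the extension of the first summand by 0.
\<close>

definition Phi ::
  "(real \<Rightarrow> real) \<Rightarrow> real \<Rightarrow> real \<Rightarrow> (('m::finite) cotangent \<Rightarrow> real) \<Rightarrow> 'm cotangent \<Rightarrow> real" where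
  "Phi \<omega> k K \<psi> z =
     (let xn = snd (fst z); \<xi>n = snd (snd z)
      in \<omega> (xn / k) * normal_phase \<psi> z + (1 - \<omega> (xn / k)) * K * xn * \<xi>n)"

definition star_Phi ::
  "(real \<Rightarrow> real) \<Rightarrow> real \<Rightarrow> real \<Rightarrow> (('m::finite) cotangent \<Rightarrow> real) \<Rightarrow>
     real ^ 'm \<Rightarrow> real ^ 'm \<Rightarrow> real \<Rightarrow> real \<Rightarrow> real" where
  "star_Phi \<omega> k K \<psi> x' \<xi>' t \<tau> = Phi \<omega> k K \<psi> ((x', t / \<langle>\<xi>'\<rangle>), (\<xi>', \<tau> * \<langle>\<xi>'\<rangle>))"


subsection \<open>Regular SG phase functions\<close>

text \<open>
  The constants are kept as parameters in order to express uniformity. Only absolute values of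
  derivatives occur, so \<open>D = - i \<partial>\<close> is replaced by \<open>\<partial>\<close>.
\<close>

definition regular_SG_phase ::
  "(nat \<Rightarrow> nat \<Rightarrow> real) \<Rightarrow> real \<Rightarrow> real \<Rightarrow> real \<Rightarrow> (real \<Rightarrow> real \<Rightarrow> real) \<Rightarrow> bool" where
  "regular_SG_phase A c C \<epsilon> F \<longleftrightarrow>
     smooth_on UNIV (\<lambda>(t, \<tau>). F t \<tau>) \<and>
     (\<forall>a \<alpha>. 0 < A a \<alpha>) \<and> 0 < c \<and> 0 < C \<and> 0 < \<epsilon> \<and>
     (\<forall>a \<alpha> t \<tau>. \<bar>(deriv ^^ a) (\<lambda>s. (deriv ^^ \<alpha>) (F s) \<tau>) t\<bar>
        \<le> A a \<alpha> * \<langle>t\<rangle> powi (1 - int a) * \<langle>\<tau>\<rangle> powi (1 - int \<alpha>)) \<and>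
     (\<forall>t \<tau>. c * \<langle>\<tau>\<rangle> \<le> \<langle>deriv (\<lambda>s. F s \<tau>) t\<rangle> \<and> \<langle>deriv (\<lambda>s. F s \<tau>) t\<rangle> \<le> C * \<langle>\<tau>\<rangle>) \<and>
     (\<forall>t \<tau>. c * \<langle>t\<rangle> \<le> \<langle>deriv (F t) \<tau>\<rangle> \<and> \<langle>deriv (F t) \<tau>\<rangle> \<le> C * \<langle>t\<rangle>) \<and>
     (\<forall>t \<tau>. \<epsilon> \<le> \<bar>deriv (\<lambda>s. deriv (F s) \<tau>) t\<bar>)"

end

theory Submission
  imports Defs
begin

text \<open>
  At \<open>x\<^sub>n = 0\<close> preservation of the boundary forces \<open>\<partial>\<^bsub>\<xi>\<^sub>n\<^esub> \<psi> = 0\<close>, and nondegeneracy together with the sign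
  of the normal component of \<open>\<psi>'\<^sub>\<xi>\<close> gives \<open>\<partial>\<^bsub>x\<^sub>n\<^esub> \<partial>\<^bsub>\<xi>\<^sub>n\<^esub> \<psi> > 0\<close>; by homogeneity and compactness this mixed
  derivative stays between two positive constants for small \<open>x\<^sub>n\<close>. For large \<open>K\<close> the transition term of
  the mixed derivative of \<open>\<Phi>\<close> is then nonnegative, which yields (P3) and, by integration, (P2).
  Every derivative of \<open>\<Phi>\<close> is homogeneous in \<open>\<xi>\<close>, hence bounded by compactness, and since \<open>\<Phi>\<close> vanishes
  at \<open>x\<^sub>n = 0\<close> and \<open>|t| \<le> k \<langle>\<xi>'\<rangle>\<close> where the cutoff acts, rescaling turns these bounds into (P1).
  A modification near \<open>\<xi> = 0\<close> is \<open>\<theta> (\<psi>\<^sub>\<partial> + x\<^sub>n \<xi>\<^sub>n) + (1 - \<theta>) \<psi>\<close>, where \<open>\<theta>\<close> varies so slowly in \<open>log |\<xi>|\<close>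
  that the terms with its derivative do not destroy the positivity of the mixed derivative.
\<close>

subsection \<open>Directional derivatives and smooth functions\<close>

text \<open>For homogeneous \<open>\<psi>\<close> a derivative of order \<alpha> in \<xi>_n is of
  size |\<xi>|^(1 - \<alpha>). Replacing |\<xi>| by \<langle>\<xi>\<rangle> in this bound costs a
  factor that is unbounded as \<xi> tends to 0 once \<alpha> \<ge> 2, so (P1) is uniform only on
  |\<xi>'| \<ge> r. The constants of (P2) and (P3) come from the orders \<alpha> \<le> 1, where
  |\<xi>|^(1 - \<alpha>) \<le> \<langle>\<xi>\<rangle>^(1 - \<alpha>). This is why c, C, \<epsilon>
  are chosen before r and \<open>A\<close> after it, and why uniformity of (P1) in all \<xi>'
  \<noteq> 0 is claimed for modifications. The price of an arbitrary modification is that inside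
  |\<xi>| < \<rho> the geometry of \<open>\<kappa>\<close> says nothing; there positivity of the
  mixed derivative is propagated from outside, since the invertible differential of the phase map
  forbids zeros. Derivatives in (t, \<tau>) are traded for derivatives on the cotangent space. The
  direction is the first argument of \<open>dirder\<close>, so that \<open>dirder v ^^ n\<close>
  iterates an operator on functions.\<close>

definition dirder :: "'a::real_normed_vector \<Rightarrow> ('a \<Rightarrow> 'b::real_normed_vector) \<Rightarrow> 'a \<Rightarrow> 'b" where
  "dirder v f z = frechet_derivative f (at z) v"

lemma dirder_eq: "(f has_derivative f') (at z) \<Longrightarrow> dirder v f z = f' v"
  unfolding dirder_def using frechet_derivative_at by metis

lemma has_derivative_dirder:
  "f differentiable (at z) \<Longrightarrow> (f has_derivative (\<lambda>v. dirder v f z)) (at z)"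
  unfolding dirder_def using frechet_derivative_works by auto

lemma Ck_on_SucI:
  assumes "\<And>x. x \<in> S \<Longrightarrow> f differentiable (at x)" "\<And>v. Ck_on k S (dirder v f)"
  shows "Ck_on (Suc k) S f"
  using assms by (simp add: dirder_def[abs_def])

lemma Ck_on_SucD:
  assumes "Ck_on (Suc k) S f"
  shows "x \<in> S \<Longrightarrow> f differentiable (at x)" "Ck_on k S (dirder v f)"
  using assms by (simp_all add: dirder_def[abs_def])

lemma has_derivative_cong_open:
  assumes "open S" "x \<in> S" "\<And>x. x \<in> S \<Longrightarrow> f x = g x"
  shows "(f has_derivative D) (at x) \<longleftrightarrow> (g has_derivative D) (at x)"
  using has_derivative_transform_within_open[of f D x UNIV S g]
    has_derivative_transform_within_open[of g D x UNIV S f] assms by auto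

lemma dirder_cong_open:
  assumes "open S" "x \<in> S" "\<And>x. x \<in> S \<Longrightarrow> f x = g x"
  shows "dirder v f x = dirder v g x"
  unfolding dirder_def frechet_derivative_def
  using has_derivative_cong_open[of S x f g, OF assms] by simp

lemma dirder_funpow_cong_open:
  assumes "open S" "\<And>x. x \<in> S \<Longrightarrow> f x = g x" "x \<in> S"
  shows "(dirder v ^^ n) f x = (dirder v ^^ n) g x"
  using assms(3)
proof (induction n arbitrary: x)
  case 0 then show ?case using assms by simp
next
  case (Suc n) then show ?case using dirder_cong_open[OF assms(1) Suc.prems Suc.IH] by simp
qed

lemma Ck_on_cong_open:
  assumes "open S" "\<And>x. x \<in> S \<Longrightarrow> f x = g x" "Ck_on k S f"
  shows "Ck_on k S g"
  using assms(2,3)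
proof (induction k arbitrary: f g)
  case 0 then show ?case using continuous_on_cong by (metis Ck_on.simps(1))
next
  case (Suc k)
  show ?case
  proof (rule Ck_on_SucI)
    fix x assume "x \<in> S"
    then show "g differentiable (at x)"
      using Ck_on_SucD(1)[OF Suc.prems(2)] has_derivative_cong_open[of S _ f g, OF assms(1) _ Suc.prems(1)]
      unfolding differentiable_def by blast
  next
    fix v show "Ck_on k S (dirder v g)"
      by (rule Suc.IH[OF _ Ck_on_SucD(2)[OF Suc.prems(2), of v]])
        (rule dirder_cong_open[OF assms(1)], use Suc.prems(1) in auto)
  qed
qed

lemma Ck_on_subset: "Ck_on k S f \<Longrightarrow> T \<subseteq> S \<Longrightarrow> Ck_on k T f"
  by (induction k arbitrary: f) (auto intro: continuous_on_subset)

text \<open>Glues a function that is described by different formulas on two open sets, such as the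
  localized phase inside and outside the strip.\<close>

lemma Ck_on_Un_open:
  assumes "open S" "open T"
  shows "Ck_on k S f \<Longrightarrow> Ck_on k T f \<Longrightarrow> Ck_on k (S \<union> T) f"
  by (induction k arbitrary: f) (use assms in \<open>auto intro: continuous_on_open_Un\<close>)

lemma Ck_on_SucD_Ck_on: "Ck_on (Suc k) S f \<Longrightarrow> Ck_on k S f"
proof (induction k arbitrary: f)
  case 0
  then show ?case
    by (auto intro!: continuous_at_imp_continuous_on differentiable_imp_continuous_within)
next
  case (Suc k)
  then show ?case by (metis Ck_on.simps(2))
qed

section \<open>Closure properties of C^k and smooth functions\<close>

lemma Ck_on_const: "Ck_on k S (\<lambda>x. c)"
  by (induction k arbitrary: c) auto

lemma Ck_on_compose_linear:
  assumes "bounded_linear h" "open S"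
  shows "Ck_on k S f \<Longrightarrow> Ck_on k S (\<lambda>x. h (f x))"
proof (induction k arbitrary: f)
  case 0 then show ?case
    using linear_continuous_on[OF assms(1)] by (auto intro: continuous_on_compose2[of UNIV h])
next
  case (Suc k)
  have d: "((\<lambda>x. h (f x)) has_derivative (\<lambda>v. h (dirder v f x))) (at x)" if "x \<in> S" for x
    using bounded_linear.has_derivative[OF assms(1) has_derivative_dirder]
      Ck_on_SucD(1)[OF Suc.prems that] by auto
  show ?case
  proof (rule Ck_on_SucI)
    fix v show "Ck_on k S (dirder v (\<lambda>x. h (f x)))"
      by (rule Ck_on_cong_open[OF assms(2) _ Suc.IH[OF Ck_on_SucD(2)[OF Suc.prems, of v]]])
        (simp add: dirder_eq[OF d])
  qed (use differentiableI[OF d] in auto)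
qed

lemma Ck_on_linear:
  assumes "bounded_linear h" shows "Ck_on k S h"
proof (cases k)
  case 0 then show ?thesis using linear_continuous_on[OF assms] by simp
next
  case (Suc n)
  have d: "(h has_derivative h) (at x)" for x
    using assms by (rule bounded_linear_imp_has_derivative)
  then have "dirder v h = (\<lambda>x. h v)" for v using dirder_eq by blast
  then have "Ck_on (Suc n) S h"
    using Ck_on_const differentiableI[OF d] by (intro Ck_on_SucI) auto
  then show ?thesis using Suc by simp
qed

lemma Ck_on_add:
  assumes "open S"
  shows "Ck_on k S f \<Longrightarrow> Ck_on k S g \<Longrightarrow> Ck_on k S (\<lambda>x. f x + g x)"
proof (induction k arbitrary: f g)
  case 0 then show ?case by (auto intro: continuous_intros)
next
  case (Suc k)
  have d: "((\<lambda>x. f x + g x) has_derivative (\<lambda>v. dirder v f x + dirder v g x)) (at x)" if "x \<in> S" for x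
    using Ck_on_SucD(1)[OF Suc.prems(1) that] Ck_on_SucD(1)[OF Suc.prems(2) that]
    by (intro has_derivative_add has_derivative_dirder)
  show ?case
  proof (rule Ck_on_SucI)
    fix v show "Ck_on k S (dirder v (\<lambda>x. f x + g x))"
      by (rule Ck_on_cong_open[OF assms _ Suc.IH[OF Ck_on_SucD(2)[OF Suc.prems(1), of v] Ck_on_SucD(2)[OF Suc.prems(2), of v]]])
        (simp add: dirder_eq[OF d])
  qed (use differentiableI[OF d] in auto)
qed

lemma Ck_on_scaleR:
  assumes "open S"
  shows "Ck_on k S f \<Longrightarrow> Ck_on k S g \<Longrightarrow> Ck_on k S (\<lambda>x. f x *\<^sub>R g x)"
proof (induction k arbitrary: f g)
  case 0 then show ?case by (auto intro: continuous_intros)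
next
  case (Suc k)
  have d: "((\<lambda>x. f x *\<^sub>R g x) has_derivative (\<lambda>v. f x *\<^sub>R dirder v g x + dirder v f x *\<^sub>R g x)) (at x)" if "x \<in> S" for x
    using Ck_on_SucD(1)[OF Suc.prems(1) that] Ck_on_SucD(1)[OF Suc.prems(2) that]
    by (intro has_derivative_scaleR has_derivative_dirder)
  show ?case
  proof (rule Ck_on_SucI)
    fix v
    have "Ck_on k S (\<lambda>x. f x *\<^sub>R dirder v g x + dirder v f x *\<^sub>R g x)"
      by (intro Ck_on_add[OF assms] Suc.IH Ck_on_SucD(2) Suc.prems Ck_on_SucD_Ck_on)
    then show "Ck_on k S (dirder v (\<lambda>x. f x *\<^sub>R g x))"
      by (rule Ck_on_cong_open[OF assms, rotated]) (simp add: dirder_eq[OF d])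
  qed (use differentiableI[OF d] in auto)
qed

lemma Ck_on_sum:
  assumes "open S" "\<And>i. i \<in> I \<Longrightarrow> Ck_on k S (f i)"
  shows "Ck_on k S (\<lambda>x. \<Sum>i\<in>I. f i x)"
  using assms(2) by (induction I rule: infinite_finite_induct) (auto intro: Ck_on_const Ck_on_add[OF assms(1)])

text \<open>By the chain rule f is differentiated in the direction \<open>dirder v g x\<close>,
  which varies with x, whereas \<open>Ck_on\<close> speaks about fixed directions. Expanding the
  direction in a basis leaves a finite sum of products with fixed directions, to which the induction
  hypothesis applies; this is where the Euclidean target of g enters.\<close>

lemma Ck_on_compose:
  fixes g :: "'a::real_normed_vector \<Rightarrow> 'b::euclidean_space"
  assumes "open S" "\<And>x. x \<in> S \<Longrightarrow> g x \<in> T"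
  shows "Ck_on k T f \<Longrightarrow> Ck_on k S g \<Longrightarrow> Ck_on k S (\<lambda>x. f (g x))"
proof (induction k arbitrary: f)
  case 0 then show ?case using assms(2)
    by (auto intro: continuous_on_compose2[of T f])
next
  case (Suc k)
  have lin: "linear (\<lambda>v. dirder v f (g x))" if "x \<in> S" for x
    using has_derivative_dirder[OF Ck_on_SucD(1)[OF Suc.prems(1) assms(2)[OF that]]]
    by (rule has_derivative_linear)
  have d: "((\<lambda>x. f (g x)) has_derivative (\<lambda>v. dirder (dirder v g x) f (g x))) (at x)" if "x \<in> S" for x
    using has_derivative_compose[OF has_derivative_dirder[OF Ck_on_SucD(1)[OF Suc.prems(2) that]]
        has_derivative_dirder[OF Ck_on_SucD(1)[OF Suc.prems(1) assms(2)[OF that]]]] .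
  have e: "dirder v (\<lambda>x. f (g x)) x = (\<Sum>b\<in>Basis. (dirder v g x \<bullet> b) *\<^sub>R dirder b f (g x))"
    if "x \<in> S" for x v
  proof -
    have "dirder v (\<lambda>x. f (g x)) x = dirder (\<Sum>b\<in>Basis. (dirder v g x \<bullet> b) *\<^sub>R b) f (g x)"
      by (simp add: dirder_eq[OF d[OF that]] euclidean_representation)
    also have "\<dots> = (\<Sum>b\<in>Basis. (dirder v g x \<bullet> b) *\<^sub>R dirder b f (g x))"
      by (simp add: linear_sum[OF lin[OF that]] linear_scale[OF lin[OF that]])
    finally show ?thesis .
  qed
  show ?case
  proof (rule Ck_on_SucI)
    fix v
    have "Ck_on k S (\<lambda>x. \<Sum>b\<in>Basis. (dirder v g x \<bullet> b) *\<^sub>R dirder b f (g x))"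
      using Suc.prems
      by (intro Ck_on_sum Ck_on_scaleR assms(1) Suc.IH
          Ck_on_compose_linear[OF bounded_linear_inner_left]) (auto intro: Ck_on_SucD(2) Ck_on_SucD_Ck_on)
    then show "Ck_on k S (dirder v (\<lambda>x. f (g x)))"
      by (rule Ck_on_cong_open[OF assms(1), rotated]) (simp add: e)
  qed (use differentiableI[OF d] in auto)
qed

lemma smooth_on_cong_open:
  "open S \<Longrightarrow> (\<And>x. x \<in> S \<Longrightarrow> f x = g x) \<Longrightarrow> smooth_on S f \<Longrightarrow> smooth_on S g"
  unfolding smooth_on_def using Ck_on_cong_open by blast

lemma smooth_on_subset: "smooth_on S f \<Longrightarrow> T \<subseteq> S \<Longrightarrow> smooth_on T f"
  unfolding smooth_on_def using Ck_on_subset by blast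

lemma smooth_on_Un_open:
  "open S \<Longrightarrow> open T \<Longrightarrow> smooth_on S f \<Longrightarrow> smooth_on T f \<Longrightarrow> smooth_on (S \<union> T) f"
  unfolding smooth_on_def using Ck_on_Un_open by blast

lemma smooth_on_imp_differentiable: "smooth_on S f \<Longrightarrow> x \<in> S \<Longrightarrow> f differentiable (at x)"
  unfolding smooth_on_def by (metis Ck_on_SucD(1))

lemma smooth_on_imp_continuous_on: "smooth_on S f \<Longrightarrow> continuous_on S f"
  unfolding smooth_on_def by (metis Ck_on.simps(1))

lemma smooth_on_has_derivative:
  "smooth_on S f \<Longrightarrow> x \<in> S \<Longrightarrow> (f has_derivative (\<lambda>v. dirder v f x)) (at x)"
  by (intro has_derivative_dirder smooth_on_imp_differentiable)

lemma smooth_on_dirder: "smooth_on S f \<Longrightarrow> smooth_on S (dirder v f)"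
  unfolding smooth_on_def using Ck_on_SucD(2) by blast

lemma smooth_on_dirder_funpow: "smooth_on S f \<Longrightarrow> smooth_on S ((dirder v ^^ n) f)"
  by (induction n) (auto intro: smooth_on_dirder)

lemma smooth_on_const: "smooth_on S (\<lambda>x. c)"
  by (simp add: smooth_on_def Ck_on_const)

lemma smooth_on_linear: "bounded_linear h \<Longrightarrow> smooth_on S h"
  by (simp add: smooth_on_def Ck_on_linear)

lemma smooth_on_compose_linear:
  "bounded_linear h \<Longrightarrow> open S \<Longrightarrow> smooth_on S f \<Longrightarrow> smooth_on S (\<lambda>x. h (f x))"
  by (simp add: smooth_on_def Ck_on_compose_linear)

lemma smooth_on_add:
  "open S \<Longrightarrow> smooth_on S f \<Longrightarrow> smooth_on S g \<Longrightarrow> smooth_on S (\<lambda>x. f x + g x)"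
  by (simp add: smooth_on_def Ck_on_add)

lemma smooth_on_scaleR:
  "open S \<Longrightarrow> smooth_on S f \<Longrightarrow> smooth_on S g \<Longrightarrow> smooth_on S (\<lambda>x. f x *\<^sub>R g x)"
  by (simp add: smooth_on_def Ck_on_scaleR)

lemma smooth_on_sum:
  "open S \<Longrightarrow> (\<And>i. i \<in> I \<Longrightarrow> smooth_on S (f i)) \<Longrightarrow> smooth_on S (\<lambda>x. \<Sum>i\<in>I. f i x)"
  by (simp add: smooth_on_def Ck_on_sum)

lemma smooth_on_mult:
  fixes f g :: "'a::real_normed_vector \<Rightarrow> real"
  shows "open S \<Longrightarrow> smooth_on S f \<Longrightarrow> smooth_on S g \<Longrightarrow> smooth_on S (\<lambda>x. f x * g x)"
  using smooth_on_scaleR[of S f g] by simp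

lemma smooth_on_diff:
  assumes "open S" "smooth_on S f" "smooth_on S g"
  shows "smooth_on S (\<lambda>x. f x - g x)"
  using smooth_on_add[OF assms(1,2) smooth_on_compose_linear[OF _ assms(1,3), of uminus]]
    bounded_linear_minus[OF bounded_linear_ident] by simp

lemma smooth_on_compose:
  fixes g :: "'a::real_normed_vector \<Rightarrow> 'b::euclidean_space"
  assumes "smooth_on T f" "smooth_on S g" "open S" "\<And>x. x \<in> S \<Longrightarrow> g x \<in> T"
  shows "smooth_on S (\<lambda>x. f (g x))"
  using assms Ck_on_compose unfolding smooth_on_def by blast

lemma smooth_on_Pair:
  assumes "open S" "smooth_on S f" "smooth_on S g"
  shows "smooth_on S (\<lambda>x. (f x, g x))"
proof -
  have "bounded_linear (\<lambda>x::'b. (x, 0::'c))" "bounded_linear (\<lambda>y::'c. (0::'b, y))"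
    by (auto intro!: bounded_linear_Pair bounded_linear_ident bounded_linear_zero)
  then show ?thesis
    using smooth_on_add[OF assms(1) smooth_on_compose_linear[OF _ assms(1,2)] smooth_on_compose_linear[OF _ assms(1,3)]]
    by fastforce
qed

section \<open>Directional derivatives as derivatives along lines\<close>

lemma has_real_derivative_line:
  fixes f :: "'a::real_normed_vector \<Rightarrow> real"
  assumes "f differentiable (at (z + (c * t) *\<^sub>R v))"
  shows "((\<lambda>t. f (z + (c * t) *\<^sub>R v)) has_real_derivative c * dirder v f (z + (c * t) *\<^sub>R v)) (at t)"
proof -
  have 1: "((\<lambda>t. z + (c * t) *\<^sub>R v) has_derivative (\<lambda>h. (c * h) *\<^sub>R v)) (at t)"
    by (auto intro!: derivative_eq_intros)
  have 2: "linear (\<lambda>u. dirder u f (z + (c * t) *\<^sub>R v))"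
    using has_derivative_linear[OF has_derivative_dirder[OF assms]] .
  have "(\<lambda>h. dirder ((c * h) *\<^sub>R v) f (z + (c * t) *\<^sub>R v)) = (*) (c * dirder v f (z + (c * t) *\<^sub>R v))"
    by (rule ext) (simp add: linear_scale[OF 2])
  then show ?thesis
    using has_derivative_compose[OF 1 has_derivative_dirder[OF assms]]
    unfolding has_field_derivative_def by simp
qed

text \<open>Only the values along the two lines matter, so different functions at different points
  can be compared. This transfers boundary derivatives from one covector to another with the same
  \<xi>'.\<close>

lemma dirder_line_cong:
  fixes f :: "'a::real_normed_vector \<Rightarrow> real" and g :: "'b::real_normed_vector \<Rightarrow> real"
  assumes "f differentiable (at z)" "g differentiable (at y)"
    and "eventually (\<lambda>t. f (z + t *\<^sub>R v) = g (y + t *\<^sub>R w)) (nhds 0)"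
  shows "dirder v f z = dirder w g y"
proof -
  have "((\<lambda>t. f (z + t *\<^sub>R v)) has_real_derivative dirder v f z) (at 0)"
    "((\<lambda>t. g (y + t *\<^sub>R w)) has_real_derivative dirder w g y) (at 0)"
    using has_real_derivative_line[of f z 1 0 v] has_real_derivative_line[of g y 1 0 w] assms by simp_all
  then show ?thesis
    using DERIV_cong_ev[OF refl assms(3) refl] DERIV_unique by metis
qed

text \<open>\<open>c ^ n\<close> is the chain rule factor of a rescaled variable, as in t /
  \<langle>\<xi>'\<rangle> or \<tau> * \<langle>\<xi>'\<rangle>; the prefactor b carries what an
  earlier differentiation in the other variable has produced.\<close>

lemma deriv_funpow_line:
  fixes f :: "'a::real_normed_vector \<Rightarrow> real"
  assumes "smooth_on S f" "\<And>t. z + (c * t) *\<^sub>R v \<in> S"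
  shows "(deriv ^^ n) (\<lambda>t. b * f (z + (c * t) *\<^sub>R v)) t = b * c ^ n * (dirder v ^^ n) f (z + (c * t) *\<^sub>R v)"
proof (induction n arbitrary: t)
  case (Suc n)
  have "(deriv ^^ n) (\<lambda>t. b * f (z + (c * t) *\<^sub>R v)) = (\<lambda>t. b * c ^ n * (dirder v ^^ n) f (z + (c * t) *\<^sub>R v))"
    using Suc.IH by blast
  moreover have "((\<lambda>t. b * c ^ n * (dirder v ^^ n) f (z + (c * t) *\<^sub>R v)) has_real_derivative
      b * c ^ n * (c * dirder v ((dirder v ^^ n) f) (z + (c * t) *\<^sub>R v))) (at t)"
    by (intro DERIV_cmult has_real_derivative_line
        smooth_on_imp_differentiable[OF smooth_on_dirder_funpow[OF assms(1)] assms(2)])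
  ultimately show ?case by (simp add: DERIV_imp_deriv mult.assoc)
qed simp

text \<open>The coefficient stays general so that the induction closes: differentiation only changes
  coefficient and exponent.\<close>

lemma Ck_on_powr: "Ck_on k {0<..} (\<lambda>x::real. c * x powr e)"
proof (induction k arbitrary: c e)
  case 0 then show ?case by (auto intro!: continuous_intros)
next
  case (Suc k)
  have d: "((\<lambda>x::real. c * x powr e) has_derivative (\<lambda>v. (v * (c * e)) * x powr (e - 1))) (at x)" if "x > 0" for x
    using that has_real_derivative_powr[OF that, of e]
    by (auto intro!: derivative_eq_intros simp: powr_diff)
  show ?case
  proof (rule Ck_on_SucI)
    fix v :: real
    show "Ck_on k {0<..} (dirder v (\<lambda>x::real. c * x powr e))"
      by (rule Ck_on_cong_open[OF _ _ Suc.IH[of "v * (c * e)" "e - 1"]]) (auto simp: dirder_eq[OF d])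
  qed (use differentiableI[OF d] in auto)
qed

lemma smooth_on_powr: "smooth_on {0<..} (\<lambda>x::real. x powr e)"
  using Ck_on_powr[of _ 1] by (simp add: smooth_on_def)

lemma smooth_on_norm_squared: "smooth_on UNIV (\<lambda>x::'a::euclidean_space. (norm x)\<^sup>2)"
proof -
  have "smooth_on UNIV (\<lambda>x::'a. \<Sum>b\<in>Basis. (x \<bullet> b) * (x \<bullet> b))"
    by (intro smooth_on_sum smooth_on_mult smooth_on_linear bounded_linear_inner_left) auto
  then show ?thesis by (simp add: power2_norm_eq_inner flip: euclidean_inner)
qed

text \<open>Chain rule for both compositions with the inverse map: its differential is a two-sided
  inverse of the differential of f.\<close>

lemma diffeo_on_bij_frechet_derivative:
  assumes "diffeo_on N T f" "z \<in> N"
  shows "bij (frechet_derivative f (at z))"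
proof -
  define g where "g = the_inv_into N f"
  have o: "open N" "open T" and b: "bij_betw f N T" and sm: "smooth_on N f" "smooth_on T g"
    using assms(1) by (auto simp: diffeo_on_def g_def)
  have gf: "g (f x) = x" if "x \<in> N" for x
    using b that by (simp add: g_def bij_betw_def the_inv_into_f_f)
  have fg: "f (g y) = y" if "y \<in> T" for y
    using b that by (simp add: g_def bij_betw_def f_the_inv_into_f)
  have fz: "f z \<in> T" using b assms(2) by (auto simp: bij_betw_def)
  note df = smooth_on_has_derivative[OF sm(1) assms(2)]
  note dg = smooth_on_has_derivative[OF sm(2) fz]
  have "((\<lambda>x. g (f x)) has_derivative (\<lambda>v. dirder (dirder v f z) g (f z))) (at z)"
    using has_derivative_compose[OF df dg] .
  then have "((\<lambda>x. x) has_derivative (\<lambda>v. dirder (dirder v f z) g (f z))) (at z)"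
    using has_derivative_cong_open[of N z "\<lambda>x. g (f x)" "\<lambda>x. x"] o assms(2) gf by auto
  then have 1: "dirder (dirder v f z) g (f z) = v" for v
    using has_derivative_unique[OF has_derivative_ident] by metis
  have df': "(f has_derivative (\<lambda>v. dirder v f z)) (at (g (f z)))"
    using df gf assms(2) by simp
  have "((\<lambda>x. f (g x)) has_derivative (\<lambda>v. dirder (dirder v g (f z)) f z)) (at (f z))"
    using has_derivative_compose[OF dg df'] .
  then have "((\<lambda>x. x) has_derivative (\<lambda>v. dirder (dirder v g (f z)) f z)) (at (f z))"
    using has_derivative_cong_open[of T "f z" "\<lambda>x. f (g x)" "\<lambda>x. x"] o fz fg by auto
  then have 2: "dirder (dirder v g (f z)) f z = v" for v
    using has_derivative_unique[OF has_derivative_ident] by metis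
  show ?thesis
    using 1 2 by (intro o_bij[of "\<lambda>v. dirder v g (f z)"]) (auto simp: dirder_def)
qed

lemma local_diffeo_on_bij_frechet_derivative:
  "local_diffeo_on S f \<Longrightarrow> z \<in> S \<Longrightarrow> bij (frechet_derivative f (at z))"
  unfolding local_diffeo_on_def using diffeo_on_bij_frechet_derivative by blast

section \<open>Gradients and the differential of the phase map\<close>

lemma gradient_eq_sum:
  fixes f :: "'a::euclidean_space \<Rightarrow> real"
  assumes "(f has_derivative D) (at z)"
  shows "gradient f z = (\<Sum>b\<in>Basis. D b *\<^sub>R b)"
proof -
  have lin: "linear D" using assms by (rule has_derivative_linear)
  have D: "D = (\<lambda>h. h \<bullet> (\<Sum>b\<in>Basis. D b *\<^sub>R b))"
  proof
    fix h
    have "D h = D (\<Sum>b\<in>Basis. (h \<bullet> b) *\<^sub>R b)" by (simp add: euclidean_representation)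
    also have "\<dots> = (\<Sum>b\<in>Basis. (h \<bullet> b) * D b)"
      by (simp add: linear_sum[OF lin] linear_scale[OF lin])
    finally show "D h = h \<bullet> (\<Sum>b\<in>Basis. D b *\<^sub>R b)"
      by (simp add: inner_sum_right mult.commute)
  qed
  have "GDERIV f z :> (\<Sum>b\<in>Basis. D b *\<^sub>R b)"
    using assms D unfolding gderiv_def by simp
  \<comment> \<open>Uniqueness resolves the definite description in \<open>gradient\<close>.\<close>
  moreover have "u = w" if "GDERIV f z :> u" "GDERIV f z :> w" for u w
    using has_derivative_unique[OF that[unfolded gderiv_def]] by (metis vector_eq_ldot)
  ultimately show ?thesis unfolding gradient_def by blast
qed

lemma has_derivative_snd_slice:
  fixes f :: "'a::real_normed_vector \<times> 'b::real_normed_vector \<Rightarrow> real"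
  assumes "f differentiable (at (x, \<xi>))"
  shows "((\<lambda>\<xi>. f (x, \<xi>)) has_derivative (\<lambda>w. dirder (0, w) f (x, \<xi>))) (at \<xi>)"
proof -
  have "((\<lambda>\<xi>. (x, \<xi>)) has_derivative (\<lambda>w. (0, w))) (at \<xi>)"
    by (auto intro!: derivative_eq_intros)
  from has_derivative_compose[OF this has_derivative_dirder[OF assms]] show ?thesis .
qed

lemma phase_map_eq:
  assumes "\<psi> differentiable (at z)"
  shows "phase_map \<psi> z = (\<Sum>b\<in>Basis. dirder (0, b) \<psi> z *\<^sub>R b, snd z)"
  using gradient_eq_sum[OF has_derivative_snd_slice[of \<psi> "fst z" "snd z"]] assms
  by (simp add: phase_map_def)

lemma phase_map_has_derivative:
  assumes "open S" "smooth_on S \<psi>" "z \<in> S"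
  shows "(phase_map \<psi> has_derivative (\<lambda>v. (\<Sum>b\<in>Basis. dirder v (dirder (0, b) \<psi>) z *\<^sub>R b, snd v))) (at z)"
proof -
  have "((\<lambda>z. (\<Sum>b\<in>Basis. dirder (0, b) \<psi> z *\<^sub>R b, snd z)) has_derivative
      (\<lambda>v. (\<Sum>b\<in>Basis. dirder v (dirder (0, b) \<psi>) z *\<^sub>R b, snd v))) (at z)"
    using smooth_on_has_derivative[OF smooth_on_dirder[OF assms(2)] assms(3)]
    by (intro has_derivative_Pair has_derivative_sum has_derivative_scaleR_left bounded_linear_imp_has_derivative bounded_linear_snd)
  then show ?thesis
    by (subst has_derivative_cong_open[OF assms(1,3) phase_map_eq])
      (auto intro: smooth_on_imp_differentiable[OF assms(2)])
qed

section \<open>Homogeneity in the covariable\<close>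

lemma dirder_homogeneous:
  fixes f :: "'a::real_normed_vector \<times> 'b::real_normed_vector \<Rightarrow> real"
  assumes sm: "smooth_on (S \<times> - {0}) f" and o: "open S"
    and hom: "\<And>x \<xi> r. x \<in> S \<Longrightarrow> \<xi> \<noteq> 0 \<Longrightarrow> 0 < r \<Longrightarrow> f (x, r *\<^sub>R \<xi>) = r powi d * f (x, \<xi>)"
    and x: "x \<in> S" "\<xi> \<noteq> 0" "0 < r"
  shows "dirder (v, 0) f (x, r *\<^sub>R \<xi>) = r powi d * dirder (v, 0) f (x, \<xi>)"
    and "dirder (0, w) f (x, r *\<^sub>R \<xi>) = r powi (d - 1) * dirder (0, w) f (x, \<xi>)"
proof -
  have o': "open (S \<times> - {0::'b})" using o by (intro open_Times) auto
  have A: "((\<lambda>z. (fst z, r *\<^sub>R snd z)) has_derivative (\<lambda>v. (fst v, r *\<^sub>R snd v))) (at (x, \<xi>))"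
    by (auto intro!: derivative_eq_intros)
  have B: "(f has_derivative (\<lambda>v. dirder v f (x, r *\<^sub>R \<xi>))) (at (fst (x, \<xi>), r *\<^sub>R snd (x, \<xi>)))"
    using x by (auto intro!: smooth_on_has_derivative[OF sm])
  have D: "(f has_derivative (\<lambda>v. dirder v f (x, \<xi>))) (at (x, \<xi>))"
    using x by (auto intro!: smooth_on_has_derivative[OF sm])
  have "((\<lambda>z. r powi d * f z) has_derivative (\<lambda>v. dirder (fst v, r *\<^sub>R snd v) f (x, r *\<^sub>R \<xi>))) (at (x, \<xi>))"
    by (subst has_derivative_cong_open[OF o', of _ _ "\<lambda>z. f (fst z, r *\<^sub>R snd z)"])
      (use x has_derivative_compose[OF A B] in \<open>auto intro!: hom[symmetric]\<close>)
  \<comment> \<open>Both sides of the homogeneity identity, as functions of z, have the same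
    differential. The chain rule puts a factor r on the covector slot only, so \<xi>-derivatives
    lose one degree and x-derivatives none.\<close>
  from has_derivative_unique[OF this has_derivative_mult_right[OF D]]
  have *: "dirder (fst v, r *\<^sub>R snd v) f (x, r *\<^sub>R \<xi>) = r powi d * dirder v f (x, \<xi>)" for v
    by metis
  show "dirder (v, 0) f (x, r *\<^sub>R \<xi>) = r powi d * dirder (v, 0) f (x, \<xi>)"
    using *[of "(v, 0)"] by simp
  have "dirder (r *\<^sub>R (0, w)) f (x, r *\<^sub>R \<xi>) = r * dirder (0, w) f (x, r *\<^sub>R \<xi>)"
    using linear_scale[OF has_derivative_linear[OF B], of r "(0, w)"] by simp
  then have "r * dirder (0, w) f (x, r *\<^sub>R \<xi>) = r powi d * dirder (0, w) f (x, \<xi>)"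
    using *[of "(0, w)"] by simp
  then show "dirder (0, w) f (x, r *\<^sub>R \<xi>) = r powi (d - 1) * dirder (0, w) f (x, \<xi>)"
    using x(3) by (simp add: power_int_diff field_simps)
qed

lemma dirder_funpow_homogeneous:
  fixes f :: "'a::real_normed_vector \<times> 'b::real_normed_vector \<Rightarrow> real"
  assumes sm: "smooth_on (S \<times> - {0}) f" and o: "open S"
    and hom: "\<And>x \<xi> r. x \<in> S \<Longrightarrow> \<xi> \<noteq> 0 \<Longrightarrow> 0 < r \<Longrightarrow> f (x, r *\<^sub>R \<xi>) = r powi d * f (x, \<xi>)"
    and x: "x \<in> S" "\<xi> \<noteq> 0" "0 < r"
  shows "(dirder (v, 0) ^^ a) ((dirder (0, w) ^^ \<alpha>) f) (x, r *\<^sub>R \<xi>)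
    = r powi (d - int \<alpha>) * (dirder (v, 0) ^^ a) ((dirder (0, w) ^^ \<alpha>) f) (x, \<xi>)"
proof -
  have 1: "(dirder (0, w) ^^ \<alpha>) f (x, r *\<^sub>R \<xi>) = r powi (d - int \<alpha>) * (dirder (0, w) ^^ \<alpha>) f (x, \<xi>)"
    if "x \<in> S" "\<xi> \<noteq> 0" "0 < r" for x \<xi> r
    using that
  proof (induction \<alpha> arbitrary: x \<xi> r)
    case 0 then show ?case using hom by simp
  next
    case (Suc \<alpha>)
    then show ?case
      using dirder_homogeneous(2)[OF smooth_on_dirder_funpow[OF sm] o Suc.IH, of x \<xi> r w] by (simp add: algebra_simps)
  qed
  show ?thesis
    using x
  proof (induction a arbitrary: x \<xi> r)
    case 0 then show ?case using 1 by simp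
  next
    case (Suc a)
    then show ?case
      using dirder_homogeneous(1)[OF smooth_on_dirder_funpow[OF smooth_on_dirder_funpow[OF sm]] o Suc.IH, of x \<xi> r v] by simp
  qed
qed

lemma compact_continuous_bound:
  fixes f :: "'a::topological_space \<Rightarrow> real"
  assumes "compact C" "continuous_on C f"
  shows "\<exists>B>0. \<forall>x\<in>C. \<bar>f x\<bar> \<le> B"
proof -
  have "bounded (f ` C)" using assms compact_continuous_image compact_imp_bounded by blast
  then show ?thesis by (auto simp: bounded_pos)
qed

lemma homogeneous_bound:
  fixes f :: "'a::real_normed_vector \<times> 'b::euclidean_space \<Rightarrow> real"
  assumes "continuous_on (S \<times> - {0}) f"
    and hom: "\<And>x \<xi> r. x \<in> S \<Longrightarrow> \<xi> \<noteq> 0 \<Longrightarrow> 0 < r \<Longrightarrow> f (x, r *\<^sub>R \<xi>) = r powi d * f (x, \<xi>)"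
    and "compact C" "C \<subseteq> S"
  shows "\<exists>B>0. \<forall>x\<in>C. \<forall>\<xi>. \<xi> \<noteq> 0 \<longrightarrow> \<bar>f (x, \<xi>)\<bar> \<le> B * norm \<xi> powi d"
proof -
  have "compact (C \<times> sphere (0::'b) 1)" using assms(3) by (intro compact_Times) auto
  moreover have "continuous_on (C \<times> sphere (0::'b) 1) f"
    by (rule continuous_on_subset[OF assms(1)]) (use assms(4) in auto)
  ultimately obtain B where B: "B > 0" "\<And>z. z \<in> C \<times> sphere (0::'b) 1 \<Longrightarrow> \<bar>f z\<bar> \<le> B"
    using compact_continuous_bound[of "C \<times> sphere (0::'b) 1" f] by auto
  have "\<bar>f (x, \<xi>)\<bar> \<le> B * norm \<xi> powi d" if "x \<in> C" "\<xi> \<noteq> 0" for x \<xi>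
  proof -
    have "f (x, norm \<xi> *\<^sub>R ((1 / norm \<xi>) *\<^sub>R \<xi>)) = norm \<xi> powi d * f (x, (1 / norm \<xi>) *\<^sub>R \<xi>)"
      by (intro hom) (use that assms(4) in auto)
    moreover have "\<bar>f (x, (1 / norm \<xi>) *\<^sub>R \<xi>)\<bar> \<le> B"
      using that by (intro B(2)) auto
    ultimately show ?thesis
      using that by (auto simp: abs_mult mult.commute intro!: mult_right_mono)
  qed
  then show ?thesis using B(1) by blast
qed

section \<open>The cutoff function\<close>

lemma cutoff_properties:
  assumes "cutoff \<omega>"
  shows "smooth_on UNIV \<omega>" "\<bar>t\<bar> \<le> 1/2 \<Longrightarrow> \<omega> t = 1" "\<bar>t\<bar> \<ge> 1 \<Longrightarrow> \<omega> t = 0"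
    "0 \<le> \<omega> t" "\<omega> t \<le> 1" "t * deriv \<omega> t \<le> 0"
    "(\<omega> has_real_derivative deriv \<omega> t) (at t)"
proof -
  have even: "\<omega> (- t) = \<omega> t" for t using assms by (simp add: cutoff_def)
  have even': "\<omega> t = \<omega> \<bar>t\<bar>" for t using even by (simp add: abs_if)
  have mono: "\<omega> y \<le> \<omega> x" if "0 \<le> x" "x \<le> y" for x y
    using assms that by (auto simp: cutoff_def monotone_on_def)
  show sm: "smooth_on UNIV \<omega>" using assms by (simp add: cutoff_def)
  have one: "\<omega> t = 1" if "\<bar>t\<bar> \<le> 1/2" for t
    using assms that by (subst even') (auto simp: cutoff_def)
  have zero: "\<omega> t = 0" if "\<bar>t\<bar> \<ge> 1" for t
    using assms that by (subst even') (auto simp: cutoff_def)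
  show "\<bar>t\<bar> \<le> 1/2 \<Longrightarrow> \<omega> t = 1" "\<bar>t\<bar> \<ge> 1 \<Longrightarrow> \<omega> t = 0" using one zero by auto
  show "\<omega> t \<le> 1" using mono[of 0 "\<bar>t\<bar>"] one[of 0] by (subst even') auto
  show "0 \<le> \<omega> t" using mono[of "\<bar>t\<bar>" "max 1 \<bar>t\<bar>"] zero[of "max 1 \<bar>t\<bar>"] by (subst even') auto
  show d: "(\<omega> has_real_derivative deriv \<omega> t) (at t)"
    using smooth_on_imp_differentiable[OF sm, of t] DERIV_deriv_iff_real_differentiable by blast
  \<comment> \<open>With the opposite sign \<open>\<omega>\<close> would grow strictly when moving
    away from 0, against monotonicity on \<open>{0..}\<close> and evenness. This sign later makes
    the transition term of the mixed derivative nonnegative.\<close>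
  show "t * deriv \<omega> t \<le> 0"
  proof (rule ccontr)
    assume "\<not> t * deriv \<omega> t \<le> 0"
    then consider "t > 0" "deriv \<omega> t > 0" | "t < 0" "deriv \<omega> t < 0"
      by (auto simp: not_le zero_less_mult_iff)
    then show False
    proof cases
      case 1
      then obtain h where "h > 0" "\<forall>h'>0. h' < h \<longrightarrow> \<omega> t < \<omega> (t + h')"
        using DERIV_pos_inc_right[OF d] by blast
      then have "\<omega> t < \<omega> (t + h / 2)" by simp
      then show False using mono[of t "t + h / 2"] 1 \<open>h > 0\<close> by simp
    next
      case 2
      then obtain h where "h > 0" "\<forall>h'>0. h' < h \<longrightarrow> \<omega> t < \<omega> (t - h')"
        using DERIV_neg_dec_left[OF d] by blast
      then have "\<omega> t < \<omega> (t - h / 2)" by simp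
      then show False using mono[of "- t" "- (t - h / 2)"] even[of t] even[of "t - h/2"] 2 \<open>h > 0\<close> by simp
    qed
  qed
qed

subsection \<open>Rescaled symbol estimates in two variables\<close>

text \<open>The intermediate point is left unlocalized so that the increment may have either sign;
  the derivative bounds combined with it hold on the whole line.\<close>

lemma real_MVT_any:
  fixes g :: "real \<Rightarrow> real"
  assumes "\<And>x. (g has_real_derivative g' x) (at x)"
  shows "\<exists>z. g b - g a = (b - a) * g' z"
proof (cases a b rule: linorder_cases)
  case less then show ?thesis using MVT2[of a b g g'] assms by blast
next
  case equal then show ?thesis by simp
next
  case greater
  then obtain z where "g a - g b = (a - b) * g' z" using MVT2[of b a g g'] assms by blast
  then show ?thesis by (intro exI[of _ z]) (simp add: algebra_simps)
qed

lemma japanese_bounds: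
  fixes v :: "'a::real_normed_vector"
  shows "1 \<le> \<langle>v\<rangle>" "norm v \<le> \<langle>v\<rangle>" "\<langle>v\<rangle> \<le> 1 + norm v"
proof -
  show "1 \<le> \<langle>v\<rangle>" by (simp add: japanese_def)
  show "norm v \<le> \<langle>v\<rangle>" unfolding japanese_def by (rule real_le_rsqrt) simp
  show "\<langle>v\<rangle> \<le> 1 + norm v" unfolding japanese_def
    by (rule real_le_lsqrt) (auto simp: power2_eq_square algebra_simps)
qed

text \<open>Source of c and C in (P2): the additive constant M is absorbed because brackets are at
  least 1.\<close>

lemma japanese_comparable:
  fixes X \<tau> :: real
  assumes "0 < \<epsilon>" "0 \<le> M" "\<epsilon> * \<bar>\<tau>\<bar> - M \<le> \<bar>X\<bar>" "\<bar>X\<bar> \<le> M * \<bar>\<tau>\<bar> + M"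
  shows "1 / (1 + (M + 1) / \<epsilon>) * \<langle>\<tau>\<rangle> \<le> \<langle>X\<rangle>" "\<langle>X\<rangle> \<le> (1 + 2 * M) * \<langle>\<tau>\<rangle>"
proof -
  have "\<bar>\<tau>\<bar> \<le> (\<bar>X\<bar> + M) / \<epsilon>" using assms by (simp add: field_simps)
  also have "\<dots> \<le> (\<langle>X\<rangle> + M * \<langle>X\<rangle>) / \<epsilon>"
    using assms japanese_bounds[of X] by (intro divide_right_mono add_mono mult_le_cancel_left1[THEN iffD2]) auto
  finally have "\<langle>\<tau>\<rangle> \<le> \<langle>X\<rangle> + (\<langle>X\<rangle> + M * \<langle>X\<rangle>) / \<epsilon>"
    using japanese_bounds(3)[of \<tau>] japanese_bounds(1)[of X] by simp
  also have "\<dots> = (1 + (M + 1) / \<epsilon>) * \<langle>X\<rangle>" using assms by (simp add: field_simps)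
  finally have *: "\<langle>\<tau>\<rangle> \<le> (1 + (M + 1) / \<epsilon>) * \<langle>X\<rangle>" .
  have "0 < 1 + (M + 1) / \<epsilon>" using assms by (intro add_pos_nonneg) auto
  then show "1 / (1 + (M + 1) / \<epsilon>) * \<langle>\<tau>\<rangle> \<le> \<langle>X\<rangle>"
    using * by (simp add: pos_divide_le_eq mult.commute)
  have "\<langle>X\<rangle> \<le> 1 + (M * \<bar>\<tau>\<bar> + M)" using assms japanese_bounds(3)[of X] by simp
  also have "\<dots> \<le> \<langle>\<tau>\<rangle> + (M * \<langle>\<tau>\<rangle> + M * \<langle>\<tau>\<rangle>)"
    using assms japanese_bounds[of \<tau>] by (intro add_mono mult_left_mono mult_le_cancel_left1[THEN iffD2]) auto
  finally show "\<langle>X\<rangle> \<le> (1 + 2 * M) * \<langle>\<tau>\<rangle>" by (simp add: algebra_simps)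
qed

text \<open>
  Two applications of the mean value theorem replace the symmetry of the mixed partial derivatives.
\<close>

lemma mixed_increment_bounds:
  fixes F :: "real \<Rightarrow> real \<Rightarrow> real"
  assumes d1: "\<And>t \<tau>. ((\<lambda>s. F s \<tau>) has_real_derivative d1 t \<tau>) (at t)"
    and d2: "\<And>t \<tau>. (F t has_real_derivative d2 t \<tau>) (at \<tau>)"
    and d12: "\<And>t \<tau>. ((\<lambda>s. d2 s \<tau>) has_real_derivative d12 t \<tau>) (at t)"
    and bd: "\<And>t \<tau>. \<epsilon> \<le> d12 t \<tau>" "\<And>t \<tau>. d12 t \<tau> \<le> M" and "0 < \<epsilon>"
  shows "\<epsilon> * \<bar>\<tau>\<bar> \<le> \<bar>d1 t \<tau> - d1 t 0\<bar>" "\<bar>d1 t \<tau> - d1 t 0\<bar> \<le> M * \<bar>\<tau>\<bar>"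
proof -
  define X where "X = d1 t \<tau> - d1 t 0"
  \<comment> \<open>The factor \<tau> turns the difference quotient of R into a value of
    \<open>d12\<close> times \<tau>^2, so the estimate needs no case distinction on the sign of
    \<tau>; it is divided out at the end.\<close>
  define R where "R s = \<tau> * (F s \<tau> - F s 0)" for s
  have R: "(R has_real_derivative \<tau> * X) (at t)"
    unfolding R_def X_def by (intro DERIV_cmult DERIV_diff d1)
  have q: "\<epsilon> * \<tau>\<^sup>2 \<le> (R (t + h) - R t) / h \<and> (R (t + h) - R t) / h \<le> M * \<tau>\<^sup>2" if "h > 0" for h
  proof -
    have "\<exists>z. (F (t + h) \<tau> - F t \<tau>) - (F (t + h) 0 - F t 0) = (\<tau> - 0) * (d2 (t + h) z - d2 t z)"
      by (intro real_MVT_any[of "\<lambda>\<tau>. F (t + h) \<tau> - F t \<tau>"] DERIV_diff d2)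
    then obtain z where z: "(F (t + h) \<tau> - F t \<tau>) - (F (t + h) 0 - F t 0) = \<tau> * (d2 (t + h) z - d2 t z)"
      by auto
    obtain w where w: "d2 (t + h) z - d2 t z = (t + h - t) * d12 w z"
      using real_MVT_any[OF d12] by blast
    have "R (t + h) - R t = \<tau> * ((F (t + h) \<tau> - F t \<tau>) - (F (t + h) 0 - F t 0))"
      by (simp add: R_def algebra_simps)
    also have "\<dots> = h * (d12 w z * \<tau>\<^sup>2)" unfolding z w by (simp add: power2_eq_square)
    finally have "(R (t + h) - R t) / h = d12 w z * \<tau>\<^sup>2" using that by simp
    then show ?thesis using bd[of w z] by (auto intro: mult_right_mono)
  qed
  have lim: "((\<lambda>h. (R (t + h) - R t) / h) \<longlongrightarrow> \<tau> * X) (at_right 0)"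
    using R by (auto simp: DERIV_def intro: filterlim_at_split[THEN iffD1, THEN conjunct2])
  have 1: "\<epsilon> * \<tau>\<^sup>2 \<le> \<tau> * X"
    by (rule tendsto_lowerbound[OF lim]) (use q in \<open>auto simp: eventually_at_right_field intro!: exI[of _ 1]\<close>)
  have 2: "\<tau> * X \<le> M * \<tau>\<^sup>2"
    by (rule tendsto_upperbound[OF lim]) (use q in \<open>auto simp: eventually_at_right_field intro!: exI[of _ 1]\<close>)
  show "\<epsilon> * \<bar>\<tau>\<bar> \<le> \<bar>d1 t \<tau> - d1 t 0\<bar>" "\<bar>d1 t \<tau> - d1 t 0\<bar> \<le> M * \<bar>\<tau>\<bar>"
  proof -
    have nn: "0 \<le> \<tau> * X" using 1 \<open>0 < \<epsilon>\<close> by (meson mult_nonneg_nonneg order_trans less_imp_le zero_le_power2)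
    have e: "\<tau> * X = \<bar>\<tau>\<bar> * \<bar>X\<bar>" using nn by (metis abs_mult abs_of_nonneg)
    have t: "\<tau>\<^sup>2 = \<bar>\<tau>\<bar> * \<bar>\<tau>\<bar>" by (simp add: power2_eq_square)
    have "\<epsilon> * \<bar>\<tau>\<bar> \<le> \<bar>X\<bar> \<and> \<bar>X\<bar> \<le> M * \<bar>\<tau>\<bar>"
    proof (cases "\<tau> = 0")
      case True then show ?thesis by (simp add: X_def)
    next
      case False
      then have p: "0 < \<bar>\<tau>\<bar>" by simp
      have "\<bar>\<tau>\<bar> * (\<epsilon> * \<bar>\<tau>\<bar>) \<le> \<bar>\<tau>\<bar> * \<bar>X\<bar>" "\<bar>\<tau>\<bar> * \<bar>X\<bar> \<le> \<bar>\<tau>\<bar> * (M * \<bar>\<tau>\<bar>)"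
        using 1 2 unfolding e t by (simp_all add: algebra_simps)
      then show ?thesis using p by (simp only: mult_le_cancel_left_pos)
    qed
    then show "\<epsilon> * \<bar>\<tau>\<bar> \<le> \<bar>d1 t \<tau> - d1 t 0\<bar>" "\<bar>d1 t \<tau> - d1 t 0\<bar> \<le> M * \<bar>\<tau>\<bar>"
      by (simp_all add: X_def)
  qed
qed

lemma smooth_partials:
  fixes F :: "real \<Rightarrow> real \<Rightarrow> real"
  assumes "smooth_on UNIV (\<lambda>(t, \<tau>). F t \<tau>)"
  shows "((\<lambda>s. F s \<tau>) has_real_derivative deriv (\<lambda>s. F s \<tau>) t) (at t)"
    and "(F t has_real_derivative deriv (F t) \<tau>) (at \<tau>)"
    and "((\<lambda>s. deriv (F s) \<tau>) has_real_derivative deriv (\<lambda>s. deriv (F s) \<tau>) t) (at t)"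
proof -
  define f where "f = (\<lambda>(t, \<tau>). F t \<tau>)"
  have f: "f differentiable (at z)" "dirder v f differentiable (at z)" for v z
    using assms unfolding f_def
    by (auto intro!: smooth_on_imp_differentiable[of UNIV] smooth_on_dirder simp del: split_paired_All)
  have 1: "((\<lambda>s. F s \<tau>) has_real_derivative dirder (1, 0) f (t, \<tau>)) (at t)" for t \<tau>
    using has_real_derivative_line[of f "(0, \<tau>)" 1 t "(1, 0)"] f by (simp add: f_def)
  have 2: "(F t has_real_derivative dirder (0, 1) f (t, \<tau>)) (at \<tau>)" for t \<tau>
    using has_real_derivative_line[of f "(t, 0)" 1 \<tau> "(0, 1)"] f by (simp add: f_def)
  have e: "deriv (F t) \<tau> = dirder (0, 1) f (t, \<tau>)" for t \<tau>
    using 2 by (rule DERIV_imp_deriv)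
  have 3: "((\<lambda>s. deriv (F s) \<tau>) has_real_derivative dirder (1, 0) (dirder (0, 1) f) (t, \<tau>)) (at t)" for t \<tau>
    using has_real_derivative_line[of "dirder (0, 1) f" "(0, \<tau>)" 1 t "(1, 0)"] f by (simp add: e)
  show "((\<lambda>s. F s \<tau>) has_real_derivative deriv (\<lambda>s. F s \<tau>) t) (at t)"
    "(F t has_real_derivative deriv (F t) \<tau>) (at \<tau>)"
    "((\<lambda>s. deriv (F s) \<tau>) has_real_derivative deriv (\<lambda>s. deriv (F s) \<tau>) t) (at t)"
    using 1 2 3 DERIV_imp_deriv by metis+
qed

text \<open>The two variables enter asymmetrically. Since F vanishes for t = 0, so does its
  \<tau>-derivative, and integrating the mixed derivative in t starts from 0. The t-derivative at
  \<tau> = 0 is merely bounded by M, and its increment in \<tau> needs the mixed derivative in the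
  other order, which \<open>mixed_increment_bounds\<close> circumvents.\<close>

lemma japanese_gradient_bounds:
  fixes F :: "real \<Rightarrow> real \<Rightarrow> real"
  assumes sm: "smooth_on UNIV (\<lambda>(t, \<tau>). F t \<tau>)" and "0 < \<epsilon>"
    and F0: "\<And>\<tau>. F 0 \<tau> = 0"
    and d12: "\<And>t \<tau>. \<epsilon> \<le> deriv (\<lambda>s. deriv (F s) \<tau>) t" "\<And>t \<tau>. deriv (\<lambda>s. deriv (F s) \<tau>) t \<le> M"
    and d10: "\<And>t. \<bar>deriv (\<lambda>s. F s 0) t\<bar> \<le> M"
  shows "1 / (1 + (M + 1) / \<epsilon>) * \<langle>\<tau>\<rangle> \<le> \<langle>deriv (\<lambda>s. F s \<tau>) t\<rangle>"
    "\<langle>deriv (\<lambda>s. F s \<tau>) t\<rangle> \<le> (1 + 2 * M) * \<langle>\<tau>\<rangle>"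
    "1 / (1 + (M + 1) / \<epsilon>) * \<langle>t\<rangle> \<le> \<langle>deriv (F t) \<tau>\<rangle>"
    "\<langle>deriv (F t) \<tau>\<rangle> \<le> (1 + 2 * M) * \<langle>t\<rangle>"
proof -
  note P = smooth_partials[OF sm]
  have M: "0 \<le> M" using d10[of 0] by (meson abs_ge_zero order_trans)
  define X where "X = deriv (\<lambda>s. F s \<tau>) t"
  have "\<epsilon> * \<bar>\<tau>\<bar> \<le> \<bar>X - deriv (\<lambda>s. F s 0) t\<bar>" "\<bar>X - deriv (\<lambda>s. F s 0) t\<bar> \<le> M * \<bar>\<tau>\<bar>"
    using mixed_increment_bounds[of F "\<lambda>t \<tau>. deriv (\<lambda>s. F s \<tau>) t", OF P d12 \<open>0 < \<epsilon>\<close>]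
    unfolding X_def by auto
  then have "\<epsilon> * \<bar>\<tau>\<bar> - M \<le> \<bar>X\<bar>" "\<bar>X\<bar> \<le> M * \<bar>\<tau>\<bar> + M" using d10[of t] by auto
  from japanese_comparable[OF \<open>0 < \<epsilon>\<close> M this]
  show "1 / (1 + (M + 1) / \<epsilon>) * \<langle>\<tau>\<rangle> \<le> \<langle>deriv (\<lambda>s. F s \<tau>) t\<rangle>"
    "\<langle>deriv (\<lambda>s. F s \<tau>) t\<rangle> \<le> (1 + 2 * M) * \<langle>\<tau>\<rangle>" by (auto simp: X_def)
  have "F 0 = (\<lambda>_. 0)" using F0 by auto
  then have z: "deriv (F 0) \<tau> = 0" by simp
  obtain w where w: "deriv (F t) \<tau> - deriv (F 0) \<tau> = (t - 0) * deriv (\<lambda>s. deriv (F s) \<tau>) w"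
    using real_MVT_any[OF P(3)] by blast
  then have e: "\<bar>deriv (F t) \<tau>\<bar> = deriv (\<lambda>s. deriv (F s) \<tau>) w * \<bar>t\<bar>"
    using z d12(1)[of \<tau> w] \<open>0 < \<epsilon>\<close> by (simp add: abs_mult)
  have "\<epsilon> * \<bar>t\<bar> \<le> \<bar>deriv (F t) \<tau>\<bar>" "\<bar>deriv (F t) \<tau>\<bar> \<le> M * \<bar>t\<bar>"
    unfolding e using d12[of \<tau> w] by (auto intro: mult_right_mono)
  then have "\<epsilon> * \<bar>t\<bar> - M \<le> \<bar>deriv (F t) \<tau>\<bar>" "\<bar>deriv (F t) \<tau>\<bar> \<le> M * \<bar>t\<bar> + M" using M by auto
  from japanese_comparable[OF \<open>0 < \<epsilon>\<close> M this]
  show "1 / (1 + (M + 1) / \<epsilon>) * \<langle>t\<rangle> \<le> \<langle>deriv (F t) \<tau>\<rangle>"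
    "\<langle>deriv (F t) \<tau>\<rangle> \<le> (1 + 2 * M) * \<langle>t\<rangle>" by auto
qed

text \<open>Power counting in \<mu>: \<mu>^\<alpha> from the chain rule and \<mu>^(1 - \<alpha>)
  from the symbol bound leave one factor \<mu>. For a = 0 it cancels against |s| = |t| / \<mu>; for
  a \<ge> 1 there remains \<mu>^(1 - a), which is comparable with \<langle>t\<rangle>^(1 - a) as
  long as |t| \<le> k * \<mu>.\<close>

lemma symbol_bound_rescaled:
  fixes D :: "nat \<Rightarrow> nat \<Rightarrow> real \<Rightarrow> real \<Rightarrow> real"
  assumes "1 \<le> \<mu>" "0 < k" "0 < K" "\<And>a \<alpha>. 0 \<le> B a \<alpha>"
    and inner: "\<And>a \<alpha> s \<tau>. \<bar>s\<bar> \<le> k \<Longrightarrow>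
      \<bar>D a \<alpha> s (\<tau> * \<mu>)\<bar> \<le> (if a = 0 then \<bar>s\<bar> else 1) * B a \<alpha> * (\<mu> * \<langle>\<tau>\<rangle>) powi (1 - int \<alpha>)"
    and outer: "\<And>a \<alpha> s \<eta>. k < \<bar>s\<bar> \<Longrightarrow> D a \<alpha> s \<eta> =
      K * (if a = 0 then s else if a = 1 then 1 else 0) * (if \<alpha> = 0 then \<eta> else if \<alpha> = 1 then 1 else 0)"
  shows "\<bar>\<mu> ^ \<alpha> / \<mu> ^ a * D a \<alpha> (t / \<mu>) (\<tau> * \<mu>)\<bar>
    \<le> (K + B a \<alpha> * (1 + k) ^ a) * \<langle>t\<rangle> powi (1 - int a) * \<langle>\<tau>\<rangle> powi (1 - int \<alpha>)"
proof -
  have pos: "0 < \<mu>" using assms by simp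
  have jpos: "0 < \<langle>t\<rangle>" "0 < \<langle>\<tau>\<rangle>" using japanese_bounds(1)[of t] japanese_bounds(1)[of \<tau>] by auto
  have Bnn: "0 \<le> B a \<alpha> * (1 + k) ^ a" using assms by auto
  have P: "\<mu> ^ \<alpha> * \<mu> powi (1 - int \<alpha>) = \<mu>"
    using pos by (simp add: power_int_diff)
  show ?thesis
  proof (cases "\<bar>t / \<mu>\<bar> \<le> k")
    case True
    have tk: "\<bar>t\<bar> \<le> k * \<mu>" using True pos by (simp add: abs_divide pos_divide_le_eq)
    have "\<bar>\<mu> ^ \<alpha> / \<mu> ^ a * D a \<alpha> (t / \<mu>) (\<tau> * \<mu>)\<bar>
        \<le> \<mu> ^ \<alpha> / \<mu> ^ a * ((if a = 0 then \<bar>t / \<mu>\<bar> else 1) * B a \<alpha> * (\<mu> * \<langle>\<tau>\<rangle>) powi (1 - int \<alpha>))"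
      using inner[OF True, of a \<alpha> \<tau>] pos by (simp add: abs_mult divide_simps mult_left_mono)
    also have "\<dots> = (if a = 0 then \<bar>t / \<mu>\<bar> else 1) / \<mu> ^ a * (\<mu> ^ \<alpha> * \<mu> powi (1 - int \<alpha>)) * B a \<alpha> * \<langle>\<tau>\<rangle> powi (1 - int \<alpha>)"
      by (simp add: power_int_mult_distrib)
    also have "\<dots> = (if a = 0 then \<bar>t\<bar> else \<mu> / \<mu> ^ a) * B a \<alpha> * \<langle>\<tau>\<rangle> powi (1 - int \<alpha>)"
      unfolding P using pos by simp
    also have "\<dots> \<le> ((1 + k) ^ a * \<langle>t\<rangle> powi (1 - int a)) * B a \<alpha> * \<langle>\<tau>\<rangle> powi (1 - int \<alpha>)"
    proof (intro mult_right_mono)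
      show "(if a = 0 then \<bar>t\<bar> else \<mu> / \<mu> ^ a) \<le> (1 + k) ^ a * \<langle>t\<rangle> powi (1 - int a)"
      proof (cases a)
        case 0 then show ?thesis using japanese_bounds(2)[of t] by simp
      next
        case (Suc n)
        \<comment> \<open>Here the inner region is used: negative powers of \<mu> become negative
          powers of \<langle>t\<rangle>, at the cost of a power of 1 + k.\<close>
        have "\<langle>t\<rangle> \<le> (1 + k) * \<mu>"
          using japanese_bounds(3)[of t] tk assms(1) by (simp add: algebra_simps)
        then have "\<langle>t\<rangle> ^ n \<le> (1 + k) ^ n * \<mu> ^ n"
          using jpos power_mono[of "\<langle>t\<rangle>" "(1 + k) * \<mu>" n] by (simp add: power_mult_distrib)
        also have "\<dots> \<le> (1 + k) ^ a * \<mu> ^ n"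
          using Suc pos assms by (intro mult_right_mono power_increasing) auto
        finally have "1 / \<mu> ^ n \<le> (1 + k) ^ a / \<langle>t\<rangle> ^ n"
          using pos jpos by (simp add: divide_simps mult.commute)
        then show ?thesis using Suc pos by (simp add: power_int_minus divide_simps)
      qed
    qed (use assms jpos in auto)
    also have "\<dots> = B a \<alpha> * (1 + k) ^ a * \<langle>t\<rangle> powi (1 - int a) * \<langle>\<tau>\<rangle> powi (1 - int \<alpha>)" by simp
    also have "\<dots> \<le> (K + B a \<alpha> * (1 + k) ^ a) * \<langle>t\<rangle> powi (1 - int a) * \<langle>\<tau>\<rangle> powi (1 - int \<alpha>)"
      using assms jpos by (intro mult_right_mono) auto
    finally show ?thesis .
  next
    case False
    \<comment> \<open>\<open>u a\<close> is the a-th derivative of the identity. In this region the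
      phase is K * s * \<eta>, and (t / \<mu>) * (\<tau> * \<mu>) = t * \<tau>, so all powers of
      \<mu> cancel.\<close>
    define u where "u a t = (if a = 0 then t else if a = 1 then 1 else 0)" for a :: nat and t :: real
    have u: "\<bar>u a t\<bar> \<le> \<langle>t\<rangle> powi (1 - int a)" for a t
      using japanese_bounds[of t] by (auto simp: u_def)
    have "\<mu> ^ \<alpha> / \<mu> ^ a * D a \<alpha> (t / \<mu>) (\<tau> * \<mu>) = K * u a t * u \<alpha> \<tau>"
      using outer[of "t / \<mu>" a \<alpha> "\<tau> * \<mu>"] False pos by (simp add: u_def)
    then have "\<bar>\<mu> ^ \<alpha> / \<mu> ^ a * D a \<alpha> (t / \<mu>) (\<tau> * \<mu>)\<bar> = K * \<bar>u a t\<bar> * \<bar>u \<alpha> \<tau>\<bar>"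
      using \<open>0 < K\<close> by (simp add: abs_mult)
    also have "\<dots> \<le> (K + B a \<alpha> * (1 + k) ^ a) * \<langle>t\<rangle> powi (1 - int a) * \<langle>\<tau>\<rangle> powi (1 - int \<alpha>)"
      using u Bnn \<open>0 < K\<close> jpos by (intro mult_mono mult_nonneg_nonneg) auto
    finally show ?thesis .
  qed
qed

subsection \<open>The localized phase\<close>

abbreviation e_x :: "'m::finite cotangent" where "e_x \<equiv> ((0, 1), 0)"
abbreviation e_\<xi> :: "'m::finite cotangent" where "e_\<xi> \<equiv> (0, (0, 1))"

text \<open>
  \<open>\<psi>(x', 0, \<xi>)\<close> takes the place of \<open>\<psi>\<^sub>\<partial>(x', \<xi>')\<close>: it has the same value for \<open>\<xi>' \<noteq> 0\<close>, whereas
  \<open>boundary_phase \<psi> x' 0\<close> involves the junk value of \<open>\<psi>\<close> at \<open>\<xi> = 0\<close> and so need not be smooth at \<open>\<xi>' = 0\<close>.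
\<close>

definition localized_phase ::
  "(real \<Rightarrow> real) \<Rightarrow> real \<Rightarrow> real \<Rightarrow> (('m::finite) cotangent \<Rightarrow> real) \<Rightarrow> 'm cotangent \<Rightarrow> real" where
  "localized_phase \<omega> k K p z =
     \<omega> (snd (fst z) / k) * (p z - p ((fst (fst z), 0), snd z))
     + (1 - \<omega> (snd (fst z) / k)) * (K * snd (fst z) * snd (snd z))"

lemma open_strip: "open N \<Longrightarrow> open (strip N \<delta>)"
  by (simp add: strip_def open_Times)

lemma bounded_linear_components:
  "bounded_linear (\<lambda>z::'m::finite cotangent. snd (fst z))"
  "bounded_linear (\<lambda>z::'m::finite cotangent. snd (snd z))"
  "bounded_linear (\<lambda>z::'m::finite cotangent. ((fst (fst z), 0::real), snd z))"
  by (auto intro!: bounded_linear_intros)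

lemma smooth_on_cutoff:
  assumes "cutoff \<omega>" "open S"
  shows "smooth_on S (\<lambda>z::'m::finite cotangent. \<omega> (snd (fst z) / k))"
proof (rule smooth_on_compose[OF cutoff_properties(1)[OF assms(1)] _ assms(2)])
  show "smooth_on S (\<lambda>z::'m cotangent. snd (fst z) / k)"
    by (intro smooth_on_linear bounded_linear_compose[OF bounded_linear_divide bounded_linear_components(1)])
qed auto

lemma localized_phase_outer:
  assumes "cutoff \<omega>" "0 < k" "k \<le> \<bar>s\<bar>"
  shows "localized_phase \<omega> k K p ((x', s), \<xi>) = K * s * snd \<xi>"
  using cutoff_properties(3)[OF assms(1), of "s / k"] assms by (simp add: localized_phase_def)

text \<open>Because k < \<delta>, the open regions |x_n| < \<delta> and |x_n| > k cover everything.
  On the second one the cutoff has died out and the phase is K * x_n * \<xi>_n, whatever values p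
  takes there.\<close>

lemma smooth_on_localized_phase:
  fixes p :: "('m::finite) cotangent \<Rightarrow> real"
  assumes sm: "smooth_on (strip N \<delta> \<times> \<Xi>) p" and o: "open N" "open \<Xi>" and c: "cutoff \<omega>" and k: "0 < k" "k < \<delta>"
  shows "smooth_on ((N \<times> UNIV) \<times> \<Xi>) (localized_phase \<omega> k K p)"
proof -
  let ?S = "strip N \<delta> \<times> \<Xi>" and ?T = "(N \<times> {s. k < \<bar>s\<bar>}) \<times> \<Xi>"
  have oS: "open ?S" using o open_strip by (intro open_Times)
  have oT: "open ?T" using o by (intro open_Times open_Collect_less continuous_intros)
  have 1: "smooth_on ?S (\<lambda>z. p ((fst (fst z), 0), snd z))"
    by (rule smooth_on_compose[OF sm smooth_on_linear[OF bounded_linear_components(3)] oS])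
      (use k in \<open>auto simp: strip_def\<close>)
  have lin: "smooth_on S (\<lambda>z::'m cotangent. K * snd (fst z) * snd (snd z))" if "open S" for S
    using that by (intro smooth_on_mult smooth_on_const smooth_on_linear bounded_linear_components)
  have S: "smooth_on ?S (localized_phase \<omega> k K p)"
    unfolding localized_phase_def[abs_def]
    by (intro smooth_on_add smooth_on_mult smooth_on_diff smooth_on_const smooth_on_cutoff c oS sm 1 lin)
  have T: "smooth_on ?T (localized_phase \<omega> k K p)"
    by (rule smooth_on_cong_open[OF oT _ lin[OF oT]]) (auto simp: localized_phase_outer[OF c k(1)])
  show ?thesis
    by (rule smooth_on_subset[OF smooth_on_Un_open[OF oS oT S T]]) (use k in \<open>auto simp: strip_def\<close>)
qed

lemma deriv_x:
  fixes f :: "('m::finite) cotangent \<Rightarrow> real"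
  assumes "f differentiable (at ((x', s), \<xi>))"
  shows "((\<lambda>s. f ((x', s), \<xi>)) has_real_derivative dirder e_x f ((x', s), \<xi>)) (at s)"
  using has_real_derivative_line[of f "((x', 0), \<xi>)" 1 s e_x] assms by simp

lemma deriv_\<xi>:
  fixes f :: "('m::finite) cotangent \<Rightarrow> real"
  assumes "f differentiable (at (x, (\<xi>', \<eta>)))"
  shows "((\<lambda>\<eta>. f (x, (\<xi>', \<eta>))) has_real_derivative dirder e_\<xi> f (x, (\<xi>', \<eta>))) (at \<eta>)"
  using has_real_derivative_line[of f "(x, (\<xi>', 0))" 1 \<eta> e_\<xi>] assms by simp

text \<open>
  In the transition region the last term \<open>\<omega>' (s/k) (q(s) - K s) / k\<close> is nonnegative: its two factors
  have the same sign as soon as \<open>K\<close> dominates \<open>q(s) / s\<close>.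
\<close>

lemma localized_phase_mixed_lower:
  fixes p :: "('m::finite) cotangent \<Rightarrow> real"
  assumes sm: "smooth_on (strip N \<delta> \<times> \<Xi>) p" and o: "open N" "open \<Xi>" and c: "cutoff \<omega>" and k: "0 < k" "k < \<delta>"
    and x: "x' \<in> N" "\<And>\<eta>. (\<xi>', \<eta>) \<in> \<Xi>"
    and q0: "dirder e_\<xi> p ((x', 0), (\<xi>', \<eta>)) = 0"
    and q1: "\<And>s. \<bar>s\<bar> \<le> k \<Longrightarrow> \<epsilon> \<le> dirder e_x (dirder e_\<xi> p) ((x', s), (\<xi>', \<eta>))"
      "\<And>s. \<bar>s\<bar> \<le> k \<Longrightarrow> dirder e_x (dirder e_\<xi> p) ((x', s), (\<xi>', \<eta>)) \<le> K"
  shows "\<epsilon> \<le> dirder e_x (dirder e_\<xi> (localized_phase \<omega> k K p)) ((x', s), (\<xi>', \<eta>))"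
proof -
  define Q where "Q = localized_phase \<omega> k K p"
  define q where "q s = dirder e_\<xi> p ((x', s), (\<xi>', \<eta>))" for s
  define q' where "q' s = dirder e_x (dirder e_\<xi> p) ((x', s), (\<xi>', \<eta>))" for s
  have smQ: "smooth_on ((N \<times> UNIV) \<times> \<Xi>) Q" unfolding Q_def
    by (rule smooth_on_localized_phase[OF sm o c k])
  have dp: "p differentiable (at ((x', s), (\<xi>', \<eta>)))" "dirder e_\<xi> p differentiable (at ((x', s), (\<xi>', \<eta>)))"
    if "\<bar>s\<bar> < \<delta>" for s \<eta>
    using that x by (auto intro!: smooth_on_imp_differentiable[OF sm] smooth_on_imp_differentiable[OF smooth_on_dirder[OF sm]] simp: strip_def)
  have dQ: "Q differentiable (at ((x', s), (\<xi>', \<eta>)))" "dirder e_\<xi> Q differentiable (at ((x', s), (\<xi>', \<eta>)))" for s \<eta>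
    using x by (auto intro!: smooth_on_imp_differentiable[OF smQ] smooth_on_imp_differentiable[OF smooth_on_dirder[OF smQ]])
  note d\<omega> = cutoff_properties(7)[OF c]
  have Q1: "dirder e_\<xi> Q ((x', s), (\<xi>', \<eta>)) = \<omega> (s / k) * q s + (1 - \<omega> (s / k)) * (K * s)" if "\<bar>s\<bar> < \<delta>" for s
  proof -
    have "((\<lambda>\<eta>. Q ((x', s), (\<xi>', \<eta>))) has_real_derivative
        \<omega> (s / k) * (q s - dirder e_\<xi> p ((x', 0), (\<xi>', \<eta>))) + (1 - \<omega> (s / k)) * (K * s)) (at \<eta>)"
      unfolding Q_def localized_phase_def q_def using that dp[of s \<eta>] dp[of 0 \<eta>] k
      by (auto intro!: derivative_eq_intros deriv_\<xi>)
    then show ?thesis using DERIV_unique[OF deriv_\<xi>[OF dQ(1)]] q0 by simp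
  qed
  have Q11: "dirder e_x (dirder e_\<xi> Q) ((x', s), (\<xi>', \<eta>)) =
      \<omega> (s / k) * q' s + (1 - \<omega> (s / k)) * K + deriv \<omega> (s / k) * (q s - K * s) / k" if "\<bar>s\<bar> < \<delta>" for s
  proof -
    have qd: "(q has_real_derivative q' s) (at s)"
      unfolding q_def q'_def using deriv_x[OF dp(2)[OF that]] .
    have "((\<lambda>s. \<omega> (s / k)) has_real_derivative deriv \<omega> (s / k) * (1 / k)) (at s)"
      by (rule DERIV_chain2[OF d\<omega>]) (use k in \<open>auto intro!: derivative_eq_intros\<close>)
    then have "((\<lambda>s. \<omega> (s / k) * q s + (1 - \<omega> (s / k)) * (K * s)) has_real_derivative
        \<omega> (s / k) * q' s + (1 - \<omega> (s / k)) * K + deriv \<omega> (s / k) * (q s - K * s) / k) (at s)"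
      using qd k by (auto intro!: derivative_eq_intros simp: algebra_simps diff_divide_distrib)
    then have "((\<lambda>s. dirder e_\<xi> Q ((x', s), (\<xi>', \<eta>))) has_real_derivative
        \<omega> (s / k) * q' s + (1 - \<omega> (s / k)) * K + deriv \<omega> (s / k) * (q s - K * s) / k) (at s)"
      by (rule has_field_derivative_transform_within_open[of _ _ _ "{-\<delta><..<\<delta>}"])
        (use that Q1 in \<open>auto simp: abs_less_iff\<close>)
    then show ?thesis using DERIV_unique[OF deriv_x[OF dQ(2)]] by blast
  qed
  have "\<epsilon> \<le> K" using q1[of 0] k by auto
  show ?thesis
  proof (cases "\<bar>s\<bar> \<le> k")
    case True
    have sgn: "s * (q s - K * s) \<le> 0"
    proof -
      \<comment> \<open>As q(0) = 0, the quotient q(s) / s is a value of q' inside [-k, k]; thus the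
        upper bound K on q' is what dominates it.\<close>
      have "\<exists>w. \<bar>w\<bar> \<le> k \<and> q s = s * q' w"
      proof (cases s "0::real" rule: linorder_cases)
        case less
        then have "\<exists>z. s < z \<and> z < 0 \<and> q 0 - q s = (0 - s) * q' z"
          using True k by (intro MVT2) (auto simp: q_def q'_def intro!: deriv_x dp(2))
        then obtain z where "s < z" "z < 0" "q 0 - q s = (0 - s) * q' z" by blast
        then show ?thesis using True q0 by (intro exI[of _ z]) (auto simp: q_def)
      next
        case equal then show ?thesis using k q0 by (intro exI[of _ 0]) (auto simp: q_def)
      next
        case greater
        then have "\<exists>z. 0 < z \<and> z < s \<and> q s - q 0 = (s - 0) * q' z"
          using True k by (intro MVT2) (auto simp: q_def q'_def intro!: deriv_x dp(2))
        then obtain z where "0 < z" "z < s" "q s - q 0 = (s - 0) * q' z" by blast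
        then show ?thesis using True q0 by (intro exI[of _ z]) (auto simp: q_def)
      qed
      then obtain w where w: "\<bar>w\<bar> \<le> k" "q s = s * q' w" by blast
      have "s * (q s - K * s) = (s * s) * (q' w - K)" unfolding w by (simp add: algebra_simps)
      also have "\<dots> \<le> 0" using q1(2)[OF w(1)] by (intro mult_nonneg_nonpos) (auto simp: q'_def)
      finally show ?thesis .
    qed
    have nn: "0 \<le> deriv \<omega> (s / k) * (q s - K * s)"
    proof -
      have "s / k * deriv \<omega> (s / k) \<le> 0" by (rule cutoff_properties(6)[OF c])
      then have a: "s * deriv \<omega> (s / k) \<le> 0" using k by (simp add: divide_le_0_iff)
      show ?thesis
      proof (cases "s = 0")
        case True then show ?thesis using q0 by (simp add: q_def)
      next
        case False
        then show ?thesis using a sgn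
          by (auto simp: mult_le_0_iff zero_le_mult_iff)
      qed
    qed
    \<comment> \<open>The first two terms form a convex combination of q'(s) and K, both at least
      \<epsilon>.\<close>
    have "\<epsilon> = \<omega> (s / k) * \<epsilon> + (1 - \<omega> (s / k)) * \<epsilon>" by (simp add: algebra_simps)
    also have "\<dots> \<le> \<omega> (s / k) * q' s + (1 - \<omega> (s / k)) * K"
      using cutoff_properties(4,5)[OF c, of "s / k"] q1(1)[OF True] \<open>\<epsilon> \<le> K\<close>
      by (intro add_mono mult_left_mono) (auto simp: q'_def)
    also have "\<dots> \<le> dirder e_x (dirder e_\<xi> Q) ((x', s), (\<xi>', \<eta>))"
      using Q11[of s] True k nn by simp
    finally show ?thesis by (simp add: Q_def)
  next
    case False
    \<comment> \<open>\<open>Q11\<close> stops at |s| = \<delta>; beyond k the phase is computed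
      directly from its linear form.\<close>
    have Q1: "dirder e_\<xi> Q ((x', s), (\<xi>', \<eta>)) = K * s" if "k < \<bar>s\<bar>" for s
    proof -
      have "((\<lambda>\<eta>. Q ((x', s), (\<xi>', \<eta>))) has_real_derivative K * s) (at \<eta>)"
        using that by (auto simp: Q_def localized_phase_outer[OF c k(1)] intro!: derivative_eq_intros)
      then show ?thesis using DERIV_unique[OF deriv_\<xi>[OF dQ(1)]] by simp
    qed
    have "((\<lambda>s. K * s) has_real_derivative K) (at s)" by (auto intro!: derivative_eq_intros)
    then have "((\<lambda>s. dirder e_\<xi> Q ((x', s), (\<xi>', \<eta>))) has_real_derivative K) (at s)"
      by (rule has_field_derivative_transform_within_open[of _ _ _ "{s. k < \<bar>s\<bar>}"])
        (use False Q1 in \<open>auto intro!: open_Collect_less continuous_intros\<close>)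
    then show ?thesis using DERIV_unique[OF deriv_x[OF dQ(2)]] \<open>\<epsilon> \<le> K\<close> by (auto simp: Q_def)
  qed
qed

text \<open>Derivatives on an open set depend only on the values there, so Q may be replaced by the
  global product K * x_n * \<xi>_n, whose derivatives separate into those of the two identity
  functions.\<close>

lemma symbol_outer:
  fixes Q :: "('m::finite) cotangent \<Rightarrow> real"
  assumes "open T" "\<And>z. z \<in> T \<Longrightarrow> Q z = K * snd (fst z) * snd (snd z)" "z \<in> T"
  shows "(dirder e_x ^^ a) ((dirder e_\<xi> ^^ \<alpha>) Q) z = K * (if a = 0 then snd (fst z) else if a = 1 then 1 else 0)
    * (if \<alpha> = 0 then snd (snd z) else if \<alpha> = 1 then 1 else 0)"
proof -
  define u :: "nat \<Rightarrow> real \<Rightarrow> real" where "u a t = (if a = 0 then t else if a = 1 then 1 else 0)" for a t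
  have u: "(u a has_real_derivative u (Suc a) t) (at t)" for a t
    unfolding u_def by (cases a) (auto intro!: derivative_eq_intros)
  have diff: "(\<lambda>z::'m cotangent. K * u a (snd (fst z)) * u \<alpha> (snd (snd z))) differentiable (at z)" for a \<alpha> z
  proof -
    have "((\<lambda>z::'m cotangent. u a (snd (fst z))) has_derivative (\<lambda>v. u (Suc a) (snd (fst z)) * snd (fst v))) (at z)"
      by (rule has_derivative_compose[OF _ u[of a, unfolded has_field_derivative_def]])
        (auto intro!: bounded_linear_imp_has_derivative bounded_linear_components)
    moreover have "((\<lambda>z::'m cotangent. u \<alpha> (snd (snd z))) has_derivative (\<lambda>v. u (Suc \<alpha>) (snd (snd z)) * snd (snd v))) (at z)"
      by (rule has_derivative_compose[OF _ u[of \<alpha>, unfolded has_field_derivative_def]])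
        (auto intro!: bounded_linear_imp_has_derivative bounded_linear_components)
    ultimately show ?thesis
      by (intro differentiable_mult differentiable_const) (auto intro: differentiableI)
  qed
  have dx: "dirder e_x (\<lambda>z::'m cotangent. K * u a (snd (fst z)) * u \<alpha> (snd (snd z))) = (\<lambda>z. K * u (Suc a) (snd (fst z)) * u \<alpha> (snd (snd z)))" for a \<alpha>
  proof
    fix z :: "'m cotangent"
    obtain x' s \<xi> where z: "z = ((x', s), \<xi>)" by (cases z) auto
    have "((\<lambda>s. K * u a s * u \<alpha> (snd \<xi>)) has_real_derivative K * u (Suc a) s * u \<alpha> (snd \<xi>)) (at s)"
      using u by (auto intro!: derivative_eq_intros)
    then show "dirder e_x (\<lambda>z::'m cotangent. K * u a (snd (fst z)) * u \<alpha> (snd (snd z))) z = K * u (Suc a) (snd (fst z)) * u \<alpha> (snd (snd z))"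
      using DERIV_unique[OF deriv_x[OF diff[of a \<alpha> "((x', s), \<xi>)"]]] z by simp
  qed
  have d\<xi>: "dirder e_\<xi> (\<lambda>z::'m cotangent. K * u a (snd (fst z)) * u \<alpha> (snd (snd z))) = (\<lambda>z. K * u a (snd (fst z)) * u (Suc \<alpha>) (snd (snd z)))" for a \<alpha>
  proof
    fix z :: "'m cotangent"
    obtain x \<xi>' \<eta> where z: "z = (x, (\<xi>', \<eta>))" by (cases z) auto
    have "((\<lambda>\<eta>. K * u a (snd x) * u \<alpha> \<eta>) has_real_derivative K * u a (snd x) * u (Suc \<alpha>) \<eta>) (at \<eta>)"
      using u by (auto intro!: derivative_eq_intros)
    then show "dirder e_\<xi> (\<lambda>z::'m cotangent. K * u a (snd (fst z)) * u \<alpha> (snd (snd z))) z = K * u a (snd (fst z)) * u (Suc \<alpha>) (snd (snd z))"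
      using DERIV_unique[OF deriv_\<xi>[OF diff[of a \<alpha> "(x, (\<xi>', \<eta>))"]]] z by simp
  qed
  have 1: "(dirder e_\<xi> ^^ \<alpha>) (\<lambda>z::'m cotangent. K * u 0 (snd (fst z)) * u 0 (snd (snd z))) = (\<lambda>z. K * u 0 (snd (fst z)) * u \<alpha> (snd (snd z)))"
    by (induction \<alpha>) (simp_all add: d\<xi>)
  have 2: "(dirder e_x ^^ a) (\<lambda>z::'m cotangent. K * u 0 (snd (fst z)) * u \<alpha> (snd (snd z))) = (\<lambda>z. K * u a (snd (fst z)) * u \<alpha> (snd (snd z)))"
    by (induction a) (simp_all add: dx)
  have "(dirder e_x ^^ a) ((dirder e_\<xi> ^^ \<alpha>) Q) z
      = (dirder e_x ^^ a) ((dirder e_\<xi> ^^ \<alpha>) (\<lambda>z. K * u 0 (snd (fst z)) * u 0 (snd (snd z)))) z"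
    by (intro dirder_funpow_cong_open[OF assms(1) _ assms(3)] dirder_funpow_cong_open[OF assms(1)])
      (use assms(2) in \<open>auto simp: u_def\<close>)
  then show ?thesis unfolding 1 2 by (simp add: u_def)
qed

lemma deriv_funpow_zero: "(deriv ^^ n) (\<lambda>_::real. 0::real) = (\<lambda>_. 0)"
  by (induction n) auto

text \<open>The reason for scaling the covariable by \<langle>\<xi>'\<rangle>: a symbol bound in
  \<langle>\<xi>\<rangle> splits exactly into a power of \<langle>\<xi>'\<rangle> and the same power
  of \<langle>\<tau>\<rangle>.\<close>

lemma japanese_scale:
  fixes \<xi>' :: "'a::real_normed_vector"
  shows "\<langle>(\<xi>', \<tau> * \<langle>\<xi>'\<rangle>)\<rangle> = \<langle>\<xi>'\<rangle> * \<langle>\<tau>\<rangle>"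
proof -
  have "1 + (norm (\<xi>', \<tau> * \<langle>\<xi>'\<rangle>))\<^sup>2 = (1 + (norm \<xi>')\<^sup>2) * (1 + (norm \<tau>)\<^sup>2)"
    by (simp add: norm_Pair power_mult_distrib japanese_def algebra_simps)
  then show ?thesis by (simp add: japanese_def real_sqrt_mult)
qed

text \<open>The constant for a = 0 is borrowed from a = 1: Q vanishes at x_n = 0 together with its
  \<xi>_n-derivatives, so the mean value inequality yields |s| times the bound of the first
  x_n-derivative. This factor |s| is what the power counting in \<langle>\<xi>'\<rangle>
  requires.\<close>

lemma regular_SG_phase_rescaled:
  fixes Q :: "('m::finite) cotangent \<Rightarrow> real"
  assumes sm: "smooth_on ((N \<times> UNIV) \<times> \<Xi>) Q" and o: "open N" "open \<Xi>"
    and x: "x' \<in> N" "\<And>\<eta>. (\<xi>', \<eta>) \<in> \<Xi>"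
    and pos: "0 < k" "0 < K" "0 < \<epsilon>" "K \<le> M" "\<And>a \<alpha>. 0 \<le> B a \<alpha>"
    and bound: "\<And>a \<alpha> s \<eta>. \<bar>s\<bar> \<le> k \<Longrightarrow>
      \<bar>(dirder e_x ^^ a) ((dirder e_\<xi> ^^ \<alpha>) Q) ((x', s), (\<xi>', \<eta>))\<bar> \<le> B a \<alpha> * \<langle>(\<xi>', \<eta>)\<rangle> powi (1 - int \<alpha>)"
    and boundary: "\<And>\<eta>. Q ((x', 0), (\<xi>', \<eta>)) = 0"
    and outer: "\<And>x' s \<xi>. k < \<bar>s\<bar> \<Longrightarrow> Q ((x', s), \<xi>) = K * s * snd \<xi>"
    and lower: "\<And>s \<eta>. \<epsilon> \<le> dirder e_x (dirder e_\<xi> Q) ((x', s), (\<xi>', \<eta>))"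
    and M: "\<And>s \<eta>. \<bar>s\<bar> \<le> k \<Longrightarrow> dirder e_x (dirder e_\<xi> Q) ((x', s), (\<xi>', \<eta>)) \<le> M"
      "\<And>s \<eta>. \<bar>s\<bar> \<le> k \<Longrightarrow> \<bar>dirder e_x Q ((x', s), (\<xi>', \<eta>))\<bar> \<le> M * \<langle>(\<xi>', \<eta>)\<rangle>"
  shows "regular_SG_phase (\<lambda>a \<alpha>. K + B (if a = 0 then 1 else a) \<alpha> * (1 + k) ^ a)
     (1 / (1 + (M + 1) / \<epsilon>)) (1 + 2 * M) \<epsilon> (\<lambda>t \<tau>. Q ((x', t / \<langle>\<xi>'\<rangle>), (\<xi>', \<tau> * \<langle>\<xi>'\<rangle>)))"
proof -
  define \<mu> where "\<mu> = \<langle>\<xi>'\<rangle>"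
  define F where "F = (\<lambda>t \<tau>. Q ((x', t / \<mu>), (\<xi>', \<tau> * \<mu>)))"
  define D where "D a \<alpha> s \<eta> = (dirder e_x ^^ a) ((dirder e_\<xi> ^^ \<alpha>) Q) ((x', s), (\<xi>', \<eta>))" for a \<alpha> s \<eta>
  define B' where "B' a \<alpha> = B (if a = 0 then 1 else a) \<alpha>" for a \<alpha>
  have \<mu>: "1 \<le> \<mu>" "0 < \<mu>" using japanese_bounds(1)[of \<xi>'] by (auto simp: \<mu>_def)
  have smF: "smooth_on UNIV (\<lambda>(t, \<tau>). F t \<tau>)"
  proof -
    have l: "bounded_linear (\<lambda>z::real \<times> real. fst z / \<mu>)" "bounded_linear (\<lambda>z::real \<times> real. snd z * \<mu>)"
      by (auto intro!: bounded_linear_compose[OF bounded_linear_divide] bounded_linear_compose[OF bounded_linear_mult_left] bounded_linear_fst bounded_linear_snd)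
    have "smooth_on UNIV (\<lambda>z::real \<times> real. Q ((x', fst z / \<mu>), (\<xi>', snd z * \<mu>)))"
    proof (rule smooth_on_compose[OF sm])
      show "smooth_on UNIV (\<lambda>z::real \<times> real. ((x', fst z / \<mu>), (\<xi>', snd z * \<mu>)))"
        by (intro smooth_on_Pair smooth_on_const open_UNIV smooth_on_linear l)
    qed (use x in auto)
    then show ?thesis by (simp add: F_def case_prod_beta')
  qed
  have derivs: "(deriv ^^ a) (\<lambda>s. (deriv ^^ \<alpha>) (F s) \<tau>) t = \<mu> ^ \<alpha> / \<mu> ^ a * D a \<alpha> (t / \<mu>) (\<tau> * \<mu>)" for a \<alpha> t \<tau>
  proof -
    have "(deriv ^^ \<alpha>) (F s) \<tau> = \<mu> ^ \<alpha> * (dirder e_\<xi> ^^ \<alpha>) Q ((x', s / \<mu>), (\<xi>', \<tau> * \<mu>))" for s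
      using deriv_funpow_line[OF sm, of "((x', s / \<mu>), (\<xi>', 0))" \<mu> e_\<xi> \<alpha> 1 \<tau>] x
      by (simp add: F_def mult.commute)
    then show ?thesis
      using deriv_funpow_line[OF smooth_on_dirder_funpow[OF sm, where v = e_\<xi> and n = \<alpha>],
          of "((x', 0), (\<xi>', \<tau> * \<mu>))" "1 / \<mu>" e_x a "\<mu> ^ \<alpha>" t] x
      by (simp add: D_def power_one_over)
  qed
  have j: "\<langle>(\<xi>', \<tau> * \<mu>)\<rangle> = \<mu> * \<langle>\<tau>\<rangle>" for \<tau> unfolding \<mu>_def by (rule japanese_scale)
  have D0: "D 0 \<alpha> 0 \<eta> = 0" for \<alpha> \<eta>
  proof -
    have "(deriv ^^ \<alpha>) (\<lambda>\<eta>. Q ((x', 0), (\<xi>', \<eta>))) \<eta> = D 0 \<alpha> 0 \<eta>"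
      using deriv_funpow_line[OF sm, of "((x', 0), (\<xi>', 0))" 1 e_\<xi> \<alpha> 1 \<eta>] x by (simp add: D_def)
    then show ?thesis by (simp add: boundary deriv_funpow_zero)
  qed
  have Dx: "((\<lambda>s. D 0 \<alpha> s \<eta>) has_real_derivative D 1 \<alpha> s \<eta>) (at s)" for \<alpha> s \<eta>
    unfolding D_def using x
    by (auto intro!: deriv_x smooth_on_imp_differentiable[OF smooth_on_dirder_funpow[OF sm]])
  have inner: "\<bar>D a \<alpha> s (\<tau> * \<mu>)\<bar> \<le> (if a = 0 then \<bar>s\<bar> else 1) * B' a \<alpha> * (\<mu> * \<langle>\<tau>\<rangle>) powi (1 - int \<alpha>)"
    if "\<bar>s\<bar> \<le> k" for a \<alpha> s \<tau>
  proof (cases "a = 0")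
    case True
    let ?b = "B 1 \<alpha> * (\<mu> * \<langle>\<tau>\<rangle>) powi (1 - int \<alpha>)"
    have b: "norm (D 1 \<alpha> w (\<tau> * \<mu>)) \<le> ?b" if "w \<in> {-k..k}" for w
      using bound[of w 1 \<alpha> "\<tau> * \<mu>"] that unfolding D_def j by auto
    have "norm (D 0 \<alpha> s (\<tau> * \<mu>) - D 0 \<alpha> 0 (\<tau> * \<mu>)) \<le> ?b * norm (s - 0)"
      by (rule field_differentiable_bound[of "{-k..k}" "\<lambda>s. D 0 \<alpha> s (\<tau> * \<mu>)" "\<lambda>s. D 1 \<alpha> s (\<tau> * \<mu>)"])
        (use b that pos(1) Dx in \<open>auto intro: has_field_derivative_at_within\<close>)
    then show ?thesis using True by (simp add: D0 B'_def mult_ac)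
  next
    case False
    then show ?thesis using bound[OF that, of a \<alpha> "\<tau> * \<mu>"] unfolding D_def j B'_def by simp
  qed
  have outerD: "D a \<alpha> s \<eta> = K * (if a = 0 then s else if a = 1 then 1 else 0) * (if \<alpha> = 0 then \<eta> else if \<alpha> = 1 then 1 else 0)"
    if "k < \<bar>s\<bar>" for a \<alpha> s \<eta>
  proof -
    have "open ((N \<times> {s. k < \<bar>s\<bar>}) \<times> \<Xi>)"
      using o by (intro open_Times open_Collect_less continuous_intros)
    from symbol_outer[OF this, of Q K "((x', s), (\<xi>', \<eta>))" a \<alpha>] show ?thesis
      using that outer x by (auto simp: D_def)
  qed
  have D11: "deriv (\<lambda>s. deriv (F s) \<tau>) t = D 1 1 (t / \<mu>) (\<tau> * \<mu>)" for t \<tau>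
    using derivs[of 1 1 \<tau> t] \<mu> by simp
  have D10: "deriv (\<lambda>s. F s 0) t = D 1 0 (t / \<mu>) 0 / \<mu>" for t
    using derivs[of 1 0 0 t] \<mu> by simp
  have l: "\<epsilon> \<le> deriv (\<lambda>s. deriv (F s) \<tau>) t" for t \<tau>
    unfolding D11 using lower by (simp add: D_def)
  have u: "deriv (\<lambda>s. deriv (F s) \<tau>) t \<le> M" for t \<tau>
    unfolding D11 using M(1)[of "t / \<mu>" "\<tau> * \<mu>"] outerD[of "t / \<mu>" 1 1 "\<tau> * \<mu>"] pos
    by (cases "\<bar>t / \<mu>\<bar> \<le> k") (auto simp: D_def)
  have b: "\<bar>deriv (\<lambda>s. F s 0) t\<bar> \<le> M" for t
  proof -
    \<comment> \<open>At \<tau> = 0 the bracket of (\<xi>', 0) equals \<mu> and cancels the chain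
      rule factor 1 / \<mu>.\<close>
    have "\<bar>D 1 0 (t / \<mu>) 0\<bar> \<le> M * \<mu>"
      using M(2)[of "t / \<mu>" 0] outerD[of "t / \<mu>" 1 0 0] pos \<mu> j[of 0]
      by (cases "\<bar>t / \<mu>\<bar> \<le> k") (auto simp: D_def japanese_def)
    then show ?thesis unfolding D10 using \<mu> by (simp add: pos_divide_le_eq)
  qed
  have F0: "F 0 \<tau> = 0" for \<tau> by (simp add: F_def boundary)
  note G = japanese_gradient_bounds[OF smF pos(3) F0 l u b]
  have P1: "\<bar>(deriv ^^ a) (\<lambda>s. (deriv ^^ \<alpha>) (F s) \<tau>) t\<bar>
      \<le> (K + B' a \<alpha> * (1 + k) ^ a) * \<langle>t\<rangle> powi (1 - int a) * \<langle>\<tau>\<rangle> powi (1 - int \<alpha>)" for a \<alpha> t \<tau>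
    unfolding derivs
    by (rule symbol_bound_rescaled[of \<mu> k K B' D, OF \<mu>(1) pos(1,2) _ inner outerD])
      (use pos in \<open>auto simp: B'_def\<close>)
  have A: "0 < K + B' a \<alpha> * (1 + k) ^ a" for a \<alpha>
    using pos by (intro add_pos_nonneg) (auto simp: B'_def)
  have "regular_SG_phase (\<lambda>a \<alpha>. K + B' a \<alpha> * (1 + k) ^ a) (1 / (1 + (M + 1) / \<epsilon>)) (1 + 2 * M) \<epsilon> F"
    unfolding regular_SG_phase_def using smF A P1 G l pos
    by (auto intro!: divide_pos_pos add_pos_nonneg order_trans[OF l abs_ge_self])
  then show ?thesis by (simp add: B'_def F_def \<mu>_def)
qed

subsection \<open>Homogeneous phase functions\<close>

lemma snd_sum_Basis_point: "snd (\<Sum>b\<in>Basis. f b *\<^sub>R b :: 'm::finite point) = f (0, 1)"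
proof -
  have "(0, 1) \<in> (Basis :: 'm point set)" by (simp add: Basis_prod_def)
  then have "(\<Sum>b\<in>Basis. f b *\<^sub>R b :: 'm point) \<bullet> (0, 1) = f (0, 1)"
    by (rule inner_sum_left_Basis)
  then show ?thesis by (simp add: inner_prod_def)
qed

text \<open>q is constant along the boundary near x', so the tangential part of the direction
  contributes nothing and linearity leaves the normal part.\<close>

lemma dirder_tangential:
  fixes q :: "('m::finite) cotangent \<Rightarrow> real"
  assumes "q differentiable (at ((x', 0), \<xi>))" "open N" "x' \<in> N" "\<And>y'. y' \<in> N \<Longrightarrow> q ((y', 0), \<xi>) = c"
  shows "dirder ((v', vn), 0) q ((x', 0), \<xi>) = vn * dirder e_x q ((x', 0), \<xi>)"
proof -
  have lin: "linear (\<lambda>v. dirder v q ((x', 0), \<xi>))"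
    using has_derivative_linear[OF has_derivative_dirder[OF assms(1)]] .
  have "eventually (\<lambda>t. x' + t *\<^sub>R v' \<in> N) (nhds 0)"
    using assms(2,3)
    by (intro topological_tendstoD[of "\<lambda>t. x' + t *\<^sub>R v'" x']) (auto intro!: tendsto_eq_intros simp: filterlim_ident)
  then have "dirder ((v', 0), 0) q ((x', 0), \<xi>) = dirder ((v', 0), 0) (\<lambda>_::'m cotangent. c) ((x', 0), \<xi>)"
    using assms(4) by (intro dirder_line_cong[OF assms(1)]) (auto elim: eventually_mono)
  then have "dirder ((v', 0), 0) q ((x', 0), \<xi>) = 0"
    using dirder_eq[OF has_derivative_const] by metis
  moreover have "((v', vn), 0) = ((v', 0), 0) + vn *\<^sub>R (e_x :: 'm cotangent)" by simp
  ultimately show ?thesis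
    using linear_add[OF lin, of "((v', 0), 0)" "vn *\<^sub>R e_x"] linear_scale[OF lin, of vn e_x] by simp
qed

text \<open>Take a preimage v of ((0, 1), 0) under the differential of the phase map. Its covector
  part is 0, and tangential base directions do not change the normal component of p'_\<xi>, which
  vanishes along the boundary. So the entry 1 can only come from the normal part of v times the
  mixed derivative.\<close>

lemma mixed_derivative_nonzero:
  fixes p :: "('m::finite) cotangent \<Rightarrow> real"
  assumes sm: "smooth_on (strip N \<delta> \<times> \<Xi>) p" and o: "open N" "open \<Xi>" "0 < \<delta>"
    and x: "x' \<in> N" "\<xi> \<in> \<Xi>"
    and q0: "\<And>y'. y' \<in> N \<Longrightarrow> dirder e_\<xi> p ((y', 0), \<xi>) = 0"
    and b: "surj (frechet_derivative (phase_map p) (at ((x', 0), \<xi>)))"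
  shows "dirder e_x (dirder e_\<xi> p) ((x', 0), \<xi>) \<noteq> 0"
proof -
  let ?z = "((x', 0), \<xi>)"
  have S: "open (strip N \<delta> \<times> \<Xi>)" "?z \<in> strip N \<delta> \<times> \<Xi>"
    using o x by (auto intro!: open_Times open_strip simp: strip_def)
  have "frechet_derivative (phase_map p) (at ?z) = (\<lambda>v. (\<Sum>b\<in>Basis. dirder v (dirder (0, b) p) ?z *\<^sub>R b, snd v))"
    using frechet_derivative_at[OF phase_map_has_derivative[OF S(1) sm S(2)]] by simp
  moreover obtain v where "((0, 1), 0) = frechet_derivative (phase_map p) (at ?z) v"
    using surjD[OF b, of "((0, 1), 0)"] by blast
  ultimately have v: "((0, 1), 0) = (\<Sum>b\<in>Basis. dirder v (dirder (0, b) p) ?z *\<^sub>R b, snd v)"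
    by metis
  have "snd (\<Sum>b\<in>Basis. dirder v (dirder (0, b) p) ?z *\<^sub>R b) = 1" "snd v = 0"
    using arg_cong[OF v, of "\<lambda>z. snd (fst z)"] arg_cong[OF v, of snd] by (simp_all only: fst_conv snd_conv)
  then have 1: "dirder v (dirder e_\<xi> p) ?z = 1" "snd v = 0" by (simp_all add: snd_sum_Basis_point)
  obtain v' vn where "v = ((v', vn), 0)" using 1(2) by (cases v) auto
  then have "vn * dirder e_x (dirder e_\<xi> p) ?z = 1"
    using dirder_tangential[OF smooth_on_imp_differentiable[OF smooth_on_dirder[OF sm] S(2)] o(1) x(1) q0, of v' vn] 1(1)
    by metis
  then show ?thesis by auto
qed

text \<open>\<open>normal_zero\<close> and \<open>mixed_pos\<close> are the traces that a
  boundary-preserving \<open>\<kappa>\<close> leaves on \<open>\<psi>\<close>; together with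
  homogeneity the estimates run on them.\<close>

locale homogeneous_phase =
  fixes \<Omega> :: "(real ^ 'm::finite) set" and \<delta> :: real and \<psi> :: "'m cotangent \<Rightarrow> real"
  assumes open_\<Omega>: "open \<Omega>" and \<delta>_pos: "0 < \<delta>"
    and smooth: "smooth_on (strip \<Omega> \<delta> \<times> - {0}) \<psi>"
    and hom: "\<And>x \<xi> r. x \<in> strip \<Omega> \<delta> \<Longrightarrow> \<xi> \<noteq> 0 \<Longrightarrow> 0 < r \<Longrightarrow> \<psi> (x, r *\<^sub>R \<xi>) = r * \<psi> (x, \<xi>)"
    and normal_zero: "\<And>x' \<xi>. x' \<in> \<Omega> \<Longrightarrow> \<xi> \<noteq> 0 \<Longrightarrow> dirder e_\<xi> \<psi> ((x', 0), \<xi>) = 0"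
    and mixed_pos: "\<And>x' \<xi>. x' \<in> \<Omega> \<Longrightarrow> \<xi> \<noteq> 0 \<Longrightarrow> 0 < dirder e_x (dirder e_\<xi> \<psi>) ((x', 0), \<xi>)"

lemma phase_represents_homogeneous_phase:
  assumes "open \<Omega>'" "0 < \<delta>" "boundary_preserving V \<kappa>" "phase_represents (strip \<Omega>' \<delta>) \<psi> V \<kappa>"
  shows "homogeneous_phase \<Omega>' \<delta> \<psi>"
proof
  show "open \<Omega>'" "0 < \<delta>" by fact+
  show sm: "smooth_on (strip \<Omega>' \<delta> \<times> - {0}) \<psi>" using assms(4) by (simp add: phase_represents_def)
  show "\<psi> (x, r *\<^sub>R \<xi>) = r * \<psi> (x, \<xi>)" if "x \<in> strip \<Omega>' \<delta>" "\<xi> \<noteq> 0" "0 < r" for x \<xi> r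
    using assms(4) that unfolding phase_represents_def by blast
  \<comment> \<open>\<open>\<kappa>\<close> sends the point with base \<psi>'_\<xi>(x, \<xi>) to one
    with base x and preserves the side of the boundary, so the normal component of \<psi>'_\<xi> is
    nonnegative exactly when x_n is.\<close>
  have sign: "0 \<le> dirder e_\<xi> \<psi> ((x', s), \<xi>) \<longleftrightarrow> 0 \<le> s" if "x' \<in> \<Omega>'" "\<bar>s\<bar> < \<delta>" "\<xi> \<noteq> 0" for x' s \<xi>
  proof -
    let ?z = "((x', s), \<xi>)"
    have z: "(x', s) \<in> strip \<Omega>' \<delta>" using that by (auto simp: strip_def)
    have "snd (fst (phase_map \<psi> ?z)) = dirder e_\<xi> \<psi> ?z"
      using phase_map_eq[OF smooth_on_imp_differentiable[OF sm, of ?z]] z that by (simp add: snd_sum_Basis_point)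
    moreover have "phase_map \<psi> ?z \<in> V \<and> \<kappa> (phase_map \<psi> ?z) = ((x', s), gradient (\<lambda>x. \<psi> (x, \<xi>)) (x', s))"
      using assms(4) z that(3) unfolding phase_represents_def by blast
    then have "phase_map \<psi> ?z \<in> V" "fst (\<kappa> (phase_map \<psi> ?z)) = (x', s)" by auto
    ultimately show ?thesis using assms(3) unfolding boundary_preserving_def by (metis snd_conv)
  qed
  have dq: "dirder e_\<xi> \<psi> differentiable (at ((x', s), \<xi>))" if "x' \<in> \<Omega>'" "\<bar>s\<bar> < \<delta>" "\<xi> \<noteq> 0" for x' s \<xi>
    using that by (intro smooth_on_imp_differentiable[OF smooth_on_dirder[OF sm]]) (auto simp: strip_def)
  show nz: "dirder e_\<xi> \<psi> ((x', 0), \<xi>) = 0" if "x' \<in> \<Omega>'" "\<xi> \<noteq> 0" for x' \<xi>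
  proof -
    let ?q = "\<lambda>s. dirder e_\<xi> \<psi> ((x', s), \<xi>)"
    have "isCont ?q 0" using DERIV_isCont[OF deriv_x[OF dq[of x' 0 \<xi>]]] that assms(2) by auto
    \<comment> \<open>By \<open>sign\<close> the function is negative to the left of 0 and
      nonnegative at 0, so its left limit pins the value at 0.\<close>
    then have "(?q \<longlongrightarrow> ?q 0) (at_left 0)"
      unfolding isCont_def by (rule tendsto_mono[OF at_le, rotated]) simp
    moreover have "eventually (\<lambda>s. ?q s \<le> 0) (at_left 0)"
      using sign[of x' _ \<xi>] that assms(2) less_eq_real_def
      by (auto simp: eventually_at_left_field intro!: exI[of _ "-\<delta>"]) (smt (verit))
    ultimately have "?q 0 \<le> 0" by (intro tendsto_upperbound) auto
    then show ?thesis using sign[of x' 0 \<xi>] that assms(2) by simp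
  qed
  show "0 < dirder e_x (dirder e_\<xi> \<psi>) ((x', 0), \<xi>)" if "x' \<in> \<Omega>'" "\<xi> \<noteq> 0" for x' \<xi>
  proof -
    let ?q = "\<lambda>s. dirder e_\<xi> \<psi> ((x', s), \<xi>)" and ?d = "dirder e_x (dirder e_\<xi> \<psi>) ((x', 0), \<xi>)"
    have d: "(?q has_real_derivative ?d) (at 0)" using deriv_x[OF dq[of x' 0 \<xi>]] that assms(2) by auto
    \<comment> \<open>A function that vanishes at 0 and is nonnegative to the right cannot have a
      negative slope there; strictness is left to nondegeneracy.\<close>
    have "?d \<ge> 0"
    proof (rule ccontr)
      assume "\<not> ?d \<ge> 0"
      then obtain h where h: "h > 0" "\<forall>h'>0. h' < h \<longrightarrow> ?q (0 + h') < ?q 0"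
        using DERIV_neg_dec_right[OF d] by auto
      then have "?q (min h \<delta> / 2) < 0" using nz[OF that] assms(2) by (auto simp: min_def)
      moreover have "\<bar>min h \<delta> / 2\<bar> < \<delta>" "0 \<le> min h \<delta> / 2" using h(1) assms(2) by auto
      ultimately show False using sign[of x' "min h \<delta> / 2" \<xi>] that by (metis not_le)
    qed
    moreover have "?d \<noteq> 0"
    proof (rule mixed_derivative_nonzero[OF sm assms(1) _ assms(2) that(1)])
      show "surj (frechet_derivative (phase_map \<psi>) (at ((x', 0), \<xi>)))"
        using that assms(2,4)
        by (intro bij_is_surj local_diffeo_on_bij_frechet_derivative[of "strip \<Omega>' \<delta> \<times> - {0}"]) (auto simp: phase_represents_def strip_def)
    qed (use nz that in auto)
    ultimately show ?thesis by simp
  qed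
qed

lemma star_Phi_eq_localized_phase:
  fixes p :: "('m::finite) cotangent \<Rightarrow> real"
  assumes "\<And>\<eta>. p ((x', 0), (\<xi>', \<eta>)) = p ((x', 0), (\<xi>', 0))"
  shows "star_Phi \<omega> k K p x' \<xi>' = (\<lambda>t \<tau>. localized_phase \<omega> k K p ((x', t / \<langle>\<xi>'\<rangle>), (\<xi>', \<tau> * \<langle>\<xi>'\<rangle>)))"
  unfolding star_Phi_def Phi_def normal_phase_def boundary_phase_def localized_phase_def
  by (intro ext) (simp add: Let_def mult.assoc assms[of "_ * _"])

text \<open>Stated for an arbitrary compact set Z of covectors, since it serves both the unit sphere
  for homogeneous phases and the ball |\<xi>| \<le> \<rho> for modified ones.\<close>

lemma near_boundary_lower_bound:
  fixes f :: "('m::finite) cotangent \<Rightarrow> real"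
  assumes cont: "continuous_on (strip N \<delta> \<times> \<Xi>) f" and "0 < \<delta>" and "compact C" "C \<subseteq> N" "compact Z" "Z \<subseteq> \<Xi>"
    and pos: "\<And>x' \<xi>. x' \<in> C \<Longrightarrow> \<xi> \<in> Z \<Longrightarrow> 0 < f ((x', 0), \<xi>)"
  shows "\<exists>k>0. \<exists>\<epsilon>>0. 2 * k < \<delta> \<and> (\<forall>x'\<in>C. \<forall>s. \<bar>s\<bar> \<le> k \<longrightarrow> (\<forall>\<xi>\<in>Z. \<epsilon> \<le> f ((x', s), \<xi>)))"
proof (cases "C \<times> Z = {}")
  case True
  then show ?thesis using \<open>0 < \<delta>\<close> by (intro exI[of _ "\<delta> / 4"] conjI exI[of _ 1]) auto
next
  case False
  let ?Z0 = "(C \<times> {0::real}) \<times> Z" and ?Z1 = "(C \<times> {-\<delta>/2..\<delta>/2}) \<times> Z"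
  have c: "compact ?Z0" "compact ?Z1" using assms by (auto intro!: compact_Times)
  have cont1: "continuous_on ?Z1 f"
    by (rule continuous_on_subset[OF cont]) (use assms in \<open>auto simp: strip_def\<close>)
  then have "continuous_on ?Z0 f" by (rule continuous_on_subset) (use \<open>0 < \<delta>\<close> in auto)
  then have "\<exists>z0\<in>?Z0. \<forall>z\<in>?Z0. f z0 \<le> f z"
    using False by (intro continuous_attains_inf c) auto
  then obtain z0 where z0: "z0 \<in> ?Z0" "\<And>z. z \<in> ?Z0 \<Longrightarrow> f z0 \<le> f z"
    by blast
  have m: "0 < f z0" using z0(1) pos by auto
  obtain d where d: "d > 0" "\<And>z z'. z \<in> ?Z1 \<Longrightarrow> z' \<in> ?Z1 \<Longrightarrow> dist z' z < d \<Longrightarrow> dist (f z') (f z) < f z0 / 2"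
    using compact_uniformly_continuous[OF cont1 c(2)] m unfolding uniformly_continuous_on_def
    by (meson half_gt_zero)
  \<comment> \<open>Half of the minimum over the boundary survives: d / 2 keeps the distance below
    the modulus of uniform continuity, \<delta> / 4 keeps the point in the compact slab and gives 2
    * k < \<delta>.\<close>
  have "f z0 / 2 \<le> f ((x', s), \<xi>)" if a: "x' \<in> C" "\<bar>s\<bar> \<le> min (d / 2) (\<delta> / 4)" "\<xi> \<in> Z" for x' s \<xi>
  proof -
    have "dist ((x', s), \<xi>) ((x', 0), \<xi>) = \<bar>s\<bar>" by (simp add: dist_Pair_Pair dist_real_def)
    then have "dist (f ((x', s), \<xi>)) (f ((x', 0), \<xi>)) < f z0 / 2"
      using a d(1) \<open>0 < \<delta>\<close> by (intro d(2)) (auto simp: abs_le_iff)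
    moreover have "f z0 \<le> f ((x', 0), \<xi>)" using a by (intro z0(2)) auto
    ultimately show ?thesis by (auto simp: dist_real_def abs_if split: if_splits)
  qed
  moreover have "0 < min (d / 2) (\<delta> / 4)" "2 * min (d / 2) (\<delta> / 4) < \<delta>" "0 < f z0 / 2"
    using d \<open>0 < \<delta>\<close> m by auto
  ultimately show ?thesis by blast
qed

text \<open>\<langle>r\<rangle> / r bounds the ratio \<langle>\<xi>\<rangle> / |\<xi>| on |\<xi>|
  \<ge> r. It blows up as r tends to 0, which is how \<open>A\<close> comes to depend on r.\<close>

lemma norm_powi_le_japanese:
  fixes \<xi> :: "'a::real_normed_vector"
  assumes "0 < r" "r \<le> norm \<xi>"
  shows "norm \<xi> powi (1 - int \<alpha>) \<le> (\<langle>r\<rangle> / r) ^ \<alpha> * \<langle>\<xi>\<rangle> powi (1 - int \<alpha>)"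
proof (cases \<alpha>)
  case 0 then show ?thesis using japanese_bounds(2)[of \<xi>] by simp
next
  case (Suc n)
  have c: "1 \<le> \<langle>r\<rangle> / r" using assms(1) japanese_bounds(2)[of r] by simp
  have "(r * \<langle>\<xi>\<rangle>)\<^sup>2 \<le> (\<langle>r\<rangle> * norm \<xi>)\<^sup>2"
    using assms power_mono[of r "norm \<xi>" 2] by (simp add: japanese_def power_mult_distrib algebra_simps)
  then have "r * \<langle>\<xi>\<rangle> \<le> \<langle>r\<rangle> * norm \<xi>"
    by (rule power2_le_imp_le) (use japanese_bounds(1)[of r] in auto)
  then have "\<langle>\<xi>\<rangle> \<le> (\<langle>r\<rangle> / r) * norm \<xi>" using assms(1) by (simp add: field_simps)
  then have "\<langle>\<xi>\<rangle> ^ n \<le> (\<langle>r\<rangle> / r) ^ n * norm \<xi> ^ n"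
    using power_mono[of "\<langle>\<xi>\<rangle>" _ n] japanese_bounds(1)[of \<xi>] by (simp flip: power_mult_distrib)
  also have "\<dots> \<le> (\<langle>r\<rangle> / r) ^ \<alpha> * norm \<xi> ^ n"
    using c Suc by (intro mult_right_mono power_increasing) auto
  finally have "1 / norm \<xi> ^ n \<le> (\<langle>r\<rangle> / r) ^ \<alpha> / \<langle>\<xi>\<rangle> ^ n"
    using zero_less_power[of "norm \<xi>" n] zero_less_power[of "\<langle>\<xi>\<rangle>" n] assms japanese_bounds(1)[of \<xi>]
      less_le_trans[OF assms]
    by (simp add: pos_divide_le_eq pos_le_divide_eq mult.commute)
  then show ?thesis using Suc by (simp add: power_int_minus divide_simps)
qed

text \<open>Common end of both cases: \<open>\<Xi>\<close> is the set of nonzero covectors for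
  homogeneous phases and the whole space for modified ones.\<close>

lemma regular_SG_phase_star_Phi:
  fixes p :: "('m::finite) cotangent \<Rightarrow> real"
  assumes sm: "smooth_on (strip N \<delta> \<times> \<Xi>) p" and o: "open N" "open \<Xi>" and c: "cutoff \<omega>" and k: "0 < k" "k < \<delta>"
    and x: "x' \<in> N" "\<And>\<eta>. (\<xi>', \<eta>) \<in> \<Xi>"
    and q0: "\<And>\<eta>. dirder e_\<xi> p ((x', 0), (\<xi>', \<eta>)) = 0"
    and mixed: "\<And>s \<eta>. \<bar>s\<bar> \<le> k \<Longrightarrow> \<epsilon> \<le> dirder e_x (dirder e_\<xi> p) ((x', s), (\<xi>', \<eta>))"
      "\<And>s \<eta>. \<bar>s\<bar> \<le> k \<Longrightarrow> dirder e_x (dirder e_\<xi> p) ((x', s), (\<xi>', \<eta>)) \<le> K"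
    and pos: "0 < \<epsilon>" "K \<le> M" "\<And>a \<alpha>. 0 \<le> B a \<alpha>"
    and bound: "\<And>a \<alpha> s \<eta>. \<bar>s\<bar> \<le> k \<Longrightarrow>
      \<bar>(dirder e_x ^^ a) ((dirder e_\<xi> ^^ \<alpha>) (localized_phase \<omega> k K p)) ((x', s), (\<xi>', \<eta>))\<bar> \<le> B a \<alpha> * \<langle>(\<xi>', \<eta>)\<rangle> powi (1 - int \<alpha>)"
    and M: "\<And>s \<eta>. \<bar>s\<bar> \<le> k \<Longrightarrow> dirder e_x (dirder e_\<xi> (localized_phase \<omega> k K p)) ((x', s), (\<xi>', \<eta>)) \<le> M"
      "\<And>s \<eta>. \<bar>s\<bar> \<le> k \<Longrightarrow> \<bar>dirder e_x (localized_phase \<omega> k K p) ((x', s), (\<xi>', \<eta>))\<bar> \<le> M * \<langle>(\<xi>', \<eta>)\<rangle>"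
  shows "regular_SG_phase (\<lambda>a \<alpha>. K + B (if a = 0 then 1 else a) \<alpha> * (1 + k) ^ a)
     (1 / (1 + (M + 1) / \<epsilon>)) (1 + 2 * M) \<epsilon> (star_Phi \<omega> k K p x' \<xi>')"
proof -
  define Q where "Q = localized_phase \<omega> k K p"
  \<comment> \<open>The whole line over \<xi>' lies in \<open>\<Xi>\<close>, so the vanishing
    \<xi>_n-derivative makes the boundary value constant on it; this identifies
    \<open>star_Phi\<close> with the rescaled localized phase.\<close>
  have "((\<lambda>\<eta>. p ((x', 0), (\<xi>', \<eta>))) has_real_derivative 0) (at \<eta>)" for \<eta>
    using deriv_\<xi>[OF smooth_on_imp_differentiable[OF sm, of "((x', 0), (\<xi>', \<eta>))"]] q0 x k
    by (auto simp: strip_def)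
  then have const: "p ((x', 0), (\<xi>', \<eta>)) = p ((x', 0), (\<xi>', 0))" for \<eta>
    using DERIV_isconst_all[of "\<lambda>\<eta>. p ((x', 0), (\<xi>', \<eta>))"] by blast
  have "0 < K" using mixed[of 0 0] pos k by auto
  have "regular_SG_phase (\<lambda>a \<alpha>. K + B (if a = 0 then 1 else a) \<alpha> * (1 + k) ^ a) (1 / (1 + (M + 1) / \<epsilon>)) (1 + 2 * M) \<epsilon>
      (\<lambda>t \<tau>. Q ((x', t / \<langle>\<xi>'\<rangle>), (\<xi>', \<tau> * \<langle>\<xi>'\<rangle>)))"
  proof (rule regular_SG_phase_rescaled[where N = N and \<Xi> = \<Xi>])
    show "smooth_on ((N \<times> UNIV) \<times> \<Xi>) Q"
      unfolding Q_def by (rule smooth_on_localized_phase[OF sm o c k])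
    show "Q ((x', 0), (\<xi>', \<eta>)) = 0" for \<eta> by (simp add: Q_def localized_phase_def cutoff_properties(2)[OF c])
    show "Q ((y', s), \<xi>) = K * s * snd \<xi>" if "k < \<bar>s\<bar>" for y' s \<xi>
      using localized_phase_outer[OF c k(1), of s K p y' \<xi>] that by (simp add: Q_def)
    show "\<epsilon> \<le> dirder e_x (dirder e_\<xi> Q) ((x', s), (\<xi>', \<eta>))" for s \<eta>
      unfolding Q_def by (rule localized_phase_mixed_lower[OF sm o c k x q0 mixed])
  qed (fact o x k pos \<open>0 < K\<close> bound[folded Q_def] M[folded Q_def])+
  then show ?thesis unfolding star_Phi_eq_localized_phase[of p x' \<xi>', OF const] Q_def .
qed

section \<open>Uniform estimates for homogeneous phases\<close>

context homogeneous_phase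
begin

text \<open>The mixed derivative has degree 0 in \<xi>, so bounds on the unit sphere hold for every
  \<xi> \<noteq> 0 without loss as \<xi> tends to 0.\<close>

lemma mixed_bounds:
  assumes C: "compact C" "C \<subseteq> \<Omega>"
  shows "\<exists>k>0. \<exists>\<epsilon>>0. \<exists>M. 2 * k < \<delta> \<and> (\<forall>x'\<in>C. \<forall>s. \<bar>s\<bar> \<le> k \<longrightarrow> (\<forall>\<xi>. \<xi> \<noteq> 0 \<longrightarrow>
      \<epsilon> \<le> dirder e_x (dirder e_\<xi> \<psi>) ((x', s), \<xi>) \<and> dirder e_x (dirder e_\<xi> \<psi>) ((x', s), \<xi>) \<le> M))"
proof -
  let ?f = "dirder e_x (dirder e_\<xi> \<psi>)"
  have cont: "continuous_on (strip \<Omega> \<delta> \<times> - {0}) ?f"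
    by (intro smooth_on_imp_continuous_on smooth_on_dirder smooth)
  have hom0: "?f (x, r *\<^sub>R \<xi>) = r powi 0 * ?f (x, \<xi>)" if "x \<in> strip \<Omega> \<delta>" "\<xi> \<noteq> 0" "0 < r" for x \<xi> r
    using dirder_funpow_homogeneous[OF smooth open_strip[OF open_\<Omega>], where d = 1 and x = x and \<xi> = \<xi>
        and r = r and v = "(0, 1)" and a = 1 and w = "(0, 1)" and \<alpha> = 1] hom that by simp
  obtain k \<epsilon> where k: "k > 0" "\<epsilon> > 0" "2 * k < \<delta>"
    and lo: "\<And>x' s \<xi>. x' \<in> C \<Longrightarrow> \<bar>s\<bar> \<le> k \<Longrightarrow> \<xi> \<in> sphere 0 1 \<Longrightarrow> \<epsilon> \<le> ?f ((x', s), \<xi>)"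
  proof -
    have "\<exists>k>0. \<exists>\<epsilon>>0. 2 * k < \<delta> \<and> (\<forall>x'\<in>C. \<forall>s. \<bar>s\<bar> \<le> k \<longrightarrow> (\<forall>\<xi>\<in>sphere 0 1. \<epsilon> \<le> ?f ((x', s), \<xi>)))"
    proof (rule near_boundary_lower_bound[OF cont \<delta>_pos C])
      show "0 < ?f ((x', 0), \<xi>)" if "x' \<in> C" "\<xi> \<in> sphere 0 1" for x' \<xi>
        using mixed_pos[of x' \<xi>] that C by (cases "\<xi> = 0") auto
      show "sphere 0 1 \<subseteq> - {0 :: 'm point}"
        by (metis Compl_iff mem_sphere_0 norm_zero singletonD subsetI zero_neq_one)
    qed auto
    then show ?thesis using that by blast
  qed
  have "compact (C \<times> {-k..k})" "C \<times> {-k..k} \<subseteq> strip \<Omega> \<delta>"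
    using C k by (auto intro!: compact_Times simp: strip_def)
  then obtain M where up: "\<And>x \<xi>. x \<in> C \<times> {-k..k} \<Longrightarrow> \<xi> \<noteq> 0 \<Longrightarrow> \<bar>?f (x, \<xi>)\<bar> \<le> M * norm \<xi> powi 0"
    using homogeneous_bound[OF cont hom0, of "C \<times> {-k..k}"] by metis
  have "\<epsilon> \<le> ?f ((x', s), \<xi>) \<and> ?f ((x', s), \<xi>) \<le> M" if "x' \<in> C" "\<bar>s\<bar> \<le> k" "\<xi> \<noteq> 0" for x' s \<xi>
  proof -
    have "?f ((x', s), (1 / norm \<xi>) *\<^sub>R \<xi>) = ?f ((x', s), \<xi>)"
      using hom0[of "(x', s)" \<xi> "1 / norm \<xi>"] that C k by (auto simp: strip_def abs_le_iff)
    moreover have "\<epsilon> \<le> ?f ((x', s), (1 / norm \<xi>) *\<^sub>R \<xi>)" using that by (intro lo) auto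
    ultimately show ?thesis using up[of "(x', s)" \<xi>] that by (auto simp: abs_le_iff)
  qed
  then show ?thesis using k by blast
qed

text \<open>The cutoff involves x_n only, and both phases that it joins have degree 1 in \<xi>;
  hence the localized phase has degree 1 for all x_n, including those outside the strip.\<close>

lemma localized_phase_symbol_bounds:
  assumes C: "compact C" "C \<subseteq> \<Omega>" and c: "cutoff \<omega>" and k: "0 < k" "k < \<delta>"
  shows "\<exists>B. (\<forall>a \<alpha>. 0 < B a \<alpha>) \<and> (\<forall>a \<alpha>. \<forall>x'\<in>C. \<forall>s \<xi>. \<bar>s\<bar> \<le> k \<longrightarrow> \<xi> \<noteq> 0 \<longrightarrow>
     \<bar>(dirder e_x ^^ a) ((dirder e_\<xi> ^^ \<alpha>) (localized_phase \<omega> k K \<psi>)) ((x', s), \<xi>)\<bar> \<le> B a \<alpha> * norm \<xi> powi (1 - int \<alpha>))"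
proof -
  define Q where "Q = localized_phase \<omega> k K \<psi>"
  have sm: "smooth_on ((\<Omega> \<times> UNIV) \<times> - {0}) Q"
    unfolding Q_def by (rule smooth_on_localized_phase[OF smooth open_\<Omega> _ c k]) auto
  have homQ: "Q (x, r *\<^sub>R \<xi>) = r powi 1 * Q (x, \<xi>)" if "x \<in> \<Omega> \<times> UNIV" "\<xi> \<noteq> 0" "0 < r" for x \<xi> r
  proof (cases "\<bar>snd x\<bar> < \<delta>")
    case True
    then show ?thesis using that hom[of x \<xi> r] hom[of "(fst x, 0)" \<xi> r] \<delta>_pos
      by (auto simp: Q_def localized_phase_def strip_def abs_less_iff algebra_simps)
  next
    case False
    then show ?thesis
      using localized_phase_outer[OF c k(1), of "snd x" K \<psi> "fst x"] k by (simp add: Q_def)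
  qed
  have "\<forall>a \<alpha>. \<exists>B>0. \<forall>x\<in>C \<times> {-k..k}. \<forall>\<xi>. \<xi> \<noteq> 0 \<longrightarrow>
      \<bar>(dirder e_x ^^ a) ((dirder e_\<xi> ^^ \<alpha>) Q) (x, \<xi>)\<bar> \<le> B * norm \<xi> powi (1 - int \<alpha>)"
  proof (intro allI homogeneous_bound)
    fix a \<alpha>
    show "continuous_on ((\<Omega> \<times> UNIV) \<times> - {0}) ((dirder e_x ^^ a) ((dirder e_\<xi> ^^ \<alpha>) Q))"
      by (intro smooth_on_imp_continuous_on smooth_on_dirder_funpow sm)
  next
    fix a \<alpha> x \<xi> and r :: real assume "x \<in> \<Omega> \<times> (UNIV :: real set)" "\<xi> \<noteq> (0::'m point)" "0 < r"
    then show "(dirder e_x ^^ a) ((dirder e_\<xi> ^^ \<alpha>) Q) (x, r *\<^sub>R \<xi>)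
        = r powi (1 - int \<alpha>) * (dirder e_x ^^ a) ((dirder e_\<xi> ^^ \<alpha>) Q) (x, \<xi>)"
      using open_\<Omega> by (intro dirder_funpow_homogeneous[OF sm _ homQ]) (auto intro: open_Times)
  qed (use C in \<open>auto intro: compact_Times\<close>)
  then obtain B where "\<And>a \<alpha>. 0 < B a \<alpha> \<and> (\<forall>x\<in>C \<times> {-k..k}. \<forall>\<xi>. \<xi> \<noteq> 0 \<longrightarrow>
      \<bar>(dirder e_x ^^ a) ((dirder e_\<xi> ^^ \<alpha>) Q) (x, \<xi>)\<bar> \<le> B a \<alpha> * norm \<xi> powi (1 - int \<alpha>))"
    by metis
  then show ?thesis unfolding Q_def[symmetric] by (intro exI[of _ B]) (auto simp: abs_le_iff)
qed

lemma regular_SG_phase_homogeneous: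
  assumes U: "U \<subset>\<subset> \<Omega>" and c: "cutoff \<omega>"
  shows "\<exists>K0>0. \<exists>k0>0. 2 * k0 < \<delta> \<and> (\<forall>K\<ge>K0. \<forall>k. 0 < k \<and> k \<le> k0 \<longrightarrow>
          (\<exists>c C \<epsilon>. \<forall>r>0. \<exists>A. \<forall>x'\<in>U. \<forall>\<xi>'. r \<le> norm \<xi>' \<longrightarrow>
             regular_SG_phase A c C \<epsilon> (star_Phi \<omega> k K \<psi> x' \<xi>')))"
proof -
  define C where "C = closure U"
  have C: "compact C" "C \<subseteq> \<Omega>" and UC: "U \<subseteq> C" using U closure_subset by (auto simp: compactly_contained_def C_def)
  obtain k0 \<epsilon> M0 where k0: "k0 > 0" "\<epsilon> > 0" "2 * k0 < \<delta>"
    and mb: "\<And>x' s \<xi>. x' \<in> C \<Longrightarrow> \<bar>s\<bar> \<le> k0 \<Longrightarrow> \<xi> \<noteq> 0 \<Longrightarrow>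
      \<epsilon> \<le> dirder e_x (dirder e_\<xi> \<psi>) ((x', s), \<xi>) \<and> dirder e_x (dirder e_\<xi> \<psi>) ((x', s), \<xi>) \<le> M0"
    using mixed_bounds[OF C] by metis
  \<comment> \<open>\<open>K0\<close> is the upper bound of the mixed derivative of
    \<open>\<psi>\<close>, raised to 1 to be positive.\<close>
  show ?thesis
  proof (rule exI[of _ "max M0 1"], rule conjI, simp, rule exI[of _ k0], intro conjI allI impI)
    fix K k assume K: "max M0 1 \<le> K" and k: "0 < k \<and> k \<le> k0"
    have k': "0 < k" "k < \<delta>" using k k0 by auto
    define Q where "Q = localized_phase \<omega> k K \<psi>"
    obtain B where B: "\<And>a \<alpha>. 0 < B a \<alpha>"
      and Bd: "\<And>a \<alpha> x' s \<xi>. x' \<in> C \<Longrightarrow> \<bar>s\<bar> \<le> k \<Longrightarrow> \<xi> \<noteq> 0 \<Longrightarrow>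
        \<bar>(dirder e_x ^^ a) ((dirder e_\<xi> ^^ \<alpha>) Q) ((x', s), \<xi>)\<bar> \<le> B a \<alpha> * norm \<xi> powi (1 - int \<alpha>)"
      using localized_phase_symbol_bounds[OF C c k', of K] unfolding Q_def by metis
    \<comment> \<open>M is fixed before r: it uses the orders (1, 1) and (1, 0) only, whose bounds
      are |\<xi>|^0 and |\<xi>| \<le> \<langle>\<xi>\<rangle>.\<close>
    define M where "M = max K (max (B 1 1) (B 1 0))"
    show "\<exists>c C \<epsilon>. \<forall>r>0. \<exists>A. \<forall>x'\<in>U. \<forall>\<xi>'. r \<le> norm \<xi>' \<longrightarrow> regular_SG_phase A c C \<epsilon> (star_Phi \<omega> k K \<psi> x' \<xi>')"
    proof (rule exI[of _ "1 / (1 + (M + 1) / \<epsilon>)"], rule exI[of _ "1 + 2 * M"], rule exI[of _ \<epsilon>], intro allI impI)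
      fix r :: real assume r: "0 < r"
      \<comment> \<open>Bounds in |\<xi>| converted to bounds in \<langle>\<xi>\<rangle> on |\<xi>|
        \<ge> r; the only place where r enters the constants.\<close>
      define B' where "B' a \<alpha> = B a \<alpha> * (\<langle>r\<rangle> / r) ^ \<alpha>" for a \<alpha>
      show "\<exists>A. \<forall>x'\<in>U. \<forall>\<xi>'. r \<le> norm \<xi>' \<longrightarrow>
        regular_SG_phase A (1 / (1 + (M + 1) / \<epsilon>)) (1 + 2 * M) \<epsilon> (star_Phi \<omega> k K \<psi> x' \<xi>')"
      proof (intro exI[of _ "\<lambda>a \<alpha>. K + B' (if a = 0 then 1 else a) \<alpha> * (1 + k) ^ a"] ballI allI impI)
        fix x' \<xi>' :: "real ^ 'm" assume x: "x' \<in> U" "r \<le> norm \<xi>'"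
        have nz: "(\<xi>', \<eta>) \<noteq> 0" for \<eta> using x r by (auto simp: zero_prod_def)
        have nr: "r \<le> norm (\<xi>', \<eta>)" for \<eta>
          using x(2) norm_fst_le[of \<xi>' \<eta>] by (rule order_trans)
        have xC: "x' \<in> C" "x' \<in> \<Omega>" using x UC C by auto
        show "regular_SG_phase (\<lambda>a \<alpha>. K + B' (if a = 0 then 1 else a) \<alpha> * (1 + k) ^ a) (1 / (1 + (M + 1) / \<epsilon>)) (1 + 2 * M) \<epsilon>
            (star_Phi \<omega> k K \<psi> x' \<xi>')"
        proof (rule regular_SG_phase_star_Phi[OF smooth open_\<Omega> _ c k' xC(2), where B = B' and K = K, folded Q_def])
          show "0 \<le> B' a \<alpha>" for a \<alpha> using B r japanese_bounds(1)[of r] by (auto simp: B'_def intro!: mult_nonneg_nonneg less_imp_le[OF B])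
          show "\<bar>(dirder e_x ^^ a) ((dirder e_\<xi> ^^ \<alpha>) Q) ((x', s), (\<xi>', \<eta>))\<bar> \<le> B' a \<alpha> * \<langle>(\<xi>', \<eta>)\<rangle> powi (1 - int \<alpha>)"
            if "\<bar>s\<bar> \<le> k" for a \<alpha> s \<eta>
          proof -
            have "\<bar>(dirder e_x ^^ a) ((dirder e_\<xi> ^^ \<alpha>) Q) ((x', s), (\<xi>', \<eta>))\<bar> \<le> B a \<alpha> * norm (\<xi>', \<eta>) powi (1 - int \<alpha>)"
              using Bd[OF xC(1) that nz] .
            also have "\<dots> \<le> B a \<alpha> * ((\<langle>r\<rangle> / r) ^ \<alpha> * \<langle>(\<xi>', \<eta>)\<rangle> powi (1 - int \<alpha>))"
              using norm_powi_le_japanese[OF r nr] B by (intro mult_left_mono) (auto intro: less_imp_le)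
            finally show ?thesis by (simp add: B'_def mult.assoc)
          qed
          show "dirder e_\<xi> \<psi> ((x', 0), (\<xi>', \<eta>)) = 0" for \<eta> using normal_zero[OF xC(2) nz] .
          show "\<epsilon> \<le> dirder e_x (dirder e_\<xi> \<psi>) ((x', s), (\<xi>', \<eta>))" "dirder e_x (dirder e_\<xi> \<psi>) ((x', s), (\<xi>', \<eta>)) \<le> K"
            if "\<bar>s\<bar> \<le> k" for s \<eta>
            using mb[OF xC(1) _ nz, of s \<eta>] that k K by auto
          show "dirder e_x (dirder e_\<xi> Q) ((x', s), (\<xi>', \<eta>)) \<le> M" if "\<bar>s\<bar> \<le> k" for s \<eta>
            using Bd[OF xC(1) that nz, of 1 1 \<eta>] by (simp add: M_def)
          show "\<bar>dirder e_x Q ((x', s), (\<xi>', \<eta>))\<bar> \<le> M * \<langle>(\<xi>', \<eta>)\<rangle>" if "\<bar>s\<bar> \<le> k" for s \<eta>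
          proof -
            have "\<bar>dirder e_x Q ((x', s), (\<xi>', \<eta>))\<bar> \<le> B 1 0 * norm (\<xi>', \<eta>)"
              using Bd[OF xC(1) that nz, of 1 0 \<eta>] by simp
            also have "\<dots> \<le> M * \<langle>(\<xi>', \<eta>)\<rangle>"
              using B[of 1 0] by (intro mult_mono japanese_bounds) (auto simp: M_def)
            finally show ?thesis .
          qed
        qed (use nz k0 in \<open>auto simp: M_def\<close>)
      qed
    qed
  qed (use k0 in auto)
qed

end

subsection \<open>Phase functions modified near the zero section\<close>

text \<open>On a bounded set of covectors a constant bound counts as a symbol bound of any
  order.\<close>

lemma japanese_powi_compact:
  fixes \<xi> :: "'a::real_normed_vector"
  assumes "norm \<xi> \<le> \<rho>"
  shows "1 \<le> \<langle>\<rho>\<rangle> ^ \<alpha> * \<langle>\<xi>\<rangle> powi (1 - int \<alpha>)"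
proof (cases \<alpha>)
  case 0 then show ?thesis using japanese_bounds(1)[of \<xi>] by simp
next
  case (Suc n)
  have "\<langle>\<xi>\<rangle> \<le> \<langle>\<rho>\<rangle>" using assms by (simp add: japanese_def power_mono)
  then have "\<langle>\<xi>\<rangle> ^ n \<le> \<langle>\<rho>\<rangle> ^ n" using japanese_bounds(1)[of \<xi>] by (intro power_mono) auto
  also have "\<dots> \<le> \<langle>\<rho>\<rangle> ^ \<alpha>" using japanese_bounds(1)[of \<rho>] Suc by (intro power_increasing) auto
  finally show ?thesis
    using Suc zero_less_power[of "\<langle>\<xi>\<rangle>" n] japanese_bounds(1)[of \<xi>] by (simp add: power_int_minus divide_simps)
qed

section \<open>Estimates for a given modification\<close>

context homogeneous_phase
begin

text \<open>Bijectivity of the differential of the phase map forbids zeros of the mixed derivative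
  at x_n = 0. Being continuous in \<xi> on a connected space, it has one sign, which is read off
  where \<open>\<psi>m\<close> agrees with \<open>\<psi>\<close>.\<close>

lemma modification_mixed_pos:
  assumes N: "open N" "N \<subseteq> \<Omega>" and m: "modification_near_0 N \<delta> \<rho> \<psi> \<psi>m"
  shows "x' \<in> N \<Longrightarrow> dirder e_\<xi> \<psi>m ((x', 0), \<xi>) = 0"
    and "z \<in> strip N \<delta> \<times> {\<xi>. \<rho> < norm \<xi>} \<Longrightarrow> dirder e_x (dirder e_\<xi> \<psi>m) z = dirder e_x (dirder e_\<xi> \<psi>) z"
    and "x' \<in> N \<Longrightarrow> 0 < dirder e_x (dirder e_\<xi> \<psi>m) ((x', 0), \<xi>)"
proof -
  have sm: "smooth_on (strip N \<delta> \<times> UNIV) \<psi>m"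
    and eq: "\<And>x \<xi>. x \<in> strip N \<delta> \<Longrightarrow> \<rho> \<le> norm \<xi> \<Longrightarrow> \<psi>m (x, \<xi>) = \<psi> (x, \<xi>)"
    and bd: "\<And>x' \<xi>' \<xi>n. x' \<in> N \<Longrightarrow> \<psi>m ((x', 0), (\<xi>', \<xi>n)) = boundary_phase \<psi>m x' \<xi>'"
    and bij: "\<And>x' \<xi>. x' \<in> N \<Longrightarrow> bij (frechet_derivative (phase_map \<psi>m) (at ((x', 0), \<xi>)))"
    using m unfolding modification_near_0_def by blast+
  have oS: "open (strip N \<delta> \<times> {\<xi>::'m point. \<rho> < norm \<xi>})"
    using N by (intro open_Times open_strip open_Collect_less continuous_intros)
  have mixed_eq: "dirder e_x (dirder e_\<xi> \<psi>m) z = dirder e_x (dirder e_\<xi> \<psi>) z"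
    if "z \<in> strip N \<delta> \<times> {\<xi>. \<rho> < norm \<xi>}" for z
    by (intro dirder_cong_open[OF oS] that) (use eq in auto)
  show "z \<in> strip N \<delta> \<times> {\<xi>. \<rho> < norm \<xi>} \<Longrightarrow> dirder e_x (dirder e_\<xi> \<psi>m) z = dirder e_x (dirder e_\<xi> \<psi>) z"
    by (rule mixed_eq)
  have zero: "dirder e_\<xi> \<psi>m ((x', 0), \<xi>) = 0" if "x' \<in> N" for x' \<xi>
  proof -
    obtain \<xi>' \<eta> where \<xi>: "\<xi> = (\<xi>', \<eta>)" by (cases \<xi>) auto
    have "\<psi>m differentiable (at ((x', 0), (\<xi>', \<eta>)))"
      using that \<delta>_pos by (intro smooth_on_imp_differentiable[OF sm]) (auto simp: strip_def)
    from deriv_\<xi>[OF this] show ?thesis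
      using DERIV_unique[OF _ DERIV_const] bd[OF that] unfolding \<xi> by simp
  qed
  show "x' \<in> N \<Longrightarrow> dirder e_\<xi> \<psi>m ((x', 0), \<xi>) = 0" by (rule zero)
  assume x: "x' \<in> N"
  define g where "g \<xi> = dirder e_x (dirder e_\<xi> \<psi>m) ((x', 0), \<xi>)" for \<xi>
  have nz: "g \<xi> \<noteq> 0" for \<xi>
    unfolding g_def
    by (rule mixed_derivative_nonzero[OF sm N(1) open_UNIV \<delta>_pos x _ zero bij_is_surj[OF bij[OF x]]]) auto
  \<comment> \<open>A covector beyond the modified region; the absolute value makes this true for
    either sign of \<rho>.\<close>
  define \<xi>1 :: "'m point" where "\<xi>1 = (0, \<bar>\<rho>\<bar> + 1)"
  have \<xi>1: "\<xi>1 \<noteq> 0" "\<rho> < norm \<xi>1" by (auto simp: \<xi>1_def zero_prod_def norm_Pair)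
  have pos1: "0 < g \<xi>1"
    using mixed_eq[of "((x', 0), \<xi>1)"] mixed_pos[of x' \<xi>1] \<xi>1 x N \<delta>_pos by (auto simp: g_def strip_def)
  have "continuous_on UNIV g"
    unfolding g_def
    by (rule continuous_on_compose2[OF smooth_on_imp_continuous_on[OF smooth_on_dirder[OF smooth_on_dirder[OF sm]]]])
      (use x \<delta>_pos in \<open>auto simp: strip_def intro!: continuous_intros\<close>)
  then have "connected (range g)" by (rule connected_continuous_image) (rule connected_UNIV)
  then have "{g \<xi>..g \<xi>1} \<subseteq> range g" by (rule connected_contains_Icc) auto
  then have "\<not> g \<xi> \<le> 0" using pos1 nz by (force simp: subset_iff)
  then show "0 < dirder e_x (dirder e_\<xi> \<psi>m) ((x', 0), \<xi>)" by (simp add: g_def)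
qed

text \<open>Two regimes: for |\<xi>| \<le> \<rho> smoothness through \<xi> = 0 and compactness bound
  every derivative, for |\<xi>| > \<rho> the homogeneous bounds apply with r = \<rho>. The split is
  made in \<xi> and not in \<xi>', so no lower bound on |\<xi>'| enters.\<close>

lemma regular_SG_phase_modified:
  assumes N: "open N" "N \<subseteq> \<Omega>" and "0 < \<rho>" and m: "modification_near_0 N \<delta> \<rho> \<psi> \<psi>m"
    and U: "U \<subset>\<subset> N" and c: "cutoff \<omega>"
  shows "\<exists>K0>0. \<exists>k0>0. 2 * k0 < \<delta> \<and> (\<forall>K\<ge>K0. \<forall>k. 0 < k \<and> k \<le> k0 \<longrightarrow>
            (\<exists>A c C \<epsilon>. \<forall>x'\<in>U. \<forall>\<xi>'. \<xi>' \<noteq> 0 \<longrightarrow>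
               regular_SG_phase A c C \<epsilon> (star_Phi \<omega> k K \<psi>m x' \<xi>')))"
proof -
  define C where "C = closure U"
  have C: "compact C" "C \<subseteq> N" "C \<subseteq> \<Omega>" and UC: "U \<subseteq> C"
    using U N closure_subset by (auto simp: compactly_contained_def C_def)
  have sm: "smooth_on (strip N \<delta> \<times> UNIV) \<psi>m"
    and eq: "\<And>x \<xi>. x \<in> strip N \<delta> \<Longrightarrow> \<rho> \<le> norm \<xi> \<Longrightarrow> \<psi>m (x, \<xi>) = \<psi> (x, \<xi>)"
    using m unfolding modification_near_0_def by blast+
  note mp = modification_mixed_pos[OF N m]
  let ?f = "dirder e_x (dirder e_\<xi> \<psi>m)"
  obtain k1 \<epsilon>1 M1 where k1: "k1 > 0" "\<epsilon>1 > 0" "2 * k1 < \<delta>"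
    and mb1: "\<And>x' s \<xi>. x' \<in> C \<Longrightarrow> \<bar>s\<bar> \<le> k1 \<Longrightarrow> \<xi> \<noteq> 0 \<Longrightarrow>
      \<epsilon>1 \<le> dirder e_x (dirder e_\<xi> \<psi>) ((x', s), \<xi>) \<and> dirder e_x (dirder e_\<xi> \<psi>) ((x', s), \<xi>) \<le> M1"
    using mixed_bounds[OF C(1,3)] by metis
  have cont: "continuous_on (strip N \<delta> \<times> UNIV) ?f"
    by (intro smooth_on_imp_continuous_on smooth_on_dirder sm)
  have "\<exists>k>0. \<exists>\<epsilon>>0. 2 * k < \<delta> \<and> (\<forall>x'\<in>C. \<forall>s. \<bar>s\<bar> \<le> k \<longrightarrow> (\<forall>\<xi>\<in>cball 0 \<rho>. \<epsilon> \<le> ?f ((x', s), \<xi>)))"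
    by (rule near_boundary_lower_bound[OF cont \<delta>_pos C(1,2)]) (use mp(3) C in auto)
  then obtain k2 \<epsilon>2 where k2: "k2 > 0" "\<epsilon>2 > 0"
    and mb2: "\<And>x' s \<xi>. x' \<in> C \<Longrightarrow> \<bar>s\<bar> \<le> k2 \<Longrightarrow> \<xi> \<in> cball 0 \<rho> \<Longrightarrow> \<epsilon>2 \<le> ?f ((x', s), \<xi>)"
    by blast
  define k0 where "k0 = min k1 k2"
  define \<epsilon> where "\<epsilon> = min \<epsilon>1 \<epsilon>2"
  have k0: "k0 > 0" "2 * k0 < \<delta>" "\<epsilon> > 0" using k1 k2 by (auto simp: k0_def \<epsilon>_def)
  have "compact ((C \<times> {-k0..k0}) \<times> cball (0::'m point) \<rho>)" using C by (intro compact_Times) auto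
  moreover have "continuous_on ((C \<times> {-k0..k0}) \<times> cball (0::'m point) \<rho>) ?f"
    by (rule continuous_on_subset[OF cont]) (use C k0 in \<open>auto simp: strip_def\<close>)
  ultimately obtain M2 where M2: "\<And>z. z \<in> (C \<times> {-k0..k0}) \<times> cball (0::'m point) \<rho> \<Longrightarrow> \<bar>?f z\<bar> \<le> M2"
    using compact_continuous_bound[of "(C \<times> {-k0..k0}) \<times> cball (0::'m point) \<rho>" ?f] by metis
  have mb: "\<epsilon> \<le> ?f ((x', s), \<xi>) \<and> ?f ((x', s), \<xi>) \<le> max M1 M2" if "x' \<in> C" "\<bar>s\<bar> \<le> k0" for x' s \<xi>
  proof (cases "norm \<xi> \<le> \<rho>")
    case True
    have "\<bar>?f ((x', s), \<xi>)\<bar> \<le> M2" using that True by (intro M2) (auto simp: abs_le_iff)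
    moreover have "\<epsilon>2 \<le> ?f ((x', s), \<xi>)" using that True by (intro mb2) (auto simp: k0_def)
    ultimately show ?thesis by (auto simp: \<epsilon>_def)
  next
    case False
    then have "\<xi> \<noteq> 0" using \<open>0 < \<rho>\<close> by auto
    moreover have "(x', s) \<in> strip N \<delta>" using that C k0 by (auto simp: strip_def abs_le_iff)
    then have "?f ((x', s), \<xi>) = dirder e_x (dirder e_\<xi> \<psi>) ((x', s), \<xi>)" using False by (intro mp(2)) auto
    ultimately show ?thesis using mb1[of x' s \<xi>] that by (auto simp: k0_def \<epsilon>_def)
  qed
  have main: "\<exists>A c C \<epsilon>. \<forall>x'\<in>U. \<forall>\<xi>'. \<xi>' \<noteq> 0 \<longrightarrow> regular_SG_phase A c C \<epsilon> (star_Phi \<omega> k K \<psi>m x' \<xi>')"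
    if K: "max (max M1 M2) 1 \<le> K" and k: "0 < k" "k \<le> k0" for K k
  proof -
    have k': "0 < k" "k < \<delta>" using k k0 by auto
    define Q where "Q = localized_phase \<omega> k K \<psi>"
    define Qm where "Qm = localized_phase \<omega> k K \<psi>m"
    have smQ: "smooth_on ((N \<times> UNIV) \<times> UNIV) Qm"
      unfolding Qm_def by (rule smooth_on_localized_phase[OF sm N(1) _ c k']) auto
    obtain B where B: "\<And>a \<alpha>. 0 < B a \<alpha>"
      and Bd: "\<And>a \<alpha> x' s \<xi>. x' \<in> C \<Longrightarrow> \<bar>s\<bar> \<le> k \<Longrightarrow> \<xi> \<noteq> 0 \<Longrightarrow>
        \<bar>(dirder e_x ^^ a) ((dirder e_\<xi> ^^ \<alpha>) Q) ((x', s), \<xi>)\<bar> \<le> B a \<alpha> * norm \<xi> powi (1 - int \<alpha>)"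
      using localized_phase_symbol_bounds[OF C(1,3) c k', of K] unfolding Q_def by metis
    have "\<exists>b>0. \<forall>z\<in>(C \<times> {-k..k}) \<times> cball 0 \<rho>. \<bar>(dirder e_x ^^ a) ((dirder e_\<xi> ^^ \<alpha>) Qm) z\<bar> \<le> b" for a \<alpha>
    proof (rule compact_continuous_bound)
      show "compact ((C \<times> {-k..k}) \<times> cball (0::'m point) \<rho>)" using C by (intro compact_Times) auto
      have "continuous_on ((N \<times> UNIV) \<times> UNIV) ((dirder e_x ^^ a) ((dirder e_\<xi> ^^ \<alpha>) Qm))"
        by (intro smooth_on_imp_continuous_on smooth_on_dirder_funpow smQ)
      then show "continuous_on ((C \<times> {-k..k}) \<times> cball 0 \<rho>) ((dirder e_x ^^ a) ((dirder e_\<xi> ^^ \<alpha>) Qm))"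
        by (rule continuous_on_subset) (use C in auto)
    qed
    then obtain b where b: "\<And>a \<alpha>. 0 < b a \<alpha>"
      and bd: "\<And>a \<alpha> z. z \<in> (C \<times> {-k..k}) \<times> cball 0 \<rho> \<Longrightarrow> \<bar>(dirder e_x ^^ a) ((dirder e_\<xi> ^^ \<alpha>) Qm) z\<bar> \<le> b a \<alpha>"
      by metis
    have oS: "open ((N \<times> (UNIV::real set)) \<times> {\<xi>::'m point. \<rho> < norm \<xi>})"
      using N by (intro open_Times open_Collect_less continuous_intros) auto
    \<comment> \<open>\<open>localized_phase\<close> subtracts the value at x_n = 0 for the same
      covector, so agreement of the two phases is used at (y', s) and at (y', 0).\<close>
    have Qeq: "Qm z = Q z" if z: "z \<in> (N \<times> UNIV) \<times> {\<xi>. \<rho> < norm \<xi>}" for z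
    proof -
      obtain y' s \<xi> where zz: "z = ((y', s), \<xi>)" by (cases z) auto
      show ?thesis
      proof (cases "\<bar>s\<bar> < \<delta>")
        case True
        then show ?thesis using z \<delta>_pos eq[of "(y', s)" \<xi>] eq[of "(y', 0)" \<xi>]
          by (auto simp: zz Qm_def Q_def localized_phase_def strip_def abs_less_iff)
      next
        case False
        then show ?thesis
          using localized_phase_outer[OF c k'(1), of s K \<psi> y' \<xi>] localized_phase_outer[OF c k'(1), of s K \<psi>m y' \<xi>] k'
          by (simp add: zz Qm_def Q_def)
      qed
    qed
    \<comment> \<open>Sum of the constants of the two regimes, each converted to bracket
      powers.\<close>
    define B' where "B' a \<alpha> = B a \<alpha> * (\<langle>\<rho>\<rangle> / \<rho>) ^ \<alpha> + b a \<alpha> * \<langle>\<rho>\<rangle> ^ \<alpha>" for a \<alpha>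
    have nn: "0 \<le> B a \<alpha> * (\<langle>\<rho>\<rangle> / \<rho>) ^ \<alpha>" "0 \<le> b a \<alpha> * \<langle>\<rho>\<rangle> ^ \<alpha>" for a \<alpha>
      using B[of a \<alpha>] b[of a \<alpha>] \<open>0 < \<rho>\<close> japanese_bounds(1)[of \<rho>] by auto
    have bound: "\<bar>(dirder e_x ^^ a) ((dirder e_\<xi> ^^ \<alpha>) Qm) ((x', s), \<xi>)\<bar> \<le> B' a \<alpha> * \<langle>\<xi>\<rangle> powi (1 - int \<alpha>)"
      if x: "x' \<in> C" and s: "\<bar>s\<bar> \<le> k" for a \<alpha> x' s \<xi>
    proof (cases "norm \<xi> \<le> \<rho>")
      case True
      have "\<bar>(dirder e_x ^^ a) ((dirder e_\<xi> ^^ \<alpha>) Qm) ((x', s), \<xi>)\<bar> \<le> b a \<alpha> * 1"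
        using bd[of "((x', s), \<xi>)" a \<alpha>] x s True by (auto simp: abs_le_iff)
      also have "\<dots> \<le> b a \<alpha> * (\<langle>\<rho>\<rangle> ^ \<alpha> * \<langle>\<xi>\<rangle> powi (1 - int \<alpha>))"
        using japanese_powi_compact[OF True] b[of a \<alpha>] by (intro mult_left_mono) auto
      also have "\<dots> \<le> B' a \<alpha> * \<langle>\<xi>\<rangle> powi (1 - int \<alpha>)"
        using mult_nonneg_nonneg[OF nn(1)[of a \<alpha>], of "\<langle>\<xi>\<rangle> powi (1 - int \<alpha>)"] japanese_bounds(1)[of \<xi>]
        by (simp add: B'_def distrib_right mult.assoc)
      finally show ?thesis .
    next
      case False
      then have \<xi>: "\<xi> \<noteq> 0" "\<rho> \<le> norm \<xi>" using \<open>0 < \<rho>\<close> by auto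
      have "(dirder e_x ^^ a) ((dirder e_\<xi> ^^ \<alpha>) Qm) ((x', s), \<xi>) = (dirder e_x ^^ a) ((dirder e_\<xi> ^^ \<alpha>) Q) ((x', s), \<xi>)"
        by (intro dirder_funpow_cong_open[OF oS] Qeq) (use x C False in auto)
      then have "\<bar>(dirder e_x ^^ a) ((dirder e_\<xi> ^^ \<alpha>) Qm) ((x', s), \<xi>)\<bar> \<le> B a \<alpha> * norm \<xi> powi (1 - int \<alpha>)"
        using Bd[OF x s \<xi>(1)] by metis
      also have "\<dots> \<le> B a \<alpha> * ((\<langle>\<rho>\<rangle> / \<rho>) ^ \<alpha> * \<langle>\<xi>\<rangle> powi (1 - int \<alpha>))"
        using norm_powi_le_japanese[OF \<open>0 < \<rho>\<close> \<xi>(2)] B[of a \<alpha>] by (intro mult_left_mono) auto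
      also have "\<dots> \<le> B' a \<alpha> * \<langle>\<xi>\<rangle> powi (1 - int \<alpha>)"
        using mult_nonneg_nonneg[OF nn(2)[of a \<alpha>], of "\<langle>\<xi>\<rangle> powi (1 - int \<alpha>)"] japanese_bounds(1)[of \<xi>]
        by (simp add: B'_def distrib_right mult.assoc)
      finally show ?thesis .
    qed
    define M where "M = max K (max (B' 1 1) (B' 1 0))"
    have "regular_SG_phase (\<lambda>a \<alpha>. K + B' (if a = 0 then 1 else a) \<alpha> * (1 + k) ^ a) (1 / (1 + (M + 1) / \<epsilon>)) (1 + 2 * M) \<epsilon>
            (star_Phi \<omega> k K \<psi>m x' \<xi>')" if x: "x' \<in> U" for x' \<xi>'
    proof (rule regular_SG_phase_star_Phi[OF sm N(1) open_UNIV c k', where B = B' and K = K, folded Qm_def])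
      have xC: "x' \<in> C" using x UC by auto
      show "x' \<in> N" using xC C by auto
      then show "dirder e_\<xi> \<psi>m ((x', 0), (\<xi>', \<eta>)) = 0" for \<eta> by (rule mp(1))
      show "\<epsilon> \<le> ?f ((x', s), (\<xi>', \<eta>))" "?f ((x', s), (\<xi>', \<eta>)) \<le> K" if "\<bar>s\<bar> \<le> k" for s \<eta>
        using mb[OF xC, of s "(\<xi>', \<eta>)"] that k K by auto
      show "\<bar>(dirder e_x ^^ a) ((dirder e_\<xi> ^^ \<alpha>) Qm) ((x', s), (\<xi>', \<eta>))\<bar> \<le> B' a \<alpha> * \<langle>(\<xi>', \<eta>)\<rangle> powi (1 - int \<alpha>)"
        if "\<bar>s\<bar> \<le> k" for a \<alpha> s \<eta> using bound[OF xC that] .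
      show "dirder e_x (dirder e_\<xi> Qm) ((x', s), (\<xi>', \<eta>)) \<le> M" if "\<bar>s\<bar> \<le> k" for s \<eta>
        using bound[OF xC that, of 1 1 "(\<xi>', \<eta>)"] by (simp add: M_def)
      show "\<bar>dirder e_x Qm ((x', s), (\<xi>', \<eta>))\<bar> \<le> M * \<langle>(\<xi>', \<eta>)\<rangle>" if "\<bar>s\<bar> \<le> k" for s \<eta>
      proof -
        have "\<bar>dirder e_x Qm ((x', s), (\<xi>', \<eta>))\<bar> \<le> B' 1 0 * \<langle>(\<xi>', \<eta>)\<rangle>"
          using bound[OF xC that, of 1 0 "(\<xi>', \<eta>)"] by simp
        also have "\<dots> \<le> M * \<langle>(\<xi>', \<eta>)\<rangle>"
          using japanese_bounds(1)[of "(\<xi>', \<eta>)"] by (intro mult_right_mono) (auto simp: M_def)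
        finally show ?thesis .
      qed
      show "0 \<le> B' a \<alpha>" for a \<alpha> using nn[of a \<alpha>] by (simp add: B'_def)
    qed (use k0 in \<open>auto simp: M_def\<close>)
    then show ?thesis by blast
  qed
  show ?thesis
    by (rule exI[of _ "max (max M1 M2) 1"], rule conjI, simp, rule exI[of _ k0]) (use k0 main in auto)
qed

end

text \<open>For u > 0, u * \<omega>'(u) is the derivative of \<open>\<omega>\<close> with respect to
  log u, the scale-invariant quantity that governs a cutoff composed with a power of
  |\<xi>|.\<close>

lemma cutoff_deriv_bound:
  assumes "cutoff \<omega>"
  shows "\<exists>W>0. \<forall>u. \<bar>deriv \<omega> u * u\<bar> \<le> W"
proof -
  note sm = cutoff_properties(1)[OF assms] and d = cutoff_properties(7)[OF assms]
  have "deriv \<omega> u = dirder 1 \<omega> u" for u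
    using dirder_eq[OF d[of u, unfolded has_field_derivative_def]] by simp
  then have "continuous_on UNIV (\<lambda>u. deriv \<omega> u * u)"
    using smooth_on_imp_continuous_on[OF smooth_on_dirder[OF sm, of 1]]
    by (intro continuous_intros) (simp add: continuous_on_cong[OF refl, of UNIV "deriv \<omega>" "dirder 1 \<omega>"])
  then obtain W where W: "W > 0" "\<And>u. u \<in> {-1..1} \<Longrightarrow> \<bar>deriv \<omega> u * u\<bar> \<le> W"
    using compact_continuous_bound[of "{-1..1}" "\<lambda>u. deriv \<omega> u * u"] continuous_on_subset by blast
  \<comment> \<open>Beyond 1 the function takes its global minimum 0, so every such point is a local
    minimum.\<close>
  have "deriv \<omega> u = 0" if "1 < \<bar>u\<bar>" for u
    by (rule DERIV_local_min[OF d, of 1])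
      (use cutoff_properties(3)[OF assms, of u] cutoff_properties(4)[OF assms] that in auto)
  then have "\<bar>deriv \<omega> u * u\<bar> \<le> W" for u
    using W by (cases "\<bar>u\<bar> \<le> 1") (auto simp: abs_le_iff)
  then show ?thesis using W(1) by blast
qed

text \<open>
  A cutoff whose scale-invariant gradient \<open>|\<xi>| |\<nabla>\<theta>|\<close> is small: \<open>\<omega>\<close> is applied to a small power
  of \<open>|\<xi>|\<close>, so that the transition is spread over many dyadic shells.
\<close>

lemma slow_cutoff:
  assumes c: "cutoff \<omega>" and "0 < \<rho>" "0 < \<eta>"
  obtains \<theta> :: "'a::euclidean_space \<Rightarrow> real" and T where
    "smooth_on UNIV \<theta>" "open T" "0 \<in> T" "\<And>\<xi>. \<xi> \<in> T \<Longrightarrow> \<theta> \<xi> = 1"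
    "\<And>\<xi>. 0 \<le> \<theta> \<xi>" "\<And>\<xi>. \<theta> \<xi> \<le> 1" "\<And>\<xi>. \<rho> \<le> norm \<xi> \<Longrightarrow> \<theta> \<xi> = 0"
    "\<And>\<xi> v. \<xi> \<noteq> 0 \<Longrightarrow> \<bar>dirder v \<theta> \<xi>\<bar> * norm \<xi> \<le> \<eta> * norm v"
proof -
  obtain W where W: "W > 0" "\<And>u. \<bar>deriv \<omega> u * u\<bar> \<le> W" using cutoff_deriv_bound[OF c] by blast
  \<comment> \<open>The gradient estimate below ends with the factor 2 * e * W, which this choice
    makes equal to \<eta>.\<close>
  define e where "e = \<eta> / (2 * W)"
  have e: "e > 0" using W \<open>0 < \<eta>\<close> by (simp add: e_def)
  define u where "u \<xi> = ((norm \<xi>)\<^sup>2 / \<rho>\<^sup>2) powr e" for \<xi> :: 'a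
  define \<theta> where "\<theta> \<xi> = \<omega> (u \<xi>)" for \<xi>
  \<comment> \<open>The power u need not be smooth at \<xi> = 0. On T it stays below 1/2, so
    \<theta> is constantly 1 there and smoothness at the origin is immediate.\<close>
  define T where "T = {\<xi>::'a. (norm \<xi>)\<^sup>2 / \<rho>\<^sup>2 < (1/2) powr (1 / e)}"
  have T: "open T" "0 \<in> T" unfolding T_def
    using \<open>0 < \<rho>\<close> by (auto intro!: open_Collect_less continuous_intros)
  have one: "\<theta> \<xi> = 1" if "\<xi> \<in> T" for \<xi>
  proof -
    have "u \<xi> \<le> ((1/2) powr (1 / e)) powr e"
      unfolding u_def using that e by (intro powr_mono2) (auto simp: T_def)
    also have "\<dots> = 1/2" using e by (simp add: powr_powr)
    finally have "\<bar>u \<xi>\<bar> \<le> 1/2" by (simp add: u_def)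
    then show ?thesis unfolding \<theta>_def by (rule cutoff_properties(2)[OF c])
  qed
  have "smooth_on (- {0}) \<theta>"
    unfolding \<theta>_def u_def
  proof (rule smooth_on_compose[OF cutoff_properties(1)[OF c]])
    show "smooth_on (- {0}) (\<lambda>\<xi>::'a. ((norm \<xi>)\<^sup>2 / \<rho>\<^sup>2) powr e)"
    proof (rule smooth_on_compose[OF smooth_on_powr])
      show "smooth_on (- {0}) (\<lambda>\<xi>::'a. (norm \<xi>)\<^sup>2 / \<rho>\<^sup>2)"
        by (intro smooth_on_compose_linear[OF bounded_linear_divide] smooth_on_subset[OF smooth_on_norm_squared]) auto
    qed (use \<open>0 < \<rho>\<close> in auto)
  qed auto
  moreover have "smooth_on T \<theta>"
    by (rule smooth_on_cong_open[OF T(1) _ smooth_on_const[of T 1]]) (simp add: one)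
  ultimately have "smooth_on (- {0} \<union> T) \<theta>" by (intro smooth_on_Un_open T) auto
  moreover have "- {0} \<union> T = UNIV" using T by auto
  ultimately have sm: "smooth_on UNIV \<theta>" by simp
  have zero: "\<theta> \<xi> = 0" if "\<rho> \<le> norm \<xi>" for \<xi>
  proof -
    have "\<rho>\<^sup>2 \<le> (norm \<xi>)\<^sup>2" using that \<open>0 < \<rho>\<close> by (intro power_mono) auto
    then have "1 \<le> (norm \<xi>)\<^sup>2 / \<rho>\<^sup>2" using \<open>0 < \<rho>\<close> by simp
    then have "1 \<le> u \<xi>" unfolding u_def using e by (intro ge_one_powr_ge_zero) auto
    then show ?thesis unfolding \<theta>_def by (intro cutoff_properties(3)[OF c]) auto
  qed
  have grad: "\<bar>dirder v \<theta> \<xi>\<bar> * norm \<xi> \<le> \<eta> * norm v" if "\<xi> \<noteq> 0" for v \<xi>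
  proof -
    define r where "r = \<xi> \<bullet> \<xi>"
    have r: "r > 0" "r = norm \<xi> * norm \<xi>" using that
      by (simp_all add: r_def dot_square_norm power2_eq_square)
    have "((\<lambda>r. (r / \<rho>\<^sup>2) powr e) has_real_derivative e * (r / \<rho>\<^sup>2) powr (e - 1) * (1 / \<rho>\<^sup>2)) (at r)"
      by (rule DERIV_chain2[OF has_real_derivative_powr]) (use r \<open>0 < \<rho>\<close> DERIV_cdivide[OF DERIV_ident] in auto)
    then have "((\<lambda>r. \<omega> ((r / \<rho>\<^sup>2) powr e)) has_real_derivative
        deriv \<omega> ((r / \<rho>\<^sup>2) powr e) * (e * (r / \<rho>\<^sup>2) powr (e - 1) * (1 / \<rho>\<^sup>2))) (at r)"
      by (rule DERIV_chain2[OF cutoff_properties(7)[OF c]])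
    then have "((\<lambda>r. \<omega> ((r / \<rho>\<^sup>2) powr e)) has_derivative
        (*) (deriv \<omega> ((r / \<rho>\<^sup>2) powr e) * (e * (r / \<rho>\<^sup>2) powr (e - 1) * (1 / \<rho>\<^sup>2)))) (at (\<xi> \<bullet> \<xi>))"
      by (simp add: has_field_derivative_def r_def)
    moreover have "((\<lambda>\<xi>. \<xi> \<bullet> \<xi>) has_derivative (\<lambda>v. \<xi> \<bullet> v + v \<bullet> \<xi>)) (at \<xi>)"
      by (auto intro!: derivative_eq_intros)
    ultimately have "((\<lambda>\<xi>. \<omega> (((\<xi> \<bullet> \<xi>) / \<rho>\<^sup>2) powr e)) has_derivative
        (\<lambda>v. deriv \<omega> ((r / \<rho>\<^sup>2) powr e) * (e * (r / \<rho>\<^sup>2) powr (e - 1) * (1 / \<rho>\<^sup>2)) * (\<xi> \<bullet> v + v \<bullet> \<xi>))) (at \<xi>)"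
      using has_derivative_compose by fast
    then have "dirder v \<theta> \<xi> = deriv \<omega> ((r / \<rho>\<^sup>2) powr e) * (e * (r / \<rho>\<^sup>2) powr (e - 1) * (1 / \<rho>\<^sup>2)) * (\<xi> \<bullet> v + v \<bullet> \<xi>)"
      unfolding \<theta>_def[abs_def] u_def power2_norm_eq_inner by (rule dirder_eq)
    \<comment> \<open>u is proportional to r^e, hence has derivative e * u / r in r; this produces
      the combination bounded by W.\<close>
    also have "\<dots> = (deriv \<omega> (u \<xi>) * u \<xi>) * (2 * e) * ((\<xi> \<bullet> v) / r)"
      using r \<open>0 < \<rho>\<close> unfolding u_def power2_norm_eq_inner r_def[symmetric]
      by (simp add: powr_diff inner_commute)
    finally have "\<bar>dirder v \<theta> \<xi>\<bar> = \<bar>deriv \<omega> (u \<xi>) * u \<xi>\<bar> * (2 * e) * (\<bar>\<xi> \<bullet> v\<bar> / r)"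
      using e r by (simp add: abs_mult)
    also have "\<dots> \<le> W * (2 * e) * (norm \<xi> * norm v / r)"
      using W e r Cauchy_Schwarz_ineq2[of \<xi> v] by (intro mult_mono divide_right_mono) auto
    also have "\<dots> = \<eta> * norm v / norm \<xi>"
      using W that by (simp add: e_def r(2))
    finally show ?thesis using that by (simp add: pos_le_divide_eq)
  qed
  show ?thesis
    by (rule that[OF sm T one _ _ zero grad]) (auto simp: \<theta>_def cutoff_properties(4,5)[OF c])
qed

section \<open>Construction of a modification\<close>

context homogeneous_phase
begin

text \<open>(\<xi>', 1) represents the boundary value at a point where \<open>\<psi>\<close> is
  smooth even for \<xi>' = 0. If \<xi>' \<noteq> 0, the value is constant along the line in \<xi>_n.
  If \<xi>' = 0, the singular point splits this line, and homogeneity shows instead that the value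
  is 0 on both halves.\<close>

lemma boundary_value_eq:
  assumes "x' \<in> \<Omega>" "\<xi> \<noteq> 0"
  shows "\<psi> ((x', 0), \<xi>) = \<psi> ((x', 0), (fst \<xi>, 1))"
proof -
  have d: "((\<lambda>\<eta>. \<psi> ((x', 0), (\<xi>', \<eta>))) has_real_derivative 0) (at \<eta>)" if "(\<xi>', \<eta>) \<noteq> 0" for \<xi>' \<eta>
    using deriv_\<xi>[OF smooth_on_imp_differentiable[OF smooth], of "(x', 0)" \<xi>' \<eta>] normal_zero[OF assms(1) that] that assms(1) \<delta>_pos
    by (auto simp: strip_def)
  obtain \<xi>' \<eta> where \<xi>: "\<xi> = (\<xi>', \<eta>)" by (cases \<xi>) auto
  show ?thesis
  proof (cases "\<xi>' = 0")
    case False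
    then have "\<And>\<eta>. ((\<lambda>\<eta>. \<psi> ((x', 0), (\<xi>', \<eta>))) has_real_derivative 0) (at \<eta>)"
      by (intro d) (auto simp: zero_prod_def)
    then show ?thesis using DERIV_isconst_all unfolding \<xi> fst_conv by blast
  next
    case True
    have z: "\<psi> ((x', 0), (0, \<eta>)) = 0" if "\<eta> \<noteq> 0" for \<eta>
    proof -
      have nz: "(0::real ^ 'm, \<eta>) \<noteq> 0" using that by (simp add: zero_prod_def)
      have h: "\<psi> ((x', 0), (0, r * \<eta>)) = r * \<psi> ((x', 0), (0, \<eta>))" if "r > 0" for r
        using hom[of "(x', 0)" "(0, \<eta>)" r] that nz assms(1) \<delta>_pos by (auto simp: strip_def)
      \<comment> \<open>Euler's identity at r = 1: the radial derivative is the value itself, and it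
        also vanishes because it points along \<xi>_n.\<close>
      have "((\<lambda>r. r * \<psi> ((x', 0), (0, \<eta>))) has_real_derivative \<psi> ((x', 0), (0, \<eta>))) (at 1)"
        by (auto intro!: derivative_eq_intros)
      then have "((\<lambda>r. \<psi> ((x', 0), (0, r * \<eta>))) has_real_derivative \<psi> ((x', 0), (0, \<eta>))) (at 1)"
        by (rule has_field_derivative_transform_within_open[of _ _ _ "{0<..}"]) (use h in auto)
      moreover have "((\<lambda>r. \<psi> ((x', 0), (0, r * \<eta>))) has_real_derivative 0 * \<eta>) (at 1)"
        by (rule DERIV_chain2[where f = "\<lambda>\<eta>. \<psi> ((x', 0), (0, \<eta>))"]) (use d[of 0 \<eta>] nz in \<open>auto intro!: derivative_eq_intros\<close>)
      ultimately show ?thesis using DERIV_unique by fastforce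
    qed
    then show ?thesis using assms(2) True unfolding \<xi> by (simp add: zero_prod_def)
  qed
qed

text \<open>Both interpolated phases share their value at x_n = 0, so this value is kept. Besides
  smoothness, the work lies in the sign of the mixed derivative at the boundary and in the
  injectivity of the differential of the phase map.\<close>

lemma modification_near_0_exists:
  assumes ld: "local_diffeo_on (strip \<Omega> \<delta> \<times> - {0}) (phase_map \<psi>)"
    and N: "open N" "N \<subset>\<subset> \<Omega>" and "0 < \<rho>" and c: "cutoff \<omega>"
  shows "\<exists>\<psi>m. modification_near_0 N \<delta> \<rho> \<psi> \<psi>m"
proof -
  define C where "C = closure N"
  have C: "compact C" "C \<subseteq> \<Omega>" and NC: "N \<subseteq> C"
    using N closure_subset by (auto simp: compactly_contained_def C_def)
  obtain k \<epsilon> M where k: "k > 0" "\<epsilon> > 0"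
    and mb: "\<And>x' s \<xi>. x' \<in> C \<Longrightarrow> \<bar>s\<bar> \<le> k \<Longrightarrow> \<xi> \<noteq> 0 \<Longrightarrow>
      \<epsilon> \<le> dirder e_x (dirder e_\<xi> \<psi>) ((x', s), \<xi>) \<and> dirder e_x (dirder e_\<xi> \<psi>) ((x', s), \<xi>) \<le> M"
    using mixed_bounds[OF C] by metis
  have oS: "open (strip \<Omega> \<delta>)" by (rule open_strip[OF open_\<Omega>])
  have "\<exists>b>0. \<forall>x\<in>C \<times> {0}. \<forall>\<xi>. \<xi> \<noteq> 0 \<longrightarrow> \<bar>dirder e_x \<psi> (x, \<xi>)\<bar> \<le> b * norm \<xi> powi 1"
  proof (rule homogeneous_bound)
    show "continuous_on (strip \<Omega> \<delta> \<times> - {0}) (dirder e_x \<psi>)"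
      by (intro smooth_on_imp_continuous_on smooth_on_dirder smooth)
    show "dirder e_x \<psi> (x, r *\<^sub>R \<xi>) = r powi 1 * dirder e_x \<psi> (x, \<xi>)" if "x \<in> strip \<Omega> \<delta>" "\<xi> \<noteq> 0" "0 < r" for x \<xi> r
      by (rule dirder_homogeneous(1)[OF smooth oS _ that]) (simp add: hom)
  qed (use C \<delta>_pos in \<open>auto simp: strip_def intro!: compact_Times\<close>)
  then obtain b where b: "b > 0" "\<And>x' \<xi>. x' \<in> C \<Longrightarrow> \<xi> \<noteq> 0 \<Longrightarrow> \<bar>dirder e_x \<psi> ((x', 0), \<xi>)\<bar> \<le> b * norm \<xi>"
    by auto
  \<comment> \<open>The terms with the derivative of \<theta> will be at most (1 + b) * \<eta>0,
    that is, half of the lower bound \<open>min 1 \<epsilon>\<close> of the remaining terms.\<close>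
  define \<eta>0 where "\<eta>0 = min 1 \<epsilon> / (2 * (1 + b))"
  have \<eta>0: "0 < \<eta>0" using b k by (simp add: \<eta>0_def)
  obtain \<theta> :: "'m point \<Rightarrow> real" and T where sm\<theta>: "smooth_on UNIV \<theta>" and T: "open T" "0 \<in> T"
    and one: "\<And>\<xi>. \<xi> \<in> T \<Longrightarrow> \<theta> \<xi> = 1" and \<theta>01: "\<And>\<xi>. 0 \<le> \<theta> \<xi>" "\<And>\<xi>. \<theta> \<xi> \<le> 1"
    and zero: "\<And>\<xi>. \<rho> \<le> norm \<xi> \<Longrightarrow> \<theta> \<xi> = 0"
    and grad: "\<And>\<xi> v. \<xi> \<noteq> 0 \<Longrightarrow> \<bar>dirder v \<theta> \<xi>\<bar> * norm \<xi> \<le> \<eta>0 * norm v"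
    using slow_cutoff[OF c \<open>0 < \<rho>\<close> \<eta>0] by metis
  \<comment> \<open>Evaluating \<open>\<psi>\<close> at (\<xi>', 1) avoids the singularity at \<xi>'
    = 0, so L is smooth in all \<xi>.\<close>
  define L :: "'m cotangent \<Rightarrow> real" where "L z = \<psi> ((fst (fst z), 0), (fst (snd z), 1)) + snd (fst z) * snd (snd z)" for z
  define \<psi>m where "\<psi>m z = \<theta> (snd z) * L z + (1 - \<theta> (snd z)) * \<psi> z" for z
  let ?S = "strip N \<delta>"
  have S: "open ?S" "?S \<subseteq> strip \<Omega> \<delta>" using N NC C by (auto simp: strip_def intro!: open_Times)
  have oT: "open (?S \<times> T)" "open (?S \<times> - {0 :: 'm point})" "open (?S \<times> (UNIV :: 'm point set))"
    using S T by (auto intro!: open_Times)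
  have smL: "smooth_on (?S \<times> UNIV) L"
  proof -
    have "smooth_on (?S \<times> UNIV) (\<lambda>z::'m cotangent. \<psi> ((fst (fst z), 0), (fst (snd z), 1)))"
    proof (rule smooth_on_compose[OF smooth _ oT(3)])
      have "bounded_linear (\<lambda>z::'m cotangent. fst (fst z))" "bounded_linear (\<lambda>z::'m cotangent. fst (snd z))"
        by (auto intro!: bounded_linear_intros)
      then show "smooth_on (?S \<times> UNIV) (\<lambda>z::'m cotangent. ((fst (fst z), 0::real), (fst (snd z), 1::real)))"
        by (intro smooth_on_Pair smooth_on_const oT(3) smooth_on_linear)
    qed (use N NC C \<delta>_pos in \<open>auto simp: strip_def zero_prod_def\<close>)
    then show ?thesis unfolding L_def[abs_def]
      by (rule smooth_on_add[OF oT(3)]) (intro smooth_on_mult smooth_on_linear bounded_linear_components oT(3))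
  qed
  have sm\<psi>: "smooth_on (?S \<times> - {0}) \<psi>" by (rule smooth_on_subset[OF smooth]) (use S in auto)
  have mT: "\<psi>m z = L z" if "z \<in> ?S \<times> T" for z using that one by (auto simp: \<psi>m_def)
  have sm: "smooth_on (?S \<times> UNIV) \<psi>m"
  proof -
    have "smooth_on (?S \<times> - {0}) (\<lambda>z. \<theta> (snd z))"
      by (rule smooth_on_compose[OF sm\<theta> smooth_on_linear[OF bounded_linear_snd] oT(2)]) auto
    then have "smooth_on (?S \<times> - {0}) \<psi>m"
      unfolding \<psi>m_def[abs_def]
      by (intro smooth_on_add smooth_on_mult smooth_on_diff smooth_on_const oT(2) sm\<psi> smooth_on_subset[OF smL]) auto
    moreover have "smooth_on (?S \<times> T) \<psi>m"
      by (rule smooth_on_cong_open[OF oT(1) mT[symmetric] smooth_on_subset[OF smL]]) auto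
    ultimately have "smooth_on (?S \<times> - {0} \<union> ?S \<times> T) \<psi>m" by (rule smooth_on_Un_open[OF oT(2,1)])
    moreover have "?S \<times> - {0} \<union> ?S \<times> T = ?S \<times> UNIV" using T by auto
    ultimately show ?thesis by simp
  qed
  have bval: "\<psi>m ((x', 0), \<xi>) = \<psi> ((x', 0), (fst \<xi>, 1))" if "x' \<in> N" for x' \<xi>
  proof (cases "\<xi> = 0")
    case True then show ?thesis using one T by (simp add: \<psi>m_def L_def)
  next
    case False
    have "x' \<in> \<Omega>" using that NC C by auto
    from boundary_value_eq[OF this False] show ?thesis by (simp add: \<psi>m_def L_def algebra_simps)
  qed
  have zS: "((x', 0), \<xi>) \<in> ?S \<times> UNIV" if "x' \<in> N" for x' and \<xi> :: "'m point" using that \<delta>_pos by (auto simp: strip_def)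
  have d: "\<psi>m differentiable (at z)" "dirder v \<psi>m differentiable (at z)" if "z \<in> ?S \<times> UNIV" for v z
    using smooth_on_imp_differentiable[OF sm that] smooth_on_imp_differentiable[OF smooth_on_dirder[OF sm] that] by auto
  have d\<psi>: "\<psi> differentiable (at ((x', s), \<xi>))" "dirder v \<psi> differentiable (at ((x', s), \<xi>))"
    if "x' \<in> N" "\<bar>s\<bar> < \<delta>" "\<xi> \<noteq> 0" for v x' s \<xi>
    using smooth_on_imp_differentiable[OF sm\<psi>, of "((x', s), \<xi>)"]
      smooth_on_imp_differentiable[OF smooth_on_dirder[OF sm\<psi>], of "((x', s), \<xi>)" v] that by (auto simp: strip_def abs_less_iff)
  have nz: "dirder e_\<xi> \<psi>m ((x', 0), \<xi>) = 0" if "x' \<in> N" for x' \<xi>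
  proof -
    obtain \<xi>' \<eta> where \<xi>: "\<xi> = (\<xi>', \<eta>)" by (cases \<xi>) auto
    show ?thesis
      using deriv_\<xi>[OF d(1)[OF zS[OF that]], of \<xi>' \<eta>] DERIV_unique[OF _ DERIV_const] unfolding \<xi> by (simp add: bval[OF that])
  qed
  have dL: "dirder e_\<xi> L ((x', s), \<xi>) = s" if "((x', s), \<xi>) \<in> ?S \<times> UNIV" for x' s \<xi>
  proof -
    obtain \<xi>' \<eta> where \<xi>: "\<xi> = (\<xi>', \<eta>)" by (cases \<xi>) auto
    have "((\<lambda>\<eta>. L ((x', s), (\<xi>', \<eta>))) has_real_derivative s) (at \<eta>)"
      unfolding L_def by (auto intro!: derivative_eq_intros)
    then show ?thesis
      using DERIV_unique[OF deriv_\<xi>[OF smooth_on_imp_differentiable[OF smL]]] that unfolding \<xi> by blast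
  qed
  have mpos: "0 < dirder e_x (dirder e_\<xi> \<psi>m) ((x', 0), \<xi>)" if x: "x' \<in> N" for x' \<xi>
  proof (cases "\<xi> = 0")
    case True
    have "dirder e_x (dirder e_\<xi> \<psi>m) ((x', 0), \<xi>) = dirder e_x (\<lambda>z::'m cotangent. snd (fst z)) ((x', 0), \<xi>)"
    proof (rule dirder_cong_open[OF oT(1)])
      show "((x', 0), \<xi>) \<in> ?S \<times> T" using x True T \<delta>_pos by (auto simp: strip_def)
      show "dirder e_\<xi> \<psi>m z = snd (fst z)" if "z \<in> ?S \<times> T" for z
      proof -
        have "dirder e_\<xi> \<psi>m z = dirder e_\<xi> L z" by (rule dirder_cong_open[OF oT(1) that mT])
        then show ?thesis using dL that by (cases z) auto
      qed
    qed
    also have "\<dots> = 1"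
      by (subst dirder_eq[OF bounded_linear_imp_has_derivative[OF bounded_linear_components(1)]]) simp
    finally show ?thesis by simp
  next
    case False
    obtain \<xi>' \<eta> where \<xi>: "\<xi> = (\<xi>', \<eta>)" by (cases \<xi>) auto
    define D where "D = dirder (0, 1) \<theta> \<xi>"
    have "((\<lambda>\<eta>. \<theta> (\<xi>', \<eta>)) has_real_derivative D) (at \<eta>)"
      using has_real_derivative_line[of \<theta> "(\<xi>', 0)" 1 \<eta> "(0, 1)"] smooth_on_imp_differentiable[OF sm\<theta>]
      by (simp add: D_def \<xi>)
    then have d1: "dirder e_\<xi> \<psi>m ((x', s), \<xi>) = D * L ((x', s), \<xi>) + \<theta> \<xi> * s + (1 - \<theta> \<xi>) * dirder e_\<xi> \<psi> ((x', s), \<xi>) - D * \<psi> ((x', s), \<xi>)"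
      if s: "\<bar>s\<bar> < \<delta>" for s
    proof -
      assume D: "((\<lambda>\<eta>. \<theta> (\<xi>', \<eta>)) has_real_derivative D) (at \<eta>)"
      have zz: "((x', s), \<xi>) \<in> ?S \<times> UNIV" using x s by (auto simp: strip_def)
      have l: "((\<lambda>\<eta>. L ((x', s), (\<xi>', \<eta>))) has_real_derivative s) (at \<eta>)"
        unfolding L_def by (auto intro!: derivative_eq_intros)
      have p: "((\<lambda>\<eta>. \<psi> ((x', s), (\<xi>', \<eta>))) has_real_derivative dirder e_\<xi> \<psi> ((x', s), \<xi>)) (at \<eta>)"
        using deriv_\<xi> d\<psi>(1)[OF x s False] unfolding \<xi> by blast
      have "((\<lambda>\<eta>. \<psi>m ((x', s), (\<xi>', \<eta>))) has_real_derivative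
          D * L ((x', s), \<xi>) + \<theta> \<xi> * s + (1 - \<theta> \<xi>) * dirder e_\<xi> \<psi> ((x', s), \<xi>) - D * \<psi> ((x', s), \<xi>)) (at \<eta>)"
        unfolding \<psi>m_def using D l p by (auto intro!: derivative_eq_intros simp: \<xi>)
      then show ?thesis using DERIV_unique[OF deriv_\<xi>[OF d(1)]] zz unfolding \<xi> by blast
    qed
    have "((\<lambda>s. D * L ((x', s), \<xi>) + \<theta> \<xi> * s + (1 - \<theta> \<xi>) * dirder e_\<xi> \<psi> ((x', s), \<xi>) - D * \<psi> ((x', s), \<xi>))
        has_real_derivative D * \<eta> + \<theta> \<xi> + (1 - \<theta> \<xi>) * dirder e_x (dirder e_\<xi> \<psi>) ((x', 0), \<xi>) - D * dirder e_x \<psi> ((x', 0), \<xi>)) (at 0)"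
    proof -
      have "((\<lambda>s. L ((x', s), \<xi>)) has_real_derivative \<eta>) (at 0)"
        unfolding L_def \<xi> by (auto intro!: derivative_eq_intros)
      moreover have "((\<lambda>s. \<psi> ((x', s), \<xi>)) has_real_derivative dirder e_x \<psi> ((x', 0), \<xi>)) (at 0)"
        "((\<lambda>s. dirder e_\<xi> \<psi> ((x', s), \<xi>)) has_real_derivative dirder e_x (dirder e_\<xi> \<psi>) ((x', 0), \<xi>)) (at 0)"
        using deriv_x[OF d\<psi>(1)[OF x _ False]] deriv_x[OF d\<psi>(2)[OF x _ False]] \<delta>_pos by auto
      ultimately show ?thesis by (auto intro!: derivative_eq_intros)
    qed
    then have "((\<lambda>s. dirder e_\<xi> \<psi>m ((x', s), \<xi>)) has_real_derivative
        D * \<eta> + \<theta> \<xi> + (1 - \<theta> \<xi>) * dirder e_x (dirder e_\<xi> \<psi>) ((x', 0), \<xi>) - D * dirder e_x \<psi> ((x', 0), \<xi>)) (at 0)"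
      by (rule has_field_derivative_transform_within_open[of _ _ _ "{-\<delta><..<\<delta>}"])
        (use \<delta>_pos d1 in \<open>auto simp: abs_less_iff\<close>)
    then have "dirder e_x (dirder e_\<xi> \<psi>m) ((x', 0), \<xi>) =
        D * \<eta> + \<theta> \<xi> + (1 - \<theta> \<xi>) * dirder e_x (dirder e_\<xi> \<psi>) ((x', 0), \<xi>) - D * dirder e_x \<psi> ((x', 0), \<xi>)"
      using DERIV_unique[OF deriv_x[OF d(2)[OF zS[OF x]]]] by blast
    \<comment> \<open>Convex combination of the mixed derivative 1 of L and that of
      \<open>\<psi>\<close>, which is at least \<epsilon>.\<close>
    moreover have "min 1 \<epsilon> \<le> \<theta> \<xi> + (1 - \<theta> \<xi>) * dirder e_x (dirder e_\<xi> \<psi>) ((x', 0), \<xi>)"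
    proof -
      have "\<theta> \<xi> * min 1 \<epsilon> + (1 - \<theta> \<xi>) * min 1 \<epsilon> \<le> \<theta> \<xi> * 1 + (1 - \<theta> \<xi>) * dirder e_x (dirder e_\<xi> \<psi>) ((x', 0), \<xi>)"
        using \<theta>01[of \<xi>] mb[of x' 0 \<xi>] subsetD[OF NC x] False k
        by (intro add_mono mult_left_mono) (auto simp: min_le_iff_disj)
      then show ?thesis by (simp add: algebra_simps)
    qed
    \<comment> \<open>D multiplies the x_n-derivative of L - \<psi> at the boundary. It is of size
      |\<xi>|, so the bound on |\<xi>| times the gradient of \<theta> suffices.\<close>
    moreover have "\<bar>D * \<eta> - D * dirder e_x \<psi> ((x', 0), \<xi>)\<bar> \<le> min 1 \<epsilon> / 2"
    proof -
      have "\<bar>\<eta>\<bar> \<le> norm \<xi>" unfolding \<xi> by (metis norm_snd_le real_norm_def)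
      moreover have "\<bar>dirder e_x \<psi> ((x', 0), \<xi>)\<bar> \<le> b * norm \<xi>" using b(2) x NC False by blast
      ultimately have "\<bar>\<eta> - dirder e_x \<psi> ((x', 0), \<xi>)\<bar> \<le> (1 + b) * norm \<xi>" by (simp add: algebra_simps)
      then have "\<bar>D\<bar> * \<bar>\<eta> - dirder e_x \<psi> ((x', 0), \<xi>)\<bar> \<le> \<bar>D\<bar> * ((1 + b) * norm \<xi>)"
        by (rule mult_left_mono) simp
      also have "\<dots> = (1 + b) * (\<bar>D\<bar> * norm \<xi>)" by simp
      also have "\<dots> \<le> (1 + b) * \<eta>0"
        using grad[OF False, of "(0, 1)"] b by (intro mult_left_mono) (auto simp: D_def norm_Pair)
      also have "\<dots> = min 1 \<epsilon> / 2" using b(1) by (simp add: \<eta>0_def divide_simps)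
      finally show ?thesis by (simp add: abs_mult[symmetric] right_diff_distrib)
    qed
    moreover have "0 < min 1 \<epsilon>" using k by simp
    ultimately show ?thesis by linarith
  qed
  have bij: "bij (frechet_derivative (phase_map \<psi>m) (at ((x', 0), \<xi>)))" if x: "x' \<in> N" for x' \<xi>
  proof -
    \<comment> \<open>A kernel vector at \<open>?z\<close> has no covector part, and
      \<open>mpos\<close> removes its normal base part. What remains is tangential, and there the
      second derivatives of \<open>\<psi>m\<close> at \<open>?z\<close> and of \<open>\<psi>\<close>
      at \<open>?y\<close> agree, because boundary values depend on \<xi>' only. So the vector lies
      in the kernel at \<open>?y\<close>, where the differential is injective.\<close>
    let ?z = "((x', 0), \<xi>)" and ?y = "((x', 0), (fst \<xi>, 1)) :: 'm cotangent"
    have y: "?y \<in> strip \<Omega> \<delta> \<times> - {0}" using x NC C \<delta>_pos by (auto simp: strip_def zero_prod_def)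
    have y': "(fst \<xi>, 1) \<noteq> (0 :: 'm point)" by (simp add: zero_prod_def)
    have hd: "(phase_map \<psi>m has_derivative (\<lambda>v. (\<Sum>b\<in>Basis. dirder v (dirder (0, b) \<psi>m) ?z *\<^sub>R b, snd v))) (at ?z)"
      by (rule phase_map_has_derivative[OF oT(3) sm zS[OF x]])
    have hy: "(phase_map \<psi> has_derivative (\<lambda>v. (\<Sum>b\<in>Basis. dirder v (dirder (0, b) \<psi>) ?y *\<^sub>R b, snd v))) (at ?y)"
      by (rule phase_map_has_derivative[OF _ smooth y]) (use oS in \<open>auto intro: open_Times\<close>)
    have injy: "inj (\<lambda>v. (\<Sum>b\<in>Basis. dirder v (dirder (0, b) \<psi>) ?y *\<^sub>R b, snd v))"
      using bij_is_inj[OF local_diffeo_on_bij_frechet_derivative[OF ld y]] frechet_derivative_at[OF hy] by simp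
    have "v = 0" if v: "(\<Sum>b\<in>Basis. dirder v (dirder (0, b) \<psi>m) ?z *\<^sub>R b, snd v) = 0" for v :: "'m cotangent"
    proof -
      have v0: "dirder v (dirder (0, b) \<psi>m) ?z = 0" if "b \<in> Basis" for b
      proof -
        have "(\<Sum>b\<in>Basis. dirder v (dirder (0, b) \<psi>m) ?z *\<^sub>R b) = 0" using v by (simp add: zero_prod_def)
        then show ?thesis using inner_sum_left_Basis[OF that, of "\<lambda>b. dirder v (dirder (0, b) \<psi>m) ?z"] by simp
      qed
      obtain v' vn where v': "v = ((v', vn), 0)" using v by (cases v) (auto simp: zero_prod_def)
      have "(0, 1) \<in> (Basis :: 'm point set)" by (simp add: Basis_prod_def)
      from v0[OF this] have "vn = 0"
        using dirder_tangential[OF d(2)[OF zS[OF x]] N(1) x nz, of v' vn] mpos[OF x, of \<xi>] by (simp add: v')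
      then have v'': "v = ((v', 0), 0)" using v' by simp
      have near: "eventually (\<lambda>t. x' + t *\<^sub>R v' \<in> N) (nhds 0)"
        using N(1) x
        by (intro topological_tendstoD[of "\<lambda>t. x' + t *\<^sub>R v'" x']) (auto intro!: tendsto_eq_intros simp: filterlim_ident)
      have tang: "dirder v (dirder (0, b) \<psi>) ?y = 0" if b: "b \<in> Basis" for b
      proof (cases "b = (0, 1)")
        case True
        have "dirder e_\<xi> \<psi> ((y', 0), (fst \<xi>, 1)) = 0" if "y' \<in> N" for y'
          using normal_zero that NC C y' by blast
        then show ?thesis
          using dirder_tangential[OF d\<psi>(2)[OF x _ y'] N(1) x, of _ 0 v' 0] \<delta>_pos True by (simp add: v'')
      next
        case False
        then obtain w where w: "b = (w, 0)" using b by (auto simp: Basis_prod_def)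
        have q: "dirder (0, (w, 0)) \<psi>m ((y', 0), \<xi>) = dirder (0, (w, 0)) \<psi> ((y', 0), (fst \<xi>, 1))" if "y' \<in> N" for y'
          by (rule dirder_line_cong[OF d(1)[OF zS[OF that]] d\<psi>(1)[OF that _ y']]) (use \<delta>_pos bval[OF that] in auto)
        have "dirder v (dirder (0, b) \<psi>m) ?z = dirder v (dirder (0, b) \<psi>) ?y"
          by (rule dirder_line_cong[OF d(2)[OF zS[OF x]] d\<psi>(2)[OF x _ y']])
            (use \<delta>_pos q in \<open>auto simp: v'' w intro: eventually_mono[OF near]\<close>)
        then show ?thesis using v0[OF b] by simp
      qed
      have z0: "dirder 0 (dirder (0, b) \<psi>) ?y = 0" for b
        using linear_0[OF has_derivative_linear[OF has_derivative_dirder[OF d\<psi>(2)[OF x _ y']]]] \<delta>_pos by simp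
      have s: "(\<Sum>b\<in>Basis. dirder v (dirder (0, b) \<psi>) ?y *\<^sub>R b) = 0" by (rule sum.neutral) (simp add: tang)
      have "snd v = 0" by (simp add: v'')
      then show "v = 0" by (intro injD[OF injy, of v 0]) (simp add: s z0)
    qed
    moreover have lin: "linear (\<lambda>v. (\<Sum>b\<in>Basis. dirder v (dirder (0, b) \<psi>m) ?z *\<^sub>R b, snd v))"
      using hd by (rule has_derivative_linear)
    ultimately have "inj (\<lambda>v. (\<Sum>b\<in>Basis. dirder v (dirder (0, b) \<psi>m) ?z *\<^sub>R b, snd v))"
      by (simp add: linear_injective_0[OF lin])
    then have "bij (\<lambda>v. (\<Sum>b\<in>Basis. dirder v (dirder (0, b) \<psi>m) ?z *\<^sub>R b, snd v))"
      using linear_injective_imp_surjective[OF lin] by (simp add: bij_def)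
    then show ?thesis using frechet_derivative_at[OF hd] by simp
  qed
  have "modification_near_0 N \<delta> \<rho> \<psi> \<psi>m"
    unfolding modification_near_0_def boundary_phase_def
    using sm zero bij bval by (auto simp: \<psi>m_def)
  then show ?thesis by blast
qed

end

theorem theorem1p1:
  fixes \<Omega>' :: "(real ^ 'm::finite) set"
    and \<delta> :: real
    and \<omega> :: "real \<Rightarrow> real"
    and V :: "'m cotangent set"
    and \<kappa> :: "'m cotangent \<Rightarrow> 'm cotangent"
    and \<psi> :: "'m cotangent \<Rightarrow> real"
  assumes "open \<Omega>'" and "connected \<Omega>'"
    and "0 < \<delta>" and "\<delta> \<le> 1"
    and "cutoff \<omega>"
    and "homogeneous_symplectomorphism V \<kappa>"
    and "boundary_preserving V \<kappa>"
    and "admissible V \<kappa>"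
    and "phase_represents (strip \<Omega>' \<delta>) \<psi> V \<kappa>"
  shows
    \<comment> \<open>homogeneous \<open>\<psi>\<close>: all constants are uniform, those in (P1) as long as \<open>\<xi>'\<close> stays away from 0\<close>
    "(\<forall>U'. U' \<subset>\<subset> \<Omega>' \<longrightarrow>
        (\<exists>K0>0. \<exists>k0>0. 2 * k0 < \<delta> \<and> (\<forall>K\<ge>K0. \<forall>k. 0 < k \<and> k \<le> k0 \<longrightarrow>
          (\<exists>c C \<epsilon>. \<forall>r>0. \<exists>A. \<forall>x'\<in>U'. \<forall>\<xi>'. r \<le> norm \<xi>' \<longrightarrow>
             regular_SG_phase A c C \<epsilon> (star_Phi \<omega> k K \<psi> x' \<xi>')))))
     \<and> \<comment> \<open>\<open>\<psi>\<close> can be modified near \<open>\<xi> = 0\<close>\<close>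
     (\<forall>N. open N \<and> N \<subset>\<subset> \<Omega>' \<longrightarrow> (\<forall>\<rho>>0. \<exists>\<psi>m. modification_near_0 N \<delta> \<rho> \<psi> \<psi>m))
     \<and> \<comment> \<open>for any modification all constants are uniform in all \<open>\<xi>' \<noteq> 0\<close>\<close>
     (\<forall>N \<rho> \<psi>m. open N \<and> N \<subseteq> \<Omega>' \<and> 0 < \<rho> \<and> modification_near_0 N \<delta> \<rho> \<psi> \<psi>m \<longrightarrow>
        (\<forall>U'. U' \<subset>\<subset> N \<longrightarrow>
          (\<exists>K0>0. \<exists>k0>0. 2 * k0 < \<delta> \<and> (\<forall>K\<ge>K0. \<forall>k. 0 < k \<and> k \<le> k0 \<longrightarrow>
            (\<exists>A c C \<epsilon>. \<forall>x'\<in>U'. \<forall>\<xi>'. \<xi>' \<noteq> 0 \<longrightarrow>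
               regular_SG_phase A c C \<epsilon> (star_Phi \<omega> k K \<psi>m x' \<xi>'))))))"
proof (intro conjI allI impI)
  have ld: "local_diffeo_on (strip \<Omega>' \<delta> \<times> - {0}) (phase_map \<psi>)"
    using assms(9) by (simp add: phase_represents_def)
  interpret homogeneous_phase \<Omega>' \<delta> \<psi>
    using assms by (intro phase_represents_homogeneous_phase)
  note c = \<open>cutoff \<omega>\<close>
  show "\<exists>K0>0. \<exists>k0>0. 2 * k0 < \<delta> \<and> (\<forall>K\<ge>K0. \<forall>k. 0 < k \<and> k \<le> k0 \<longrightarrow>
          (\<exists>c C \<epsilon>. \<forall>r>0. \<exists>A. \<forall>x'\<in>U'. \<forall>\<xi>'. r \<le> norm \<xi>' \<longrightarrow>
             regular_SG_phase A c C \<epsilon> (star_Phi \<omega> k K \<psi> x' \<xi>')))"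
    if "U' \<subset>\<subset> \<Omega>'" for U'
    using regular_SG_phase_homogeneous[OF that c] .
  show "\<exists>\<psi>m. modification_near_0 N \<delta> \<rho> \<psi> \<psi>m" if "open N \<and> N \<subset>\<subset> \<Omega>'" "0 < \<rho>" for N \<rho>
    using modification_near_0_exists[OF ld _ _ that(2) c] that(1) by blast
  show "\<exists>K0>0. \<exists>k0>0. 2 * k0 < \<delta> \<and> (\<forall>K\<ge>K0. \<forall>k. 0 < k \<and> k \<le> k0 \<longrightarrow>
            (\<exists>A c C \<epsilon>. \<forall>x'\<in>U'. \<forall>\<xi>'. \<xi>' \<noteq> 0 \<longrightarrow>
               regular_SG_phase A c C \<epsilon> (star_Phi \<omega> k K \<psi>m x' \<xi>')))"
    if "open N \<and> N \<subseteq> \<Omega>' \<and> 0 < \<rho> \<and> modification_near_0 N \<delta> \<rho> \<psi> \<psi>m" "U' \<subset>\<subset> N" for N \<rho> \<psi>m U'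
    using regular_SG_phase_modified[OF _ _ _ _ that(2) c, of \<rho> \<psi>m] that(1) by blast
qed

end
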